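(* Let $(\Omega_t)$ be an L-admissible family and $p\in\partial_\infty\Omega_0$. Suppose that the following conditions hold: (i) there exists a Dini-smooth closed Jordan curve $C$ in the Riemann sphere $\overline{\mathbb{C}}$ such that $p\in C$ and one of the two connected components of $\overline{\mathbb{C}}\setminus C$ is contained in $\Omega_0$; (ii) for each $t>0$ there exists a Dini-smooth closed Jordan curve $C_t$ in the Riemann sphere such that $p\in C_t$ and $\Omega_t\cap C_t=\emptyset$. Then the family $(\Omega_t)$ is chordally admissible.
   Context: $\mathbb{D}=\{z:|z|<1\}$, $\mathbb{T}=\partial\mathbb{D}$; $\angle\lim$ denotes angular (non-tangential) limit; $\partial_\infty E$ is the boundary of $E$ in the Riemann sphere $\overline{\mathbb{C}}$. A closed Jordan curve $C\subset\mathbb{C}$ is Dini-smooth if there is a bijective map $h$ of $\mathbb{T}$ onto $C$ such that $\mathbb{R}\ni\theta\mapsto h(e^{i\theta})\in C$ has non-vanishing Dini-continuous derivative (Dini-continuous: the modulus of continuity $\omega$ satisfies $\int_0^1\omega(x)x^{-1}dx<\infty$). A closed Jordan curve $C\subset\overline{\mathbb{C}}$ is Dini-smooth if for some (equivalently, every) Möbius transformation $T$ sending $C$ into $\mathbb{C}$, $T(C)$ is Dini-smooth. $r(D,z)$ is the conformal radius of a simply connected domain $D\subsetneq\mathbb{C}$ with respect to $z\in D$: $r(D,z)=|f'(0)|$ for $f$ a conformal map of $\mathbb{D}$ onto $D$ with $f(0)=z$. An L-admissible family (of order $d\in[1,+\infty]$; if unspecified, of some order) is a family $(\Omega_t)_{t\ge0}$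 of simply connected domains $\Omega_t\subset\mathbb{C}$ such that (AF1) $\Omega_s\subset\Omega_t\ne\mathbb{C}$ whenever $t\ge s\ge0$; (AF2) there is $w_*\in\Omega_0$ such that $t\mapsto r(\Omega_t,w_* )$ is locally absolutely continuous on $[0,+\infty)$ with derivative in $L^d_{loc}$. Prime ends and conformal embedding: $\mathrm{P}(D)$ denotes the set of all (Carathéodory) prime ends of a simply connected domain $D$; $\mathrm{P}(\mathbb{D})$ is identified with $\mathbb{T}$. A conformal map $F$ of $D$ induces a bijection $F^{p.e.}:\mathrm{P}(D)\to\mathrm{P}(F(D))$. Let $G\subset\mathbb{D}$ be a simply connected domain, $\psi$ a conformal map of $\mathbb{D}$ onto $G$, $P\in\mathrm{P}(G)$, $\zeta_0:=(\psi^{p.e.})^{-1}(P)$. $G$ is embedded in $\mathbb{D}$ conformally at $P$ if $z_0:=\angle\lim_{\zeta\to\zeta_0}\psi(\zeta)$ exists and belongs to $\mathbb{T}$, and $\angle\lim_{\zeta\to\zeta_0}\frac{\psi(\zeta)-z_0}{\zeta-\zeta_0}\ne\infty$. For hyperbolic simply connected domains $\Omega_1\subset\Omega_2\subset\mathbb{C}$, $\Omega_1$ is embedded in $\Omega_2$ conformally at $P_1\in\mathrm{P}(\Omega_1)$ if there is a conformal map $\phi$ of $\Omega_2$ onto $\mathbb{D}$ such that $\phi(\Omega_1)$ is embedded in $\mathbb{D}$ conformally at $(\phi|_{\Omega_1})^{p.e.}(P_1)$. (These notions do not depend on the choice of $\psi$ and $\phi$.) An L-admissible family $(\Omega_t)$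 is chordally admissible if there exists $P_0\in\mathrm{P}(\Omega_0)$ such that for each $t\ge0$ the domain $\Omega_0$ is embedded in $\Omega_t$ conformally at $P_0$. *)

theory Defs
  imports "HOL-Complex_Analysis.Complex_Analysis"
begin

section \<open>The Riemann sphere\<close>

text \<open>Points of the Riemann sphere are values of type \<open>complex option\<close>, with \<open>None\<close> as the point
  at infinity; a set \<open>E\<close> of complex numbers is \<open>Some ` E\<close> as a subset of the sphere.\<close>

abbreviation riemann_sphere :: "complex option topology" where
  "riemann_sphere \<equiv> Alexandroff_compactification euclidean"

definition boundary_inf :: "complex set \<Rightarrow> complex option set" where
  "boundary_inf E = riemann_sphere frontier_of (Some ` E)"

definition chordal_dist :: "complex \<Rightarrow> complex \<Rightarrow> real" where
  "chordal_dist z w = 2 * cmod (z - w) / (sqrt (1 + (cmod z)\<^sup>2) * sqrt (1 + (cmod w)\<^sup>2))"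

fun moebius_sphere ::
  "complex \<Rightarrow> complex \<Rightarrow> complex \<Rightarrow> complex \<Rightarrow> complex option \<Rightarrow> complex option" where
  "moebius_sphere a b c d None = (if c = 0 then None else Some (a / c))"
| "moebius_sphere a b c d (Some z) = (if c * z + d = 0 then None else Some (moebius a b c d z))"

definition moebius_transformation :: "(complex option \<Rightarrow> complex option) \<Rightarrow> bool" where
  "moebius_transformation T \<longleftrightarrow> (\<exists>a b c d. a * d - b * c \<noteq> 0 \<and> T = moebius_sphere a b c d)"

section \<open>Dini-smooth closed Jordan curves\<close>

text \<open>Extended-valued, so that an unbounded \<open>g\<close> has modulus \<open>\<infinity>\<close> rather than a junk value.\<close>

definition modulus_of_continuity :: "(real \<Rightarrow> complex) \<Rightarrow> real \<Rightarrow> ennreal" where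
  "modulus_of_continuity g x =
     (SUP (s, t) \<in> {(s, t). \<bar>s - t\<bar> \<le> x}. ennreal (cmod (g s - g t)))"

definition dini_continuous :: "(real \<Rightarrow> complex) \<Rightarrow> bool" where
  "dini_continuous g \<longleftrightarrow>
     (\<integral>\<^sup>+x\<in>{0<..1}. modulus_of_continuity g x / ennreal x \<partial>lborel) < \<infinity>"

definition dini_smooth_plane :: "complex set \<Rightarrow> bool" where
  "dini_smooth_plane C \<longleftrightarrow>
     (\<exists>h g. bij_betw h (sphere 0 1) C \<and>
        (\<forall>\<theta>. ((\<lambda>\<theta>. h (cis \<theta>)) has_vector_derivative g \<theta>) (at \<theta>)) \<and>
        (\<forall>\<theta>. g \<theta> \<noteq> 0) \<and> dini_continuous g)"

definition closed_jordan_curve :: "complex option set \<Rightarrow> bool" where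
  "closed_jordan_curve C \<longleftrightarrow>
     subtopology riemann_sphere C homeomorphic_space top_of_set (sphere (0::complex) 1)"

definition dini_smooth_jordan_curve :: "complex option set \<Rightarrow> bool" where
  "dini_smooth_jordan_curve C \<longleftrightarrow> closed_jordan_curve C \<and>
     (\<exists>T C'. moebius_transformation T \<and> T ` C = Some ` C' \<and> dini_smooth_plane C')"

section \<open>Conformal maps, conformal radius, L-admissible families\<close>

definition simply_connected_domain :: "complex set \<Rightarrow> bool" where
  "simply_connected_domain D \<longleftrightarrow> D \<noteq> {} \<and> open D \<and> connected D \<and> simply_connected D"

definition conformal_onto :: "(complex \<Rightarrow> complex) \<Rightarrow> complex set \<Rightarrow> complex set \<Rightarrow> bool" where
  "conformal_onto f D E \<longleftrightarrow> f holomorphic_on D \<and> bij_betw f D E"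

definition conformal_radius :: "complex set \<Rightarrow> complex \<Rightarrow> real" where
  "conformal_radius D z =
     (THE r. \<exists>f. conformal_onto f (ball 0 1) D \<and> f 0 = z \<and> r = cmod (deriv f 0))"

definition abs_cont_on_interval :: "real \<Rightarrow> real \<Rightarrow> (real \<Rightarrow> real) \<Rightarrow> bool" where
  "abs_cont_on_interval a b f \<longleftrightarrow>
     (\<forall>\<epsilon>>0. \<exists>\<delta>>0. \<forall>(n::nat) s t.
        (\<forall>i<n. a \<le> s i \<and> s i \<le> t i \<and> t i \<le> b) \<and>
        disjoint_family_on (\<lambda>i. {s i<..<t i}) {..<n} \<and>
        (\<Sum>i<n. t i - s i) < \<delta> \<longrightarrow> (\<Sum>i<n. \<bar>f (t i) - f (s i)\<bar>) < \<epsilon>)"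

definition in_Lp_loc :: "ennreal \<Rightarrow> (real \<Rightarrow> real) \<Rightarrow> bool" where
  "in_Lp_loc d g \<longleftrightarrow>
     (\<forall>T\<ge>0. g \<in> borel_measurable (lebesgue_on {0..T}) \<and>
        (if d = \<infinity> then \<exists>M. AE t in lebesgue_on {0..T}. \<bar>g t\<bar> \<le> M
         else integrable (lebesgue_on {0..T}) (\<lambda>t. \<bar>g t\<bar> powr enn2real d)))"

text \<open>Families are indexed by all reals, but only the indices \<open>t \<ge> 0\<close> are ever inspected.\<close>

definition L_admissible_of_order :: "ennreal \<Rightarrow> (real \<Rightarrow> complex set) \<Rightarrow> bool" where
  "L_admissible_of_order d \<Omega> \<longleftrightarrow>
     (\<forall>t\<ge>0. simply_connected_domain (\<Omega> t)) \<and>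
     (\<forall>s t. 0 \<le> s \<and> s \<le> t \<longrightarrow> \<Omega> s \<subseteq> \<Omega> t \<and> \<Omega> t \<noteq> UNIV) \<and>
     (\<exists>w\<in>\<Omega> 0.
        (\<forall>T\<ge>0. abs_cont_on_interval 0 T (\<lambda>t. conformal_radius (\<Omega> t) w)) \<and>
        (\<exists>g. (AE t in lebesgue_on {0..}.
                ((\<lambda>t. conformal_radius (\<Omega> t) w) has_real_derivative g t) (at t)) \<and>
             in_Lp_loc d g))"

definition L_admissible :: "(real \<Rightarrow> complex set) \<Rightarrow> bool" where
  "L_admissible \<Omega> \<longleftrightarrow> (\<exists>d\<ge>1. L_admissible_of_order d \<Omega>)"

section \<open>Prime ends\<close>

text \<open>A crosscut is an open Jordan arc in \<open>D\<close> whose closure in the sphere adds one or two end points,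
  lying on the boundary of \<open>D\<close> in the sphere; the two end points may coincide.\<close>

definition crosscut :: "complex set \<Rightarrow> complex set \<Rightarrow> bool" where
  "crosscut D C \<longleftrightarrow>
     (\<exists>\<gamma>. continuous_map (top_of_set {0..1::real}) riemann_sphere \<gamma> \<and>
        inj_on \<gamma> {0<..<1} \<and> \<gamma> ` {0<..<1} = Some ` C \<and> C \<subseteq> D \<and>
        \<gamma> 0 \<in> boundary_inf D \<and> \<gamma> 1 \<in> boundary_inf D)"

definition separates_in :: "complex set \<Rightarrow> complex set \<Rightarrow> complex set \<Rightarrow> complex set \<Rightarrow> bool" where
  "separates_in D C A B \<longleftrightarrow> A \<subseteq> D - C \<and> B \<subseteq> D - C \<and>
     (\<forall>a\<in>A. \<forall>b\<in>B. \<not> connected_component (D - C) a b)"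

definition null_chain :: "complex set \<Rightarrow> (nat \<Rightarrow> complex set) \<Rightarrow> bool" where
  "null_chain D C \<longleftrightarrow>
     (\<forall>n. crosscut D (C n)) \<and>
     (\<forall>n. riemann_sphere closure_of (Some ` C n) \<inter>
          riemann_sphere closure_of (Some ` C (Suc n)) = {}) \<and>
     (\<forall>n\<ge>1. separates_in D (C n) (C 0) (C (Suc n))) \<and>
     (\<forall>\<epsilon>>0. \<forall>\<^sub>F n in sequentially. \<forall>z\<in>C n. \<forall>w\<in>C n. chordal_dist z w < \<epsilon>)"

text \<open>For a null-chain, this is the component of \<open>D - C n\<close> containing \<open>C (Suc n)\<close>; for \<open>n \<ge> 1\<close> it is
  the component that does not contain \<open>C 0\<close>.\<close>

definition chain_domain :: "complex set \<Rightarrow> (nat \<Rightarrow> complex set) \<Rightarrow> nat \<Rightarrow> complex set" where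
  "chain_domain D C n = (\<Union>w\<in>C (Suc n). connected_component_set (D - C n) w)"

definition cofinal_seqs :: "(nat \<Rightarrow> complex set) \<Rightarrow> (nat \<Rightarrow> complex set) \<Rightarrow> bool" where
  "cofinal_seqs U V \<longleftrightarrow> (\<forall>m. \<exists>n. U n \<subseteq> V m) \<and> (\<forall>m. \<exists>n. V n \<subseteq> U m)"

definition null_chain_equiv ::
  "complex set \<Rightarrow> ((nat \<Rightarrow> complex set) \<times> (nat \<Rightarrow> complex set)) set" where
  "null_chain_equiv D = {(C, C'). null_chain D C \<and> null_chain D C' \<and>
     cofinal_seqs (chain_domain D C) (chain_domain D C')}"

definition prime_ends :: "complex set \<Rightarrow> (nat \<Rightarrow> complex set) set set" where
  "prime_ends D = {C. null_chain D C} // null_chain_equiv D"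

text \<open>The bijection between prime ends induced by a conformal map \<open>F\<close> of \<open>D\<close>. The images of the
  crosscuts of a null-chain of \<open>D\<close> need not form a null-chain of \<open>F ` D\<close>, but the images of the domains
  cut off by them are cofinal with those of a null-chain representing the image prime end.\<close>

definition pe_map ::
  "(complex \<Rightarrow> complex) \<Rightarrow> complex set \<Rightarrow> (nat \<Rightarrow> complex set) set \<Rightarrow> (nat \<Rightarrow> complex set) set" where
  "pe_map F D P = (THE Q. Q \<in> prime_ends (F ` D) \<and>
     (\<exists>C\<in>P. \<exists>C'\<in>Q. cofinal_seqs (\<lambda>n. F ` chain_domain D C n) (chain_domain (F ` D) C')))"

text \<open>The identification of the unit circle with the prime ends of the unit disc: a point corresponds
  to the prime end whose impression consists of this point.\<close>

definition disc_prime_end :: "complex \<Rightarrow> (nat \<Rightarrow> complex set) set" where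
  "disc_prime_end \<zeta> = {C. null_chain (ball 0 1) C \<and>
     (\<Inter>n. closure (chain_domain (ball 0 1) C n)) = {\<zeta>}}"

section \<open>Conformal embedding and chordally admissible families\<close>

definition angular_lim :: "(complex \<Rightarrow> complex) \<Rightarrow> complex \<Rightarrow> complex \<Rightarrow> bool" where
  "angular_lim f \<zeta>\<^sub>0 l \<longleftrightarrow>
     (\<forall>M>1. (f \<longlongrightarrow> l) (at \<zeta>\<^sub>0 within {z \<in> ball 0 1. cmod (z - \<zeta>\<^sub>0) \<le> M * (1 - cmod z)}))"

text \<open>Finiteness of the angular limit of the difference quotient is expressed by its existence as a
  complex number.\<close>

definition conformally_embedded_in_disc ::
  "complex set \<Rightarrow> (nat \<Rightarrow> complex set) set \<Rightarrow> bool" where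
  "conformally_embedded_in_disc G P \<longleftrightarrow> P \<in> prime_ends G \<and>
     (\<exists>\<psi> \<zeta>\<^sub>0 z\<^sub>0 c. conformal_onto \<psi> (ball 0 1) G \<and>
        \<zeta>\<^sub>0 \<in> sphere 0 1 \<and> pe_map \<psi> (ball 0 1) (disc_prime_end \<zeta>\<^sub>0) = P \<and>
        z\<^sub>0 \<in> sphere 0 1 \<and> angular_lim \<psi> \<zeta>\<^sub>0 z\<^sub>0 \<and>
        angular_lim (\<lambda>\<zeta>. (\<psi> \<zeta> - z\<^sub>0) / (\<zeta> - \<zeta>\<^sub>0)) \<zeta>\<^sub>0 c)"

definition conformally_embedded ::
  "complex set \<Rightarrow> complex set \<Rightarrow> (nat \<Rightarrow> complex set) set \<Rightarrow> bool" where
  "conformally_embedded \<Omega>\<^sub>1 \<Omega>\<^sub>2 P \<longleftrightarrow>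
     (\<exists>\<phi>. conformal_onto \<phi> \<Omega>\<^sub>2 (ball 0 1) \<and>
        conformally_embedded_in_disc (\<phi> ` \<Omega>\<^sub>1) (pe_map \<phi> \<Omega>\<^sub>1 P))"

definition chordally_admissible :: "(real \<Rightarrow> complex set) \<Rightarrow> bool" where
  "chordally_admissible \<Omega> \<longleftrightarrow> L_admissible \<Omega> \<and>
     (\<exists>P\<^sub>0\<in>prime_ends (\<Omega> 0). \<forall>t\<ge>0. conformally_embedded (\<Omega> 0) (\<Omega> t) P\<^sub>0)"

end

theory Submission
  imports Defs
begin

text \<open>Why the theorem is true. A Riemann map \<open>f\<close> of the disc onto \<open>\<Omega> 0\<close> and Riemann maps \<open>\<phi>\<close> of \<open>\<Omega> t\<close>
onto the disc give self-maps \<open>\<psi> = \<phi> \<circ> f\<close> of the disc, and everything is to be shown at one boundary point \<open>\<zeta>0\<close> that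
serves all \<open>t\<close>. By the Julia--Wolff theorem (\<open>Julia_Wolff\<close>) the angular limit of \<open>\<psi>\<close> at \<open>\<zeta>0\<close> and that of
the difference quotient exist as soon as \<open>1 - \<bar>\<psi>\<bar>\<close> is bounded by a multiple of \<open>1 - \<bar>\<zeta>\<bar>\<close> along a single
sequence that tends to \<open>\<zeta>0\<close>; neither boundary extension nor a derivative of a Riemann map is involved.

The sequence comes from the two curve conditions, each of which turns into one explicit holomorphic map. The curve inside \<open>\<Omega> 0\<close> gives
a map \<open>g\<close> of the disc into \<open>\<Omega> 0\<close> with \<open>dist (g r, p) \<le> B * (1 - r)\<close> as \<open>r\<close> tends to \<open>1\<close> (\<open>inner_sphere_map\<close>); the
curve outside \<open>\<Omega> t\<close> gives a map \<open>G\<close> of \<open>\<Omega> t\<close> into the disc with \<open>1 - \<bar>G z\<bar> \<le> B * dist (z, p)\<close>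
(\<open>outer_sphere_map\<close>). The points are \<open>\<zeta> = f\<inverse> (g r)\<close>: the Schwarz--Pick lemma compares \<open>1 - \<bar>\<zeta>\<bar>\<close> with \<open>1 - r\<close> from below,
and \<open>1 - \<bar>\<psi> \<zeta>\<bar> = 1 - \<bar>\<phi> (g r)\<bar>\<close> with \<open>1 - \<bar>G (g r)\<bar>\<close>, hence with \<open>1 - r\<close>, from above. Both maps are built from
\<open>s \<mapsto> s * exp (\<kappa> s)\<close>, where \<open>\<kappa>\<close> is a bounded function whose imaginary part near the real axis dominates the
angle by which the curve deviates from its tangent; that such a bounded \<open>\<kappa>\<close> exists is exactly the Dini condition.

The prime end is the one that \<open>f\<close> assigns to \<open>\<zeta>0\<close>. For it to be meaningful, every conformal map \<open>F\<close> of the disc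
must carry the neighbourhoods of \<open>\<zeta>0\<close> to a sequence cofinal with the domains of a null-chain (\<open>exists_null_chain_at\<close>). In the
strip \<open>0 < Im z < \<pi>\<close>, with \<open>\<zeta>0\<close> at the right end, the crosscuts are images of vertical segments.
Length and area are compared for a density that is so large near infinity that curves of finite length are bounded, but that
still gives the plane finite area; applied to \<open>F\<close> and to \<open>1 / (F - a)\<close> it yields segments whose images are short, end at finite
boundary points, and avoid the end points of the segment chosen before. The domains they cut off are images of half-strips, so the
separation properties of a null-chain hold in the strip by inspection.\<close>

section \<open>Change of variables for conformal maps\<close>

text \<open>Change of variables with a Jacobian determinant is a statement about \<open>real^2\<close>, with which the complex plane is
identified by a linear isometry that preserves Lebesgue measure.\<close>
definition vec_of :: "complex \<Rightarrow> real^2" where "vec_of z = vector [Re z, Im z]"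
definition cpx_of :: "real^2 \<Rightarrow> complex" where "cpx_of v = Complex (vec_nth v 1) (vec_nth v 2)"

lemma vec_cpx [simp]: "vec_of (cpx_of v) = v" "cpx_of (vec_of z) = z"
  by (auto simp: vec_of_def cpx_of_def vec_eq_iff forall_2)

lemma bounded_linear_cpx_of: "bounded_linear cpx_of"
  unfolding linear_conv_bounded_linear[symmetric]
  by (rule linearI) (auto simp: cpx_of_def complex_eq_iff)

lemma bounded_linear_vec_of: "bounded_linear vec_of"
  unfolding linear_conv_bounded_linear[symmetric]
  by (rule linearI) (auto simp: vec_of_def vec_eq_iff forall_2)

lemma borel_cpx_of [measurable]: "cpx_of \<in> borel_measurable borel"
  by (intro borel_measurable_continuous_onI linear_continuous_on bounded_linear_cpx_of)

lemma lborel_cpx_of: "distr lborel borel cpx_of = (lborel :: complex measure)"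
proof (rule lborel_eqI[symmetric])
  fix l u :: complex
  assume le: "\<And>b. b \<in> Basis \<Longrightarrow> l \<bullet> b \<le> u \<bullet> b"
  have b: "Basis = {1, \<i>}" by (simp add: Basis_complex_def)
  have 1: "cpx_of -` box l u = box (vec_of l) (vec_of u)"
    by (auto simp: box_def b cpx_of_def vec_of_def Basis_vec_def inner_axis forall_2 inner_complex_def)
  have le': "Re l \<le> Re u" "Im l \<le> Im u" using le[of 1] le[of \<i>] by (auto simp: b inner_complex_def)
  have "emeasure (distr lborel borel cpx_of) (box l u) = emeasure lborel (box (vec_of l) (vec_of u))"
    by (subst emeasure_distr) (auto simp: 1)
  also have "\<dots> = (\<Prod>b\<in>Basis. (vec_of u - vec_of l) \<bullet> b)"
  proof (subst emeasure_lborel_box)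
    have "vec_nth (vec_of l) i \<le> vec_nth (vec_of u) i" for i
      using exhaust_2[of i] le' by (auto simp: vec_of_def)
    then show "vec_of l \<bullet> b \<le> vec_of u \<bullet> b" if "b \<in> Basis" for b
      using that by (auto simp: Basis_vec_def inner_axis)
  qed simp
  also have "(\<Prod>b\<in>Basis. (vec_of u - vec_of l) \<bullet> b) = (\<Prod>b\<in>Basis. (u - l) \<bullet> b)"
  proof -
    have "(Basis::(real^2) set) = {axis 1 1, axis 2 1}"
      by (auto simp: Basis_vec_def UNIV_2)
    note bb = this
    have "axis 1 1 \<noteq> (axis 2 1 :: real^2)" by (simp add: axis_eq_axis)
    then show ?thesis unfolding b bb by (simp add: inner_axis vec_of_def inner_complex_def)
  qed
  finally show "emeasure (distr lborel borel cpx_of) (box l u) = (\<Prod>b\<in>Basis. (u - l) \<bullet> b)" .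
qed simp

lemma lborel_Complex: "distr lborel borel (\<lambda>(x, y). Complex x y) = (lborel :: complex measure)"
proof (rule lborel_eqI[symmetric])
  have m: "(\<lambda>(x, y). Complex x y) \<in> borel_measurable borel"
    by (intro borel_measurable_continuous_onI) (auto simp: case_prod_unfold intro!: continuous_intros)
  fix l u :: complex
  assume le: "\<And>b. b \<in> Basis \<Longrightarrow> l \<bullet> b \<le> u \<bullet> b"
  have b: "Basis = {1, \<i>}" by (simp add: Basis_complex_def)
  have le': "Re l \<le> Re u" "Im l \<le> Im u" using le[of 1] le[of \<i>] by (auto simp: b inner_complex_def)
  have 1: "(\<lambda>(x, y). Complex x y) -` box l u = box (Re l, Im l) (Re u, Im u)"
    by (auto simp: box_def b Basis_prod_def inner_complex_def)
  have "emeasure (distr lborel borel (\<lambda>(x, y). Complex x y)) (box l u) = emeasure lborel (box (Re l, Im l) (Re u, Im u))"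
    using m by (subst emeasure_distr) (auto simp: 1)
  also have "\<dots> = (\<Prod>b\<in>Basis. ((Re u, Im u) - (Re l, Im l)) \<bullet> b)"
    using le' by (subst emeasure_lborel_box) (auto simp: b Basis_prod_def inner_complex_def)
  also have "(\<Prod>b\<in>Basis. ((Re u, Im u) - (Re l, Im l)) \<bullet> b) = (\<Prod>b\<in>Basis. (u - l) \<bullet> b)"
  proof -
    have "(Basis::(real\<times>real) set) = {(1,0), (0,1)}" by (auto simp: Basis_prod_def)
    note bb = this
    show ?thesis unfolding b bb by (simp add: inner_complex_def)
  qed
  finally show "emeasure (distr lborel borel (\<lambda>(x, y). Complex x y)) (box l u) = (\<Prod>b\<in>Basis. (u - l) \<bullet> b)" .
qed simp

text \<open>The Jacobian of a holomorphic map is the squared modulus of its derivative, and by injectivity no point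
of the image is counted twice. Only an inequality is asserted because the image may be smaller than the plane.\<close>
lemma conformal_change_of_variables:
  fixes F :: "complex \<Rightarrow> complex" and k :: "complex \<Rightarrow> real"
  assumes S: "open S" and F: "F holomorphic_on S" "inj_on F S"
    and k: "continuous_on UNIV k" "\<And>z. k z \<ge> 0" "integrable lborel k"
  shows "(\<integral>\<^sup>+z\<in>S. ennreal (k (F z) * (cmod (deriv F z))\<^sup>2) \<partial>lborel) \<le> (\<integral>\<^sup>+z. ennreal (k z) \<partial>lborel)"
proof -
  define S' where "S' = vec_of ` S"
  have S'eq: "S' = cpx_of -` S"
    unfolding S'_def by (force intro: image_eqI[of _ _ "cpx_of _"])
  have cont: "continuous_on UNIV cpx_of"
    by (intro linear_continuous_on bounded_linear_cpx_of)
  have S'o: "open S'" unfolding S'eq using S cont by (rule open_vimage)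
  define \<Phi> where "\<Phi> = (\<lambda>v. vec_of (F (cpx_of v)))"
  define \<Phi>' where "\<Phi>' = (\<lambda>v x. vec_of (deriv F (cpx_of v) * cpx_of x))"
  have der: "(\<Phi> has_derivative \<Phi>' v) (at v within S')" if "v \<in> S'" for v
  proof -
    have "(F has_field_derivative deriv F (cpx_of v)) (at (cpx_of v))"
      using F(1) S that by (auto simp: S'eq intro: holomorphic_derivI)
    then have "(F has_derivative (\<lambda>x. deriv F (cpx_of v) * x)) (at (cpx_of v))"
      by (simp add: has_field_derivative_def)
    moreover have "(cpx_of has_derivative cpx_of) (at v)"
      by (rule bounded_linear_imp_has_derivative[OF bounded_linear_cpx_of])
    ultimately have "((\<lambda>v. F (cpx_of v)) has_derivative (\<lambda>x. deriv F (cpx_of v) * cpx_of x)) (at v)"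
      by (rule has_derivative_compose[rotated])
    from bounded_linear.has_derivative[OF bounded_linear_vec_of this] show ?thesis
      unfolding \<Phi>_def \<Phi>'_def by (rule has_derivative_at_withinI)
  qed
  have injP: "inj_on \<Phi> S'"
    using F(2) unfolding \<Phi>_def S'eq by (auto simp: inj_on_def) (metis vec_cpx)+
  have det: "\<bar>det (matrix (\<Phi>' v))\<bar> = (cmod (deriv F (cpx_of v)))\<^sup>2" for v
    by (simp add: det_2 matrix_def \<Phi>'_def vec_of_def cpx_of_def axis_def cmod_power2 power2_eq_square[symmetric])
  define k' where "k' = (\<lambda>v. k (cpx_of v))"
  have km[measurable]: "k \<in> borel_measurable borel" using k(1) by (rule borel_measurable_continuous_onI)
  have int0: "integrable lborel k'"
    using k(3) unfolding k'_def by (subst (asm) lborel_cpx_of[symmetric], subst (asm) integrable_distr_eq) auto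
  have k'm[measurable]: "k' \<in> borel_measurable borel" unfolding k'_def by measurable
  have im: "\<Phi> ` S' \<in> sets lebesgue"
  proof (rule differentiable_image_in_sets_lebesgue)
    show "S' \<in> sets lebesgue" using S'o by simp
    show "\<Phi> differentiable_on S'" using der by (auto simp: differentiable_on_def differentiable_def)
  qed simp
  have "k' absolutely_integrable_on UNIV"
    using int0 by (simp add: set_integrable_def integrable_completion)
  then have ai: "k' absolutely_integrable_on \<Phi> ` S'" 
    by (rule set_integrable_subset) (use im in auto)
  define D where "D = (\<lambda>v. (cmod (deriv F (cpx_of v)))\<^sup>2 * k' (\<Phi> v))"
  have Dn: "D v \<ge> 0" for v using k(2) by (simp add: D_def k'_def)
  have eq: "D absolutely_integrable_on S' \<and> integral S' D = integral (\<Phi> ` S') k'"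
    using has_absolute_integral_change_of_variables[OF _ der injP, of "\<lambda>v. vec (k' v)::real^1" "vec (integral (\<Phi> ` S') k')"] S'o ai
    by (simp add: det absolutely_integrable_on_1_iff integral_on_1_eq D_def vec_eq_iff)
  have "(\<integral>\<^sup>+z\<in>S. ennreal (k (F z) * (cmod (deriv F z))\<^sup>2) \<partial>lborel)
      = (\<integral>\<^sup>+v. ennreal (k (F (cpx_of v)) * (cmod (deriv F (cpx_of v)))\<^sup>2) * indicator S (cpx_of v) \<partial>lborel)"
  proof -
    have "(\<lambda>z. (k (F z) * (cmod (deriv F z))\<^sup>2)) \<in> borel_measurable (restrict_space borel S)"
      by (intro borel_measurable_continuous_on_restrict continuous_intros continuous_on_compose2[OF k(1)]
          holomorphic_on_imp_continuous_on holomorphic_deriv F S) auto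
    then have [measurable]: "(\<lambda>z. indicat_real S z * (k (F z) * (cmod (deriv F z))\<^sup>2)) \<in> borel_measurable borel"
      using S by (subst (asm) borel_measurable_restrict_space_iff) auto
    have "(\<lambda>z. ennreal (indicat_real S z * (k (F z) * (cmod (deriv F z))\<^sup>2))) \<in> borel_measurable borel"
      by measurable
    also have "(\<lambda>z. ennreal (indicat_real S z * (k (F z) * (cmod (deriv F z))\<^sup>2))) =
        (\<lambda>z. ennreal (k (F z) * (cmod (deriv F z))\<^sup>2) * indicator S z)"
      by (auto simp: indicator_def)
    finally have "(\<lambda>z. ennreal (k (F z) * (cmod (deriv F z))\<^sup>2) * indicator S z) \<in> borel_measurable borel" .
    then show ?thesis by (subst lborel_cpx_of[symmetric], subst nn_integral_distr) auto
  qed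
  also have "\<dots> = (\<integral>\<^sup>+v. ennreal (indicator S' v * D v) \<partial>lebesgue)"
    by (subst nn_integral_completion, intro nn_integral_cong) (auto simp: D_def S'eq \<Phi>_def k'_def indicator_def mult.commute)
  also have "\<dots> = ennreal (integral S' D)"
    using eq Dn by (subst nn_integral_eq_integral) (auto simp: set_integrable_def set_lebesgue_integral_def set_lebesgue_integral_eq_integral(2)[symmetric])
  also have "\<dots> = ennreal (integral (\<Phi> ` S') k')" using eq by simp
  also have "\<dots> = (\<integral>\<^sup>+v. ennreal (indicator (\<Phi> ` S') v * k' v) \<partial>lebesgue)"
    using ai k(2) by (subst nn_integral_eq_integral) (auto simp: k'_def set_integrable_def set_lebesgue_integral_def set_lebesgue_integral_eq_integral(2)[symmetric])
  also have "\<dots> \<le> (\<integral>\<^sup>+v. ennreal (k' v) \<partial>lebesgue)"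
    using k(2) by (intro nn_integral_mono) (auto simp: k'_def indicator_def)
  also have "\<dots> = (\<integral>\<^sup>+v. ennreal (k' v) \<partial>lborel)" by (rule nn_integral_completion)
  also have "(\<integral>\<^sup>+v. ennreal (k' v) \<partial>lborel) = (\<integral>\<^sup>+z. ennreal (k z) \<partial>distr lborel borel cpx_of)"
    by (subst nn_integral_distr) (auto simp: k'_def)
  also have "\<dots> = (\<integral>\<^sup>+z. ennreal (k z) \<partial>lborel)" by (simp only: lborel_cpx_of)
  finally show ?thesis .
qed

section \<open>Energy of the vertical slices of a strip\<close>

text \<open>Dominates, up to a constant, the square of the gradient of \<open>log (1 + log (1 + \<bar>z\<bar>\<^sup>2))\<close>. This function is unbounded near infinity
although the density is integrable; that is what excludes infinity as an end point of almost every slice. The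
density also dominates the squared spherical density, so that the same energy controls chordal lengths.\<close>
definition loglog_density :: "complex \<Rightarrow> real" where
  "loglog_density z = 1 / ((1 + (cmod z)\<^sup>2) * (1 + ln (1 + (cmod z)\<^sup>2))\<^sup>2)"

lemma loglog_density_pos: "0 < loglog_density z"
proof -
  have "0 \<le> ln (1 + (cmod z)\<^sup>2)" by simp
  then have "0 < (1 + ln (1 + (cmod z)\<^sup>2))\<^sup>2" by (intro zero_less_power) linarith
  then show ?thesis unfolding loglog_density_def
    by (intro divide_pos_pos mult_pos_pos) (auto intro: add_pos_nonneg)
qed

lemma continuous_on_loglog_density: "continuous_on A loglog_density"
proof -
  have "1 + (cmod z)\<^sup>2 \<noteq> 0" for z by (metis add_pos_nonneg less_irrefl zero_le_power2 zero_less_one)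
  moreover have "1 + ln (1 + (cmod z)\<^sup>2) \<noteq> 0" for z
    using ln_ge_zero[of "1 + (cmod z)\<^sup>2"] by (smt (verit) zero_le_power2)
  ultimately show ?thesis unfolding loglog_density_def by (intro continuous_intros) auto
qed

text \<open>On the annulus \<open>4^n \<le> 1 + \<bar>z\<bar>\<^sup>2 < 4^(n+1)\<close> the density is at most \<open>1 / (4^n * (n + 1)\<^sup>2)\<close>, while the area is of
order \<open>4^n\<close>; the squares \<open>B n\<close> cover the annuli, and \<open>\<Sum> 1 / (n + 1)\<^sup>2\<close> converges.\<close>
lemma integrable_loglog_density: "integrable lborel loglog_density"
proof (rule integrableI_nonneg)
  show "loglog_density \<in> borel_measurable lborel"
    using continuous_on_loglog_density[of UNIV] by (simp add: borel_measurable_continuous_onI)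
  show "AE z in lborel. 0 \<le> loglog_density z" using loglog_density_pos by (simp add: less_imp_le)
  define B :: "nat \<Rightarrow> complex set" where "B n = cbox (Complex (-(2^(n+1))) (-(2^(n+1)))) (Complex (2^(n+1)) (2^(n+1)))" for n
  define c :: "nat \<Rightarrow> real" where "c n = 1 / (4^n * (1 + real n)\<^sup>2)" for n
  have em: "emeasure lborel (B n) = ennreal (16 * 4^n)" for n
  proof -
    have b: "Basis = {1, \<i>}" by (simp add: Basis_complex_def)
    have "(2::real)^n * 2^n = 4^n" by (simp flip: power_mult_distrib)
    moreover have "emeasure lborel (B n) = ennreal ((\<Prod>b\<in>Basis. (Complex (2^(n+1)) (2^(n+1)) - Complex (-(2^(n+1))) (-(2^(n+1)))) \<bullet> b))"
      unfolding B_def by (rule emeasure_lborel_cbox) (auto simp: b inner_complex_def)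
    ultimately show ?thesis unfolding b by (simp add: inner_complex_def)
  qed
  have "ennreal (loglog_density z) \<le> (\<Sum>n. ennreal (c n) * indicator (B n) z)" for z
  proof -
    define x where "x = 1 + (cmod z)\<^sup>2"
    have x1: "x \<ge> 1" by (simp add: x_def)
    \<comment> \<open>the index of the annulus that contains \<open>z\<close>\<close>
    define n where "n = nat \<lfloor>log 4 x\<rfloor>"
    have l0: "log 4 x \<ge> 0" using x1 by simp
    then have n: "real n \<le> log 4 x" "log 4 x < real n + 1" by (simp_all add: n_def)
    have le: "4^n \<le> x"
    proof -
      have "4 powr real n \<le> 4 powr (log 4 x)" using n by (intro powr_mono) auto
      then show ?thesis using x1 by (simp add: powr_realpow)
    qed
    have lt: "x < 4^(n+1)"
    proof -
      have "4 powr (log 4 x) < 4 powr real (n+1)" using n by (intro powr_less_mono) auto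
      then show ?thesis using x1 by (simp only: powr_realpow) simp
    qed
    have "cmod z < 2^(n+1)"
    proof (rule power_less_imp_less_base)
      have "(2^(n+1))\<^sup>2 = (4::real)^(n+1)" by (simp add: power2_eq_square flip: power_mult_distrib)
      then show "(cmod z)\<^sup>2 < (2^(n+1))\<^sup>2" using lt unfolding x_def by linarith
    qed simp
    then have zB: "z \<in> B n"
      using abs_Re_le_cmod[of z] abs_Im_le_cmod[of z]
      by (auto simp: B_def cbox_def Basis_complex_def inner_complex_def abs_le_iff intro: order_trans)
    have lnx: "real n \<le> ln x"
    proof -
      have "1 \<le> ln (4::real)" using exp_le by (subst ln_ge_iff) auto
      then have "real n \<le> real n * ln 4" by (simp add: mult_le_cancel_left1)
      also have "\<dots> \<le> log 4 x * ln 4" using n by (intro mult_right_mono) auto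
      also have "\<dots> = ln x" by (simp add: log_def)
      finally show ?thesis .
    qed
    have "loglog_density z \<le> c n" unfolding loglog_density_def c_def x_def[symmetric]
      using le lnx x1 by (intro divide_left_mono mult_mono power_mono mult_pos_pos) (auto intro!: zero_less_power add_pos_nonneg)
    then have "ennreal (loglog_density z) \<le> ennreal (c n) * indicator (B n) z" using zB by (simp add: ennreal_leI)
    also have "\<dots> \<le> (\<Sum>n. ennreal (c n) * indicator (B n) z)"
    proof -
      have "f n \<le> suminf f" for f :: "nat \<Rightarrow> ennreal"
        using sum_le_suminf[OF summableI, of "{n}" f] by simp
      then show ?thesis .
    qed
    finally show ?thesis .
  qed
  then have "(\<integral>\<^sup>+z. ennreal (loglog_density z) \<partial>lborel) \<le> (\<integral>\<^sup>+z. (\<Sum>n. ennreal (c n) * indicator (B n) z) \<partial>lborel)"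
    by (intro nn_integral_mono) auto
  also have "\<dots> = (\<Sum>n. ennreal (c n) * emeasure lborel (B n))"
    by (subst nn_integral_suminf) (auto simp: nn_integral_cmult_indicator B_def)
  also have "\<dots> = (\<Sum>n. ennreal (16 * (1 / (1 + real n)\<^sup>2)))"
    by (intro suminf_cong) (auto simp: em c_def ennreal_mult'[symmetric])
  also have "\<dots> < \<infinity>"
  proof -
    have "summable (\<lambda>n. 16 * (1 / (1 + real n)\<^sup>2))"
      using inverse_squares_sums by (intro summable_mult) (auto simp: sums_iff add.commute)
    then show ?thesis by (subst suminf_ennreal2) auto
  qed
  finally show "(\<integral>\<^sup>+z. ennreal (loglog_density z) \<partial>lborel) < \<infinity>" .
qed

definition strip :: "complex set" where "strip = {z. 0 < Im z \<and> Im z < pi}"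

lemma open_strip: "open strip"
  unfolding strip_def by (intro open_Collect_conj open_halfspace_Im_gt open_halfspace_Im_lt)

lemma convex_strip: "convex strip"
  unfolding strip_def Collect_conj_eq by (intro convex_Int convex_halfspace_Im_gt convex_halfspace_Im_lt)

text \<open>The Dirichlet-type energy of \<open>F\<close> along the vertical segment over \<open>u\<close>: by the Cauchy--Schwarz inequality \<open>\<pi>\<close> times it bounds
the square of the length of the image of the segment with respect to the square root of the density.\<close>
definition slice_energy :: "(complex \<Rightarrow> complex) \<Rightarrow> real \<Rightarrow> ennreal" where
  "slice_energy F u = (\<integral>\<^sup>+\<theta>\<in>{0<..<pi}. ennreal (loglog_density (F (Complex u \<theta>)) * (cmod (deriv F (Complex u \<theta>)))\<^sup>2) \<partial>lborel)"

lemma measurable_loglog_integrand: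
  assumes "F holomorphic_on strip"
  shows "(\<lambda>z. ennreal (loglog_density (F z) * (cmod (deriv F z))\<^sup>2) * indicator strip z) \<in> borel_measurable borel"
proof -
  have "(\<lambda>z. (loglog_density (F z) * (cmod (deriv F z))\<^sup>2)) \<in> borel_measurable (restrict_space borel strip)"
    by (intro borel_measurable_continuous_on_restrict continuous_intros continuous_on_compose2[OF continuous_on_loglog_density[of UNIV]]
        holomorphic_on_imp_continuous_on holomorphic_deriv assms open_strip) auto
  then have [measurable]: "(\<lambda>z. indicat_real strip z * (loglog_density (F z) * (cmod (deriv F z))\<^sup>2)) \<in> borel_measurable borel"
    using open_strip by (subst (asm) borel_measurable_restrict_space_iff) auto
  have "(\<lambda>z. ennreal (indicat_real strip z * (loglog_density (F z) * (cmod (deriv F z))\<^sup>2))) \<in> borel_measurable borel"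
    by measurable
  also have "(\<lambda>z. ennreal (indicat_real strip z * (loglog_density (F z) * (cmod (deriv F z))\<^sup>2))) =
      (\<lambda>z. ennreal (loglog_density (F z) * (cmod (deriv F z))\<^sup>2) * indicator strip z)"
    by (auto simp: indicator_def)
  finally show ?thesis .
qed

lemma measurable_Complex_pair: "(\<lambda>(x, y). Complex x y) \<in> borel_measurable borel"
  by (intro borel_measurable_continuous_onI) (auto simp: case_prod_unfold intro!: continuous_intros)

text \<open>Fubini turns the double integral into the density-weighted area of the image of the strip, which is at most that of the plane.\<close>
lemma slice_energy:
  assumes "F holomorphic_on strip" "inj_on F strip"
  shows "slice_energy F \<in> borel_measurable borel" "(\<integral>\<^sup>+u. slice_energy F u \<partial>lborel) < \<infinity>"
proof -
  define k where "k = (\<lambda>z. ennreal (loglog_density (F z) * (cmod (deriv F z))\<^sup>2) * indicator strip z)"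
  have k[measurable]: "k \<in> borel_measurable borel" unfolding k_def by (rule measurable_loglog_integrand[OF assms(1)])
  define k2 where "k2 = (\<lambda>p. k (case p of (x, y) \<Rightarrow> Complex x y))"
  have "k2 \<in> borel_measurable borel"
    unfolding k2_def by (rule measurable_compose[OF measurable_Complex_pair k])
  then have k2[measurable]: "k2 \<in> borel_measurable (lborel \<Otimes>\<^sub>M lborel)" by (simp add: lborel_prod)
  have se: "slice_energy F u = (\<integral>\<^sup>+\<theta>. k2 (u, \<theta>) \<partial>lborel)" for u
    unfolding slice_energy_def by (intro nn_integral_cong) (auto simp: k_def k2_def indicator_def strip_def)
  show "slice_energy F \<in> borel_measurable borel"
    unfolding se using lborel.borel_measurable_nn_integral_fst[OF k2] by simp
  have "(\<integral>\<^sup>+u. slice_energy F u \<partial>lborel) = (\<integral>\<^sup>+p. k2 p \<partial>(lborel \<Otimes>\<^sub>M lborel))"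
    unfolding se by (rule lborel.nn_integral_fst[OF k2])
  also have "\<dots> = (\<integral>\<^sup>+z. k z \<partial>distr lborel borel (\<lambda>(x, y). Complex x y))"
    unfolding lborel_prod k2_def by (subst nn_integral_distr) (use measurable_Complex_pair in auto)
  also have "\<dots> = (\<integral>\<^sup>+z. k z \<partial>lborel)" by (simp only: lborel_Complex)
  also have "\<dots> \<le> (\<integral>\<^sup>+z. ennreal (loglog_density z) \<partial>lborel)" unfolding k_def
    by (rule conformal_change_of_variables[OF open_strip assms continuous_on_loglog_density less_imp_le[OF loglog_density_pos] integrable_loglog_density])
  also have "\<dots> < \<infinity>"
    using integrable_loglog_density less_imp_le[OF loglog_density_pos] by (simp add: nn_integral_eq_integral)
  finally show "(\<integral>\<^sup>+u. slice_energy F u \<partial>lborel) < \<infinity>" .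
qed

text \<open>A function with finite integral cannot stay above \<open>\<delta>\<close> on a half-line.\<close>
lemma exists_small_slice:
  fixes E :: "real \<Rightarrow> ennreal"
  assumes "E \<in> borel_measurable borel" "(\<integral>\<^sup>+u. E u \<partial>lborel) < \<infinity>" "0 < \<delta>"
  shows "\<exists>u>N. E u < ennreal \<delta>"
proof (rule ccontr)
  assume *: "\<not> ?thesis"
  have "ennreal \<delta> \<le> E u" if "N < u" for u by (rule ccontr) (use * that in \<open>auto simp: not_le\<close>)
  then have "ennreal \<delta> * indicator {N<..} u \<le> E u" for u by (cases "u > N") auto
  then have "(\<integral>\<^sup>+u. ennreal \<delta> * indicator {N<..} u \<partial>lborel) \<le> (\<integral>\<^sup>+u. E u \<partial>lborel)" by (intro nn_integral_mono) auto
  moreover have "(\<integral>\<^sup>+u. ennreal \<delta> * indicator {N<..} u \<partial>lborel) = ennreal \<delta> * emeasure lborel {N<..}"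
    by (intro nn_integral_cmult_indicator) auto
  moreover have "emeasure lborel {N<..} = \<infinity>"
  proof (rule ccontr)
    assume "emeasure lborel {N<..} \<noteq> \<infinity>"
    then obtain r where r: "emeasure lborel {N<..} = ennreal r" "r \<ge> 0" by (metis ennreal_cases infinity_ennreal_def)
    have "emeasure lborel {N<..<N+(r+1)} \<le> emeasure lborel {N<..}" by (intro emeasure_mono) auto
    then show False using r by (simp add: ennreal_le_iff)
  qed
  ultimately show False using assms(2,3) by (simp add: ennreal_mult_top)
qed

text \<open>The Cauchy--Schwarz inequality in the form \<open>2 * sqrt \<kappa> \<le> l * \<kappa> + 1 / l\<close>. The free parameter \<open>l\<close> is chosen
differently by the users: fixed for boundedness, small for uniform continuity, \<open>1 / \<delta>\<close> for shortness.\<close>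
lemma variation_le_energy:
  fixes q :: "real \<Rightarrow> 'a :: euclidean_space"
  assumes der: "\<And>\<theta>. 0 < \<theta> \<Longrightarrow> \<theta> < pi \<Longrightarrow> (q has_vector_derivative q' \<theta>) (at \<theta>)"
    and bnd: "\<And>\<theta>. 0 < \<theta> \<Longrightarrow> \<theta> < pi \<Longrightarrow> norm (q' \<theta>) \<le> c * sqrt (\<kappa> \<theta>)"
    and \<kappa>: "continuous_on {0<..<pi} \<kappa>" "\<And>\<theta>. 0 < \<theta> \<Longrightarrow> \<theta> < pi \<Longrightarrow> 0 \<le> \<kappa> \<theta>"
    and E: "(\<integral>\<^sup>+\<theta>\<in>{0<..<pi}. ennreal (\<kappa> \<theta>) \<partial>lborel) \<le> ennreal E"
    and c: "0 \<le> c" and lam: "0 < l" and ab: "0 < a" "a \<le> b" "b < pi" and E0: "0 \<le> E"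
  shows "norm (q b - q a) \<le> c * (l * E + (b - a) / l) / 2"
proof -
  have sub: "{a..b} \<subseteq> {0<..<pi}" using ab by auto
  have ci: "continuous_on {a..b} \<kappa>" using \<kappa>(1) sub by (rule continuous_on_subset)
  have int: "(q' has_integral (q b - q a)) {a..b}"
  proof (rule fundamental_theorem_of_calculus[OF ab(2)])
    show "(q has_vector_derivative q' x) (at x within {a..b})" if "x \<in> {a..b}" for x
      using der[of x] that ab by (intro has_vector_derivative_at_within[OF der]) auto
  qed
  have bi: "((\<lambda>\<theta>. c * (l * \<kappa> \<theta> + 1 / l) / 2) has_integral (c * (l * integral {a..b} \<kappa> + (b - a) / l) / 2)) {a..b}"
  proof -
    have "(\<kappa> has_integral integral {a..b} \<kappa>) {a..b}" using ci by (simp add: integrable_continuous_interval integrable_integral)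
    moreover have "((\<lambda>_. 1/l) has_integral ((b - a) / l)) {a..b}" using has_integral_const_real[of "1/l" a b] ab by simp
    ultimately have "((\<lambda>\<theta>. (c/2) * (l * \<kappa> \<theta> + 1 / l)) has_integral (c/2 * (l * integral {a..b} \<kappa> + (b - a) / l))) {a..b}"
      by (intro has_integral_mult_right has_integral_add)
    then show ?thesis by simp
  qed
  have "integral {a..b} \<kappa> \<le> E"
  proof -
    have "ennreal (integral {a..b} \<kappa>) = (\<integral>\<^sup>+\<theta>\<in>{a..b}. ennreal (\<kappa> \<theta>) \<partial>lborel)"
    proof (rule nn_integral_has_integral_lebesgue'[symmetric])
      show "0 \<le> \<kappa> x" if "x \<in> {a..b}" for x using \<kappa>(2)[of x] that ab by simp
      show "(\<kappa> has_integral integral {a..b} \<kappa>) {a..b}"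
        using ci by (simp add: integrable_continuous_interval integrable_integral)
    qed
    also have "\<dots> \<le> (\<integral>\<^sup>+\<theta>\<in>{0<..<pi}. ennreal (\<kappa> \<theta>) \<partial>lborel)"
      using sub by (intro nn_integral_mono) (auto simp: indicator_def)
    finally show ?thesis using E E0 by (meson ennreal_le_iff order_trans)
  qed
  have "norm (q' \<theta>) \<le> c * (l * \<kappa> \<theta> + 1 / l) / 2" if "\<theta> \<in> {a..b}" for \<theta>
  proof -
    have t: "0 < \<theta>" "\<theta> < pi" using that ab by auto
    have "2 * sqrt (\<kappa> \<theta>) \<le> l * \<kappa> \<theta> + 1 / l"
    proof -
      have "0 \<le> (l * sqrt (\<kappa> \<theta>) - 1)\<^sup>2 / l" using lam by simp
      also have "\<dots> = l * \<kappa> \<theta> + 1 / l - 2 * sqrt (\<kappa> \<theta>)" using lam \<kappa>(2)[OF t]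
        by (simp add: field_simps power2_eq_square)
      finally show ?thesis by simp
    qed
    then have "c * sqrt (\<kappa> \<theta>) \<le> c * ((l * \<kappa> \<theta> + 1 / l) / 2)" using c by (intro mult_left_mono) auto
    then show ?thesis using bnd[OF t] by simp
  qed
  then have "norm (integral {a..b} q') \<le> integral {a..b} (\<lambda>\<theta>. c * (l * \<kappa> \<theta> + 1 / l) / 2)"
    by (intro integral_norm_bound_integral has_integral_integrable[OF int] has_integral_integrable[OF bi])
  then have "norm (q b - q a) \<le> c * (l * integral {a..b} \<kappa> + (b - a) / l) / 2"
    by (simp only: integral_unique[OF int] integral_unique[OF bi])
  also have "\<dots> \<le> c * (l * E + (b - a) / l) / 2"
    using \<open>integral {a..b} \<kappa> \<le> E\<close> c lam by (intro divide_right_mono mult_left_mono add_right_mono) auto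
  finally show ?thesis .
qed

lemma slice_has_vector_derivative:
  assumes "F holomorphic_on strip" "0 < \<theta>" "\<theta> < pi"
  shows "((\<lambda>\<theta>. F (Complex u \<theta>)) has_vector_derivative (\<i> * deriv F (Complex u \<theta>))) (at \<theta>)"
proof -
  have "(F has_field_derivative deriv F (Complex u \<theta>)) (at (Complex u \<theta>))"
    using assms open_strip by (intro holomorphic_derivI[of _ strip]) (auto simp: strip_def)
  moreover have "((\<lambda>\<theta>. Complex u \<theta>) has_vector_derivative \<i>) (at \<theta>)"
  proof -
    have "Complex u = (\<lambda>\<theta>. of_real u + of_real \<theta> * \<i>)" by (auto simp: complex_eq_iff)
    moreover have "((\<lambda>\<theta>. of_real u + of_real \<theta> * \<i>) has_vector_derivative \<i>) (at \<theta>)"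
      by (auto intro!: derivative_eq_intros)
    ultimately show ?thesis by simp
  qed
  ultimately show ?thesis
    using field_vector_diff_chain_at[of "Complex u" \<i> \<theta> F] by (simp add: o_def)
qed

text \<open>Only the size of the derivative enters the estimates of functions of \<open>\<bar>F\<bar>\<^sup>2\<close>, so its value is left existential.\<close>
lemma slice_has_norm_sq_derivative:
  assumes "F holomorphic_on strip" "0 < \<theta>" "\<theta> < pi"
  obtains d where "((\<lambda>\<theta>. (cmod (F (Complex u \<theta>)))\<^sup>2) has_real_derivative d) (at \<theta>)"
    "\<bar>d\<bar> \<le> 2 * cmod (F (Complex u \<theta>)) * cmod (deriv F (Complex u \<theta>))"
proof
  let ?f = "\<lambda>\<theta>. F (Complex u \<theta>)" and ?f' = "\<i> * deriv F (Complex u \<theta>)"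
  have "(\<lambda>\<theta>. (cmod (?f \<theta>))\<^sup>2) = (\<lambda>\<theta>. ?f \<theta> \<bullet> ?f \<theta>)" by (simp add: power2_norm_eq_inner)
  moreover have "((\<lambda>\<theta>. ?f \<theta> \<bullet> ?f \<theta>) has_vector_derivative (?f \<theta> \<bullet> ?f' + ?f' \<bullet> ?f \<theta>)) (at \<theta>)"
    by (rule bounded_bilinear.has_vector_derivative[OF bounded_bilinear_inner])
       (use slice_has_vector_derivative[OF assms, of u] in auto)
  ultimately show "((\<lambda>\<theta>. (cmod (?f \<theta>))\<^sup>2) has_real_derivative (2 * (?f \<theta> \<bullet> ?f'))) (at \<theta>)"
    by (simp add: has_real_derivative_iff_has_vector_derivative inner_commute)
  show "\<bar>2 * (?f \<theta> \<bullet> ?f')\<bar> \<le> 2 * cmod (?f \<theta>) * cmod (deriv F (Complex u \<theta>))"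
    using Cauchy_Schwarz_ineq2[of "?f \<theta>" ?f'] by (simp add: norm_mult abs_mult)
qed

lemma continuous_on_slice:
  assumes "f holomorphic_on strip"
  shows "continuous_on {0<..<pi} (\<lambda>\<theta>. f (Complex u \<theta>))"
  by (rule continuous_on_compose2[OF holomorphic_on_imp_continuous_on[OF assms]])
     (auto simp: strip_def Complex_eq intro!: continuous_intros)

text \<open>The previous estimate for functions of \<open>F\<close> along a slice whose derivative is dominated by the density; it is used for
\<open>log (1 + log (1 + \<bar>F\<bar>\<^sup>2))\<close>, for \<open>F\<close> itself once \<open>F\<close> is known to be bounded, and for the stereographic image of \<open>F\<close>.\<close>
lemma slice_variation:
  fixes q :: "real \<Rightarrow> 'a :: euclidean_space"
  assumes F: "F holomorphic_on strip" and E: "slice_energy F u \<le> ennreal E" "0 \<le> E"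
    and q: "\<And>\<theta>. 0 < \<theta> \<Longrightarrow> \<theta> < pi \<Longrightarrow> \<exists>d. (q has_vector_derivative d) (at \<theta>) \<and>
      norm d \<le> c * sqrt (loglog_density (F (Complex u \<theta>))) * cmod (deriv F (Complex u \<theta>))"
    and c: "0 \<le> c" and l: "0 < l" and ab: "0 < a" "a < pi" "0 < b" "b < pi"
  shows "norm (q b - q a) \<le> c * (l * E + \<bar>b - a\<bar> / l) / 2"
proof -
  obtain q' where q': "\<And>\<theta>. 0 < \<theta> \<Longrightarrow> \<theta> < pi \<Longrightarrow> (q has_vector_derivative q' \<theta>) (at \<theta>)"
      "\<And>\<theta>. 0 < \<theta> \<Longrightarrow> \<theta> < pi \<Longrightarrow> norm (q' \<theta>) \<le> c * sqrt (loglog_density (F (Complex u \<theta>))) * cmod (deriv F (Complex u \<theta>))"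
    using q by metis
  define \<kappa> where "\<kappa> \<theta> = loglog_density (F (Complex u \<theta>)) * (cmod (deriv F (Complex u \<theta>)))\<^sup>2" for \<theta>
  have k0: "0 \<le> \<kappa> \<theta>" for \<theta> using loglog_density_pos by (simp add: \<kappa>_def less_imp_le)
  have kc: "continuous_on {0<..<pi} \<kappa>" unfolding \<kappa>_def
    by (intro continuous_intros continuous_on_compose2[OF continuous_on_loglog_density[of UNIV]]
        continuous_on_slice F holomorphic_deriv open_strip) auto
  have sq: "sqrt (\<kappa> \<theta>) = sqrt (loglog_density (F (Complex u \<theta>))) * cmod (deriv F (Complex u \<theta>))" for \<theta>
    by (simp add: \<kappa>_def real_sqrt_mult)
  have nq: "norm (q' \<theta>) \<le> c * sqrt (\<kappa> \<theta>)" if "0 < \<theta>" "\<theta> < pi" for \<theta>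
    using q'(2)[OF that] by (simp only: sq mult.assoc)
  have Ek: "(\<integral>\<^sup>+\<theta>\<in>{0<..<pi}. ennreal (\<kappa> \<theta>) \<partial>lborel) \<le> ennreal E"
    using E(1) by (simp only: \<kappa>_def slice_energy_def)
  have *: "norm (q b - q a) \<le> c * (l * E + (b - a) / l) / 2" if "0 < a" "a \<le> b" "b < pi" for a b
    by (rule variation_le_energy[OF q'(1) nq kc k0 Ek c l that E(2)])
  show ?thesis
    using *[of a b] *[of b a] ab by (cases "a \<le> b") (auto simp: norm_minus_commute)
qed

lemma sqrt_loglog_density: 
  "sqrt (loglog_density z) = 1 / (sqrt (1 + (cmod z)\<^sup>2) * (1 + ln (1 + (cmod z)\<^sup>2)))"
proof -
  have "0 \<le> ln (1 + (cmod z)\<^sup>2)" by simp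
  then show ?thesis by (simp add: loglog_density_def real_sqrt_divide real_sqrt_mult)
qed

text \<open>Along a slice of finite energy \<open>log (1 + log (1 + \<bar>F\<bar>\<^sup>2))\<close> has finite variation, so \<open>F\<close> cannot tend to infinity.\<close>
lemma bounded_slice:
  assumes F: "F holomorphic_on strip" and E: "slice_energy F u < \<infinity>"
  shows "\<exists>B. \<forall>\<theta>\<in>{0<..<pi}. cmod (F (Complex u \<theta>)) \<le> B"
proof -
  obtain E where E: "slice_energy F u \<le> ennreal E" "0 \<le> E"
    using E by (metis ennreal_cases infinity_ennreal_def less_irrefl order_refl)
  let ?f = "\<lambda>\<theta>. F (Complex u \<theta>)"
  define q where "q = (\<lambda>\<theta>. ln (1 + ln (1 + (cmod (?f \<theta>))\<^sup>2)))"
  have der: "\<exists>d. (q has_vector_derivative d) (at \<theta>) \<and>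
      norm d \<le> 2 * sqrt (loglog_density (?f \<theta>)) * cmod (deriv F (Complex u \<theta>))" if t: "0 < \<theta>" "\<theta> < pi" for \<theta>
  proof -
    obtain d where d: "((\<lambda>\<theta>. (cmod (?f \<theta>))\<^sup>2) has_real_derivative d) (at \<theta>)"
      "\<bar>d\<bar> \<le> 2 * cmod (?f \<theta>) * cmod (deriv F (Complex u \<theta>))"
      using slice_has_norm_sq_derivative[OF F t] by blast
    define x where "x = 1 + (cmod (?f \<theta>))\<^sup>2"
    have x: "x > 0" "x \<ge> 1" by (simp_all add: x_def add_pos_nonneg)
    have l: "1 + ln x > 0" using x by (simp add: add_pos_nonneg)
    have "(q has_real_derivative (1 / (1 + ln x) * (1 / x * d))) (at \<theta>)"
    proof -
      have "((\<lambda>\<theta>. 1 + (cmod (?f \<theta>))\<^sup>2) has_real_derivative d) (at \<theta>)"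
        using DERIV_add[OF DERIV_const d(1), of 1] by simp
      then have "((\<lambda>\<theta>. ln (1 + (cmod (?f \<theta>))\<^sup>2)) has_real_derivative (1 / x * d)) (at \<theta>)"
        by (rule DERIV_chain2[rotated]) (use x in \<open>simp add: x_def DERIV_ln_divide\<close>)
      then have "((\<lambda>\<theta>. 1 + ln (1 + (cmod (?f \<theta>))\<^sup>2)) has_real_derivative (1 / x * d)) (at \<theta>)"
        using DERIV_add[OF DERIV_const] by fastforce
      then show ?thesis unfolding q_def
        by (rule DERIV_chain2[rotated]) (use l in \<open>simp add: x_def DERIV_ln_divide\<close>)
    qed
    moreover have "norm (1 / (1 + ln x) * (1 / x * d)) \<le> 2 * sqrt (loglog_density (?f \<theta>)) * cmod (deriv F (Complex u \<theta>))"
    proof -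
      have s: "cmod (?f \<theta>) \<le> sqrt x" unfolding x_def by (simp add: real_le_rsqrt)
      have "\<bar>d\<bar> \<le> 2 * sqrt x * cmod (deriv F (Complex u \<theta>))"
        using d(2) s by (meson mult_left_mono mult_right_mono norm_ge_zero order_trans zero_le_numeral)
      then have "\<bar>d\<bar> / (x * (1 + ln x)) \<le> (2 * sqrt x * cmod (deriv F (Complex u \<theta>))) / (x * (1 + ln x))"
        using x l by (intro divide_right_mono) auto
      also have "\<dots> = 2 * sqrt (loglog_density (?f \<theta>)) * cmod (deriv F (Complex u \<theta>))"
        using x l real_sqrt_mult_self[of x] unfolding sqrt_loglog_density x_def[symmetric]
        by (simp add: divide_simps)
      finally show ?thesis using x l by (simp add: abs_mult mult.commute)
    qed
    ultimately show ?thesis by (auto simp: has_real_derivative_iff_has_vector_derivative)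
  qed
  have le: "q \<theta> \<le> q (pi/2) + (E + pi)" if t: "0 < \<theta>" "\<theta> < pi" for \<theta>
  proof -
    have "norm (q \<theta> - q (pi/2)) \<le> 2 * (1 * E + \<bar>\<theta> - pi/2\<bar> / 1) / 2"
      by (rule slice_variation[OF F E der]) (use t in auto)
    also have "\<dots> \<le> E + pi" using t by (simp add: abs_if)
    finally show ?thesis by simp
  qed
  define M where "M = q (pi/2) + (E + pi)"
  have "cmod (?f \<theta>) \<le> sqrt (exp (exp M))" if t: "0 < \<theta>" "\<theta> < pi" for \<theta>
  proof -
    define x where "x = 1 + (cmod (?f \<theta>))\<^sup>2"
    have x: "x > 0" "x \<ge> 1" by (simp_all add: x_def add_pos_nonneg)
    have l: "1 + ln x > 0" using x by (simp add: add_pos_nonneg)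
    have "ln (1 + ln x) \<le> M" using le[OF t] by (simp add: q_def M_def x_def)
    then have "1 + ln x \<le> exp M" using l by (metis exp_le_cancel_iff exp_ln)
    then have "ln x \<le> exp M" by simp
    then have "x \<le> exp (exp M)" using x by (metis exp_le_cancel_iff exp_ln)
    then show ?thesis unfolding x_def by (intro real_le_rsqrt) simp
  qed
  then show ?thesis by (intro exI[of _ "sqrt (exp (exp M))"]) auto
qed

text \<open>On a bounded set the density is bounded below, so \<open>F\<close> is uniformly continuous along the slice and has limits at
both ends.\<close>
lemma extend_slice:
  assumes F: "F holomorphic_on strip" and E: "slice_energy F u < \<infinity>"
  obtains q where "continuous_on {0..pi} q" "\<And>\<theta>. 0 < \<theta> \<Longrightarrow> \<theta> < pi \<Longrightarrow> q \<theta> = F (Complex u \<theta>)"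
proof -
  obtain B where B: "\<And>\<theta>. 0 < \<theta> \<Longrightarrow> \<theta> < pi \<Longrightarrow> cmod (F (Complex u \<theta>)) \<le> B"
    using bounded_slice[OF assms] by (meson greaterThanLessThan_iff)
  obtain E where E: "slice_energy F u \<le> ennreal E" "0 \<le> E"
    using E by (metis ennreal_cases infinity_ennreal_def less_irrefl order_refl)
  define b where "b = 1 / (sqrt (1 + B\<^sup>2) * (1 + ln (1 + B\<^sup>2)))"
  have b0: "b > 0" unfolding b_def by (intro divide_pos_pos mult_pos_pos add_pos_nonneg) (auto intro: add_pos_nonneg)
  have bb: "b \<le> sqrt (loglog_density (F (Complex u \<theta>)))" if t: "0 < \<theta>" "\<theta> < pi" for \<theta>
  proof -
    have "(cmod (F (Complex u \<theta>)))\<^sup>2 \<le> B\<^sup>2" using B[OF t] by (intro power_mono) auto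
    then show ?thesis unfolding b_def sqrt_loglog_density
      by (intro divide_left_mono mult_mono mult_pos_pos add_pos_nonneg add_left_mono real_sqrt_le_mono) 
         (auto intro: add_pos_nonneg simp: add_pos_nonneg)
  qed
  have var: "cmod (F (Complex u \<theta>) - F (Complex u \<theta>')) \<le> (1/b) * (l * E + \<bar>\<theta> - \<theta>'\<bar> / l) / 2"
    if t: "0 < \<theta>" "\<theta> < pi" "0 < \<theta>'" "\<theta>' < pi" "0 < l" for \<theta> \<theta>' l
  proof (rule slice_variation[OF F E])
    fix \<theta> assume t: "0 < \<theta>" "\<theta> < pi"
    have "cmod (deriv F (Complex u \<theta>)) * b \<le> cmod (deriv F (Complex u \<theta>)) * sqrt (loglog_density (F (Complex u \<theta>)))"
      using bb[OF t] by (intro mult_left_mono) auto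
    then have "cmod (deriv F (Complex u \<theta>)) \<le> 1 / b * sqrt (loglog_density (F (Complex u \<theta>))) * cmod (deriv F (Complex u \<theta>))"
      using b0 by (simp add: field_simps)
    then show "\<exists>d. ((\<lambda>\<theta>. F (Complex u \<theta>)) has_vector_derivative d) (at \<theta>) \<and>
      norm d \<le> 1 / b * sqrt (loglog_density (F (Complex u \<theta>))) * cmod (deriv F (Complex u \<theta>))"
      using slice_has_vector_derivative[OF F t, of u]
      by (intro exI[of _ "\<i> * deriv F (Complex u \<theta>)"] conjI) (auto simp: norm_mult)
  qed (use b0 t in auto)
  have "uniformly_continuous_on {0<..<pi} (\<lambda>\<theta>. F (Complex u \<theta>))"
    unfolding uniformly_continuous_on_def
  proof (intro allI impI)
    fix e :: real assume e: "0 < e"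
    \<comment> \<open>the energy term is made small by \<open>l\<close>, the remaining one by the distance of the points\<close>
    define l where "l = b * e / (2 * (E + 1))"
    have l: "l > 0" "l * E \<le> b * e / 2" using b0 e E(2) by (auto simp: l_def field_simps)
    show "\<exists>d>0. \<forall>x\<in>{0<..<pi}. \<forall>x'\<in>{0<..<pi}. dist x' x < d \<longrightarrow> dist (F (Complex u x')) (F (Complex u x)) < e"
    proof (intro exI[of _ "l * (b * e)"] conjI ballI impI)
      fix x x' assume x: "x \<in> {0<..<pi}" "x' \<in> {0<..<pi}" "dist x' x < l * (b * e)"
      have "cmod (F (Complex u x') - F (Complex u x)) \<le> (1/b) * (l * E + \<bar>x' - x\<bar> / l) / 2"
        using x l by (intro var) auto
      also have "\<dots> < (1/b) * (b * e / 2 + b * e) / 2"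
        using x l b0 by (intro divide_strict_right_mono mult_strict_left_mono add_le_less_mono)
          (auto simp: dist_real_def field_simps)
      also have "\<dots> < e" using b0 e by (simp add: field_simps)
      finally show "dist (F (Complex u x')) (F (Complex u x)) < e" by (simp add: dist_norm)
    qed (use l b0 e in auto)
  qed
  then obtain q where "uniformly_continuous_on (closure {0<..<pi}) q" "\<And>x. x \<in> {0<..<pi} \<Longrightarrow> F (Complex u x) = q x"
    by (rule uniformly_continuous_on_extension_on_closure) auto
  then show ?thesis by (intro that[of q]) (auto simp: uniformly_continuous_imp_continuous)
qed

text \<open>Chordal distance is twice the Euclidean distance of the pairs \<open>(F / N, 1 / N)\<close> with \<open>N = 1 + \<bar>F\<bar>\<^sup>2\<close>, which are
the stereographic images up to an affine map; their derivatives are bounded by the spherical density.\<close>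
lemma chordal_dist_slice:
  assumes F: "F holomorphic_on strip" and E: "slice_energy F u \<le> ennreal (\<delta>\<^sup>2)" "0 < \<delta>"
    and ab: "0 < a" "a < pi" "0 < b" "b < pi"
  shows "chordal_dist (F (Complex u a)) (F (Complex u b)) \<le> 100 * \<delta>"
proof -
  let ?f = "\<lambda>\<theta>. F (Complex u \<theta>)"
  define N where "N = (\<lambda>\<theta>. 1 + (cmod (?f \<theta>))\<^sup>2)"
  have N: "N \<theta> > 0" "N \<theta> \<ge> 1" for \<theta> by (simp_all add: N_def add_pos_nonneg)
  define X where "X = (\<lambda>\<theta>. (1 / N \<theta>) *\<^sub>R ?f \<theta>)"
  define Y where "Y = (\<lambda>\<theta>. 1 / N \<theta>)"
  have key: "1 / N \<theta> \<le> 2 * sqrt (loglog_density (?f \<theta>))" for \<theta>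
  proof -
    define s where "s = sqrt (N \<theta>)"
    have s: "s \<ge> 1" "N \<theta> = s * s" using N[of \<theta>] by (auto simp: s_def)
    have "ln (s * s) = 2 * ln s" using s by (simp add: ln_mult)
    also have "\<dots> \<le> 2 * (s - 1)" using ln_le_minus_one[of s] s by simp
    finally have l: "1 + ln (s * s) \<le> 2 * s" by simp
    have p: "1 + ln (s * s) > 0" using s by (intro add_pos_nonneg) (auto simp: ln_mult)
    have "1 / (s * s) \<le> 2 * (1 / (s * (1 + ln (s * s))))"
      using s p l by (simp add: divide_simps)
    moreover have "sqrt (loglog_density (?f \<theta>)) = 1 / (s * (1 + ln (s * s)))"
    proof -
      have "1 + (cmod (?f \<theta>))\<^sup>2 = N \<theta>" by (simp add: N_def)
      then show ?thesis unfolding sqrt_loglog_density s_def using N[of \<theta>] by simp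
    qed
    ultimately show ?thesis by (simp only: s(2))
  qed
  have der: "\<exists>d. ((\<lambda>\<theta>. (X \<theta>, Y \<theta>)) has_vector_derivative d) (at \<theta>) \<and>
      norm d \<le> 10 * sqrt (loglog_density (?f \<theta>)) * cmod (deriv F (Complex u \<theta>))" if t: "0 < \<theta>" "\<theta> < pi" for \<theta>
  proof -
    obtain d where d: "((\<lambda>\<theta>. (cmod (?f \<theta>))\<^sup>2) has_real_derivative d) (at \<theta>)"
      "\<bar>d\<bar> \<le> 2 * cmod (?f \<theta>) * cmod (deriv F (Complex u \<theta>))"
      using slice_has_norm_sq_derivative[OF F t] by blast
    let ?D = "deriv F (Complex u \<theta>)"
    have Nd: "(N has_real_derivative d) (at \<theta>)"
      unfolding N_def using DERIV_add[OF DERIV_const d(1), of 1] by simp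
    have Yd: "(Y has_real_derivative (- d / (N \<theta>)\<^sup>2)) (at \<theta>)"
      using DERIV_inverse_fun[OF Nd] N[of \<theta>]
      by (simp add: Y_def divide_inverse power2_eq_square mult_ac)
    have Xd: "(X has_vector_derivative ((1 / N \<theta>) *\<^sub>R (\<i> * ?D) + (- d / (N \<theta>)\<^sup>2) *\<^sub>R ?f \<theta>)) (at \<theta>)"
      unfolding X_def using Yd unfolding Y_def
      by (intro has_vector_derivative_scaleR slice_has_vector_derivative[OF F t])
    have nn: "(cmod (?f \<theta>))\<^sup>2 \<le> N \<theta>" "cmod (?f \<theta>) \<le> N \<theta>"
    proof -
      have "2 * cmod (?f \<theta>) \<le> N \<theta>" using sum_squares_bound[of 1 "cmod (?f \<theta>)"] by (simp add: N_def)
      then show "cmod (?f \<theta>) \<le> N \<theta>" using norm_ge_zero[of "?f \<theta>"] by linarith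
    qed (simp add: N_def)
    have 1: "\<bar>d\<bar> / (N \<theta>)\<^sup>2 \<le> 2 * cmod ?D / N \<theta>"
    proof -
      have "\<bar>d\<bar> \<le> 2 * N \<theta> * cmod ?D" using d(2) nn(2)
        by (meson mult_left_mono mult_right_mono norm_ge_zero order_trans zero_le_numeral)
      then show ?thesis using N[of \<theta>] by (simp add: power2_eq_square divide_simps mult.commute mult.left_commute)
    qed
    have 2: "\<bar>d\<bar> / (N \<theta>)\<^sup>2 * cmod (?f \<theta>) \<le> 2 * cmod ?D / N \<theta>"
    proof -
      have "\<bar>d\<bar> * cmod (?f \<theta>) \<le> 2 * cmod ?D * (cmod (?f \<theta>))\<^sup>2" 
        using mult_right_mono[OF d(2), of "cmod (?f \<theta>)"] by (simp add: power2_eq_square mult_ac)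
      also have "\<dots> \<le> 2 * cmod ?D * N \<theta>" using nn(1) by (intro mult_left_mono) auto
      finally show ?thesis using N[of \<theta>] by (simp add: power2_eq_square divide_simps mult.commute mult.left_commute)
    qed
    have "((\<lambda>\<theta>. (X \<theta>, Y \<theta>)) has_vector_derivative ((1 / N \<theta>) *\<^sub>R (\<i> * ?D) + (- d / (N \<theta>)\<^sup>2) *\<^sub>R ?f \<theta>, - d / (N \<theta>)\<^sup>2)) (at \<theta>)"
      using Xd Yd by (intro has_vector_derivative_Pair) (auto simp: has_real_derivative_iff_has_vector_derivative)
    moreover have "norm ((1 / N \<theta>) *\<^sub>R (\<i> * ?D) + (- d / (N \<theta>)\<^sup>2) *\<^sub>R ?f \<theta>, - d / (N \<theta>)\<^sup>2) \<le>
        norm ((1 / N \<theta>) *\<^sub>R (\<i> * ?D) + (- d / (N \<theta>)\<^sup>2) *\<^sub>R ?f \<theta>) + norm (- d / (N \<theta>)\<^sup>2)"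
      by (rule norm_Pair_le)
    moreover have "\<dots> \<le> cmod ?D / N \<theta> + \<bar>d\<bar> / (N \<theta>)\<^sup>2 * cmod (?f \<theta>) + \<bar>d\<bar> / (N \<theta>)\<^sup>2"
      using N[of \<theta>] by (intro add_mono order_trans[OF norm_triangle_ineq]) (auto simp: norm_mult)
    moreover have "\<dots> \<le> 5 * (cmod ?D * (1 / N \<theta>))" using 1 2 by simp
    moreover have "\<dots> \<le> 5 * (cmod ?D * (2 * sqrt (loglog_density (?f \<theta>))))"
      using key[of \<theta>] by (intro mult_left_mono) auto
    ultimately show ?thesis by (intro exI conjI) (assumption, simp add: mult_ac)
  qed
  have "norm ((X b, Y b) - (X a, Y a)) \<le> 10 * (1/\<delta> * \<delta>\<^sup>2 + \<bar>b - a\<bar> / (1/\<delta>)) / 2"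
    by (rule slice_variation[OF F E(1) _ der]) (use ab E in auto)
  also have "\<dots> \<le> 10 * (1/\<delta> * \<delta>\<^sup>2 + 4 / (1/\<delta>)) / 2"
    using ab E pi_less_4 by (intro divide_right_mono mult_left_mono add_left_mono) auto
  also have "\<dots> = 25 * \<delta>" using E by (simp add: power2_eq_square)
  finally have n: "norm (X b - X a, Y b - Y a) \<le> 25 * \<delta>" by simp
  have "(chordal_dist (?f a) (?f b))\<^sup>2 = 4 * (norm (X b - X a, Y b - Y a))\<^sup>2"
  proof -
    have id: "4 * (((x/(1+(x\<^sup>2+y\<^sup>2)) - x'/(1+(x'\<^sup>2+y'\<^sup>2)))\<^sup>2 + (y/(1+(x\<^sup>2+y\<^sup>2)) - y'/(1+(x'\<^sup>2+y'\<^sup>2)))\<^sup>2) + (1/(1+(x\<^sup>2+y\<^sup>2)) - 1/(1+(x'\<^sup>2+y'\<^sup>2)))\<^sup>2)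
       = 4 * ((x - x')\<^sup>2 + (y - y')\<^sup>2) / ((1+(x\<^sup>2+y\<^sup>2)) * (1+(x'\<^sup>2+y'\<^sup>2)))" for x y x' y' :: real
    proof -
      define p q where "p = 1+(x\<^sup>2+y\<^sup>2)" and "q = 1+(x'\<^sup>2+y'\<^sup>2)"
      have nz: "p \<noteq> 0" "q \<noteq> 0" unfolding p_def q_def by (smt (verit) zero_le_power2)+
      have "(x*q - x'*p)\<^sup>2 + (y*q - y'*p)\<^sup>2 + (q - p)\<^sup>2 = p*q*((x - x')\<^sup>2 + (y - y')\<^sup>2)"
        using p_def q_def by algebra
      moreover have "x/p - x'/q = (x*q - x'*p)/(p*q)" "y/p - y'/q = (y*q - y'*p)/(p*q)" "1/p - 1/q = (q - p)/(p*q)"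
        using nz by (simp_all add: diff_frac_eq)
      ultimately have "((x/p - x'/q)\<^sup>2 + (y/p - y'/q)\<^sup>2) + (1/p - 1/q)\<^sup>2 = p*q*((x - x')\<^sup>2 + (y - y')\<^sup>2) / (p*q)\<^sup>2"
        by (simp only: power_divide flip: add_divide_distrib)
      then show ?thesis unfolding p_def[symmetric] q_def[symmetric] using nz by (simp add: power2_eq_square)
    qed
    have "(chordal_dist (?f a) (?f b))\<^sup>2 = 4 * (cmod (?f b - ?f a))\<^sup>2 / (N b * N a)"
    proof -
      have e: "1 + (cmod (?f a))\<^sup>2 = N a" "1 + (cmod (?f b))\<^sup>2 = N b" by (simp_all add: N_def)
      show ?thesis unfolding chordal_dist_def e using N[of a] N[of b]
        by (simp add: power_divide power_mult_distrib norm_minus_commute mult.commute)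
    qed
    then show ?thesis
      using id[of "Re (?f b)" "Im (?f b)" "Re (?f a)" "Im (?f a)"]
      unfolding norm_Pair cmod_power2 X_def Y_def N_def
      by (simp add: cmod_power2)
  qed
  also have "\<dots> \<le> 4 * (25 * \<delta>)\<^sup>2" using n by (intro mult_left_mono power_mono) auto
  also have "\<dots> = (50 * \<delta>)\<^sup>2" by (simp add: power_mult_distrib)
  finally have "chordal_dist (?f a) (?f b) \<le> 50 * \<delta>" by (rule power2_le_imp_le) (use E in simp)
  then show ?thesis using E by simp
qed

section \<open>Null-chains cut out by vertical slices\<close>

text \<open>An end point inside the image would be \<open>F w\<close> for some \<open>w\<close> in the strip; by continuity of the inverse map, points of the slice
that approach the boundary of the strip would tend to \<open>w\<close>.\<close>
lemma slice_endpoint_not_in_image: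
  assumes F: "F holomorphic_on strip" "inj_on F strip"
    and q: "continuous_on {0..pi} q" "\<And>\<theta>. 0 < \<theta> \<Longrightarrow> \<theta> < pi \<Longrightarrow> q \<theta> = F (Complex u \<theta>)"
    and e: "e = 0 \<or> e = pi"
  shows "q e \<notin> F ` strip" "q e \<in> closure (F ` strip)"
    "((\<lambda>\<theta>. F (Complex u \<theta>)) \<longlongrightarrow> q e) (at e within {0<..<pi})" "at e within {0<..<pi} \<noteq> bot"
proof -
  show nb: "at e within {0<..<pi} \<noteq> bot"
  proof -
    have "e islimpt {0<..<pi}" using e islimpt_greaterThanLessThan1[of 0 pi] islimpt_greaterThanLessThan2[of 0 pi] by auto
    then show ?thesis by (simp add: trivial_limit_within)
  qed
  have "(q \<longlongrightarrow> q e) (at e within {0..pi})" using q(1) e by (auto simp: continuous_on_def)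
  then have "(q \<longlongrightarrow> q e) (at e within {0<..<pi})" by (rule tendsto_within_subset) auto
  then show lim: "((\<lambda>\<theta>. F (Complex u \<theta>)) \<longlongrightarrow> q e) (at e within {0<..<pi})"
    by (rule Lim_transform_eventually) (auto simp: eventually_at_filter q(2))
  have ev: "\<forall>\<^sub>F \<theta> in at e within {0<..<pi}. F (Complex u \<theta>) \<in> F ` strip"
    by (auto simp: eventually_at_filter strip_def)
  show "q e \<in> closure (F ` strip)"
    by (rule Lim_in_closed_set[OF closed_closure eventually_mono[OF ev] nb lim]) (rule subsetD[OF closure_subset])
  show "q e \<notin> F ` strip"
  proof
    assume "q e \<in> F ` strip"
    then obtain w where w: "w \<in> strip" "q e = F w" by auto
    obtain g where g: "g holomorphic_on (F ` strip)" "\<And>z. z \<in> strip \<Longrightarrow> g (F z) = z"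
      using holomorphic_has_inverse[OF F(1) open_strip F(2)] by metis
    have op: "open (F ` strip)" using open_mapping_thm3[OF F(1) open_strip F(2)] .
    have "isCont g (F w)"
      using holomorphic_on_imp_continuous_on[OF g(1)] op w by (simp add: continuous_on_eq_continuous_at)
    then have "((\<lambda>\<theta>. g (F (Complex u \<theta>))) \<longlongrightarrow> g (F w)) (at e within {0<..<pi})"
      using lim w(2) by (metis isCont_tendsto_compose)
    then have "((\<lambda>\<theta>. Complex u \<theta>) \<longlongrightarrow> g (F w)) (at e within {0<..<pi})"
      by (rule Lim_transform_eventually) (auto simp: eventually_at_filter g(2) strip_def)
    then have "((\<lambda>\<theta>. Complex u \<theta>) \<longlongrightarrow> w) (at e within {0<..<pi})"
      using g(2)[OF w(1)] by simp
    moreover have "((\<lambda>\<theta>. Complex u \<theta>) \<longlongrightarrow> Complex u e) (at e within {0<..<pi})"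
      by (intro tendsto_intros)
    ultimately have "w = Complex u e" using tendsto_unique nb by blast
    then show False using w(1) e by (auto simp: strip_def)
  qed
qed

text \<open>If the slice of \<open>1 / (F - a)\<close> has finite energy, this function is bounded along it, so \<open>F\<close> does not tend to \<open>a\<close>. This replaces
the theorem of F. and M. Riesz: a boundary value is attained only on a null set of slices.\<close>
lemma slice_energy_inverse_avoids:
  assumes F: "F holomorphic_on strip" "inj_on F strip" and a: "a \<notin> F ` strip"
    and q: "continuous_on {0..pi} q" "\<And>\<theta>. 0 < \<theta> \<Longrightarrow> \<theta> < pi \<Longrightarrow> q \<theta> = F (Complex u \<theta>)"
    and e: "e = 0 \<or> e = pi" and E: "slice_energy (\<lambda>z. 1 / (F z - a)) u < \<infinity>"
  shows "q e \<noteq> a"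
proof
  assume "q e = a"
  have h: "(\<lambda>z. 1 / (F z - a)) holomorphic_on strip" using F(1) a by (intro holomorphic_intros) auto
  obtain B where B: "\<And>\<theta>. 0 < \<theta> \<Longrightarrow> \<theta> < pi \<Longrightarrow> cmod (1 / (F (Complex u \<theta>) - a)) \<le> B"
    using bounded_slice[OF h E] by (meson greaterThanLessThan_iff)
  have "1 \<le> max B 1 * cmod (F (Complex u \<theta>) - a)" if "0 < \<theta>" "\<theta> < pi" for \<theta>
  proof -
    have "Complex u \<theta> \<in> strip" using that by (simp add: strip_def)
    then have nz: "F (Complex u \<theta>) - a \<noteq> 0" using a by auto
    have "1 / cmod (F (Complex u \<theta>) - a) \<le> max B 1" using B[OF that] by (simp add: norm_divide)
    then show ?thesis using nz by (simp add: field_simps)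
  qed
  then have "\<forall>\<^sub>F \<theta> in at e within {0<..<pi}. 1 \<le> max B 1 * cmod (F (Complex u \<theta>) - a)"
    by (auto simp: eventually_at_filter)
  moreover have "((\<lambda>\<theta>. max B 1 * cmod (F (Complex u \<theta>) - a)) \<longlongrightarrow> max B 1 * cmod (a - a)) (at e within {0<..<pi})"
    using slice_endpoint_not_in_image(3)[OF F q e] \<open>q e = a\<close> by (intro tendsto_intros) auto
  ultimately have "1 \<le> max B 1 * cmod (a - a)"
    using tendsto_lowerbound slice_endpoint_not_in_image(4)[OF F q e] by blast
  then show False by simp
qed

text \<open>The energies of \<open>F\<close>, \<open>1 / (F - a)\<close> and \<open>1 / (F - b)\<close> are integrable together, so a single segment makes all three small.\<close>
lemma exists_good_slice:
  assumes F: "F holomorphic_on strip" "inj_on F strip" and a: "a \<notin> F ` strip" "b \<notin> F ` strip" and d: "0 < \<delta>"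
  obtains u q where "N < u" "continuous_on {0..pi} q" "\<And>\<theta>. 0 < \<theta> \<Longrightarrow> \<theta> < pi \<Longrightarrow> q \<theta> = F (Complex u \<theta>)"
    "{q 0, q pi} \<inter> {a, b} = {}"
    "\<And>s t. 0 < s \<Longrightarrow> s < pi \<Longrightarrow> 0 < t \<Longrightarrow> t < pi \<Longrightarrow> chordal_dist (F (Complex u s)) (F (Complex u t)) \<le> \<delta>"
proof -
  define A where "A = (\<lambda>z. 1 / (F z - a))"
  define B where "B = (\<lambda>z. 1 / (F z - b))"
  have A: "A holomorphic_on strip" "inj_on A strip" 
    unfolding A_def using F a by (auto intro!: holomorphic_intros simp: inj_on_def)
  have B: "B holomorphic_on strip" "inj_on B strip" 
    unfolding B_def using F a by (auto intro!: holomorphic_intros simp: inj_on_def)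
  note [measurable] = slice_energy(1)[OF F] slice_energy(1)[OF A] slice_energy(1)[OF B]
  let ?E = "\<lambda>u. slice_energy F u + (slice_energy A u + slice_energy B u)"
  have "(\<integral>\<^sup>+u. ?E u \<partial>lborel) < \<infinity>"
    using slice_energy(2)[OF F] slice_energy(2)[OF A] slice_energy(2)[OF B]
    by (simp add: nn_integral_add)
  then obtain u where u: "N < u" "?E u < ennreal ((\<delta>/100)\<^sup>2)"
    using exists_small_slice[of ?E "(\<delta>/100)\<^sup>2" N] d by auto
  have EF: "slice_energy F u \<le> ennreal ((\<delta>/100)\<^sup>2)"
  proof -
    have "slice_energy F u \<le> ?E u" by (simp add: add_increasing2)
    then show ?thesis using less_imp_le[OF u(2)] by (rule order_trans)
  qed
  have fin: "?E u < \<infinity>" using less_trans[OF u(2) ennreal_less_top] by simp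
  have EA: "slice_energy F u < \<infinity>" "slice_energy A u < \<infinity>" "slice_energy B u < \<infinity>" using fin by auto
  obtain q where q: "continuous_on {0..pi} q" "\<And>\<theta>. 0 < \<theta> \<Longrightarrow> \<theta> < pi \<Longrightarrow> q \<theta> = F (Complex u \<theta>)"
    using extend_slice[OF F(1) EA(1)] by metis
  have ne: "q e \<noteq> a" "q e \<noteq> b" if "e = 0 \<or> e = pi" for e
    using slice_energy_inverse_avoids[OF F a(1) q that EA(2)[unfolded A_def]]
          slice_energy_inverse_avoids[OF F a(2) q that EA(3)[unfolded B_def]] by auto
  show ?thesis
  proof (rule that[OF u(1) q])
    show "{q 0, q pi} \<inter> {a, b} = {}" using ne by auto
    show "chordal_dist (F (Complex u s)) (F (Complex u t)) \<le> \<delta>" if "0 < s" "s < pi" "0 < t" "t < pi" for s t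
      using chordal_dist_slice[OF F(1) EF _ that] d by simp
  qed
qed

text \<open>Dependent choice: each slice is required to avoid the two end points of the preceding one, which lie outside the image.\<close>
lemma good_slices:
  assumes F: "F holomorphic_on strip" "inj_on F strip"
  obtains u q where "\<And>n. real n < u n" "\<And>n. u n < u (Suc n)" "\<And>n::nat. continuous_on {0..pi} (q n)"
    "\<And>n \<theta>. 0 < \<theta> \<Longrightarrow> \<theta> < pi \<Longrightarrow> q n \<theta> = F (Complex (u n) \<theta>)"
    "\<And>n. {q n 0, q n pi} \<inter> {q (Suc n) 0, q (Suc n) pi} = {}"
    "\<And>n s t. 0 < s \<Longrightarrow> s < pi \<Longrightarrow> 0 < t \<Longrightarrow> t < pi \<Longrightarrow> chordal_dist (F (Complex (u n) s)) (F (Complex (u n) t)) \<le> 1 / (real n + 1)"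
proof -
  define P where "P n x \<longleftrightarrow> real n < fst x \<and> continuous_on {0..pi} (snd x) \<and> (\<forall>\<theta>. 0 < \<theta> \<longrightarrow> \<theta> < pi \<longrightarrow> snd x \<theta> = F (Complex (fst x) \<theta>))
     \<and> (\<forall>s t. 0 < s \<longrightarrow> s < pi \<longrightarrow> 0 < t \<longrightarrow> t < pi \<longrightarrow> chordal_dist (F (Complex (fst x) s)) (F (Complex (fst x) t)) \<le> 1 / (real n + 1))"
    for n :: nat and x :: "real \<times> (real \<Rightarrow> complex)"
  define Q where "Q x y \<longleftrightarrow> fst x < fst y \<and> {snd x 0, snd x pi} \<inter> {snd y 0, snd y pi} = {}"
    for x y :: "real \<times> (real \<Rightarrow> complex)"
  have nend: "snd x 0 \<notin> F ` strip" "snd x pi \<notin> F ` strip" if "P n x" for n x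
    using slice_endpoint_not_in_image(1)[OF F, of "snd x" "fst x"] that by (auto simp: P_def)
  have P1: "\<exists>y. P m y \<and> N < fst y \<and> {snd y 0, snd y pi} \<inter> {a, b} = {}" if ab: "a \<notin> F ` strip" "b \<notin> F ` strip" for m N a b
  proof -
    obtain u q where uq: "max (real m) N < u" "continuous_on {0..pi} q" "\<And>\<theta>. 0 < \<theta> \<Longrightarrow> \<theta> < pi \<Longrightarrow> q \<theta> = F (Complex u \<theta>)"
      "{q 0, q pi} \<inter> {a, b} = {}"
      "\<And>s t. 0 < s \<Longrightarrow> s < pi \<Longrightarrow> 0 < t \<Longrightarrow> t < pi \<Longrightarrow> chordal_dist (F (Complex u s)) (F (Complex u t)) \<le> 1 / (real m + 1)"
      by (rule exists_good_slice[OF F ab, of "1 / (real m + 1)" "max (real m) N"]) auto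
    show ?thesis by (rule exI[of _ "(u, q)"]) (use uq in \<open>auto simp: P_def\<close>)
  qed
  have "F ` strip \<noteq> UNIV"
  proof
    assume U: "F ` strip = UNIV"
    \<comment> \<open>otherwise the inverse of \<open>F\<close> is a nonconstant entire function with values in a strip\<close>
    obtain g where g: "g holomorphic_on (F ` strip)" "\<And>z. z \<in> strip \<Longrightarrow> g (F z) = z"
      using holomorphic_has_inverse[OF F(1) open_strip F(2)] by metis
    have gs: "g w \<in> strip" for w using g(2) U by (metis UNIV_I imageE)
    have "(\<lambda>w. exp (\<i> * g w)) holomorphic_on UNIV" using g(1) U by (intro holomorphic_intros) auto
    moreover have "bounded (range (\<lambda>w. exp (\<i> * g w)))"
      unfolding bounded_iff by (rule exI[of _ 1]) (use gs in \<open>auto simp: strip_def less_imp_le\<close>)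
    ultimately obtain c where c: "\<And>w. exp (\<i> * g w) = c" using Liouville_theorem by (metis constant_on_def UNIV_I)
    have "exp (\<i> * (\<i> * 1)) = exp (\<i> * (\<i> * 2))"
      using c[of "F (\<i> * 1)"] c[of "F (\<i> * 2)"] g(2)[of "\<i> * 1"] g(2)[of "\<i> * 2"] pi_gt3 by (simp add: strip_def)
    then have "cmod (exp (\<i> * (\<i> * 1))) = cmod (exp (\<i> * (\<i> * 2)))" by simp
    then show False by simp
  qed
  then obtain a0 where a0: "a0 \<notin> F ` strip" by auto
  have "\<exists>f. \<forall>n. P n (f n) \<and> Q (f n) (f (Suc n))"
  proof (rule dependent_nat_choice)
    show "\<exists>x. P 0 x" using P1[OF a0 a0] by blast
    show "\<exists>y. P (Suc n) y \<and> Q x y" if "P n x" for n x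
      using P1[OF nend[OF that], of "Suc n" "fst x"] unfolding Q_def by blast
  qed
  then obtain f where f: "\<And>n. P n (f n)" "\<And>n. Q (f n) (f (Suc n))" by auto
  show ?thesis
    by (rule that[of "\<lambda>n. fst (f n)" "\<lambda>n. snd (f n)"]) (use f in \<open>auto simp: P_def Q_def\<close>)
qed

lemma boundary_infI:
  assumes "open G" "a \<in> closure G" "a \<notin> G"
  shows "Some a \<in> boundary_inf G"
proof -
  have "Some a \<in> riemann_sphere closure_of (Some ` G)"
    unfolding in_closure_of
  proof (intro conjI allI impI)
    fix T assume T: "Some a \<in> T \<and> openin riemann_sphere T"
    have "open {z. Some z \<in> T}"
      using T continuous_map_Some[of euclidean] by (auto simp: continuous_map_def)
    then have "{z. Some z \<in> T} \<inter> G \<noteq> {}"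
      using assms(2) T open_Int_closure_eq_empty[of "{z. Some z \<in> T}" G] by auto
    then show "\<exists>y. y \<in> Some ` G \<and> y \<in> T" by auto
  qed simp
  then show ?thesis
    using assms(3) interior_of_subset[of riemann_sphere "Some ` G"] by (auto simp: boundary_inf_def frontier_of_def)
qed

definition strip_cut :: "real \<Rightarrow> complex set" where "strip_cut u = {z \<in> strip. Re z = u}"
definition strip_end :: "real \<Rightarrow> complex set" where "strip_end u = {z \<in> strip. u < Re z}"

lemma strip_cut_eq: "strip_cut u = Complex u ` {0<..<pi}"
  by (auto simp: strip_cut_def strip_def image_iff complex_eq_iff)

lemma connected_strip_end: "connected (strip_end u)"
proof -
  have "strip_end u = strip \<inter> {z. Re z > u}" by (auto simp: strip_end_def)
  then show ?thesis by (simp add: convex_connected convex_Int convex_strip convex_halfspace_Re_gt)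
qed

lemma crosscut_slice:
  assumes F: "F holomorphic_on strip" "inj_on F strip"
    and q: "continuous_on {0..pi} q" "\<And>\<theta>. 0 < \<theta> \<Longrightarrow> \<theta> < pi \<Longrightarrow> q \<theta> = F (Complex u \<theta>)"
  shows "crosscut (F ` strip) (F ` strip_cut u)"
  unfolding crosscut_def
proof (intro exI conjI)
  let ?g = "\<lambda>x. q (pi * x)"
  have op: "open (F ` strip)" using open_mapping_thm3[OF F(1) open_strip F(2)] .
  have cg: "continuous_on {0..1} ?g" by (rule continuous_on_compose2[OF q(1)]) (auto intro!: continuous_intros simp: mult_left_le)
  show "continuous_map (top_of_set {0..1}) riemann_sphere (Some \<circ> ?g)"
    by (rule continuous_map_compose[OF _ continuous_map_Some]) (use cg in simp)
  have qf: "?g x = F (Complex u (pi * x))" "Complex u (pi * x) \<in> strip" if "x \<in> {0<..<1}" for x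
    using q(2)[of "pi * x"] that by (auto simp: strip_def)
  show "inj_on (Some \<circ> ?g) {0<..<1}"
  proof (rule inj_onI)
    fix x y :: real assume xy: "x \<in> {0<..<1}" "y \<in> {0<..<1}" "(Some \<circ> ?g) x = (Some \<circ> ?g) y"
    then have "F (Complex u (pi * x)) = F (Complex u (pi * y))" using qf(1) by simp
    then have "Complex u (pi * x) = Complex u (pi * y)" using inj_onD[OF F(2)] qf(2) xy by blast
    then show "x = y" by simp
  qed
  have im: "(\<lambda>x. pi * x) ` {0<..<1} = {0<..<pi}"
  proof -
    have "\<theta> \<in> (\<lambda>x. pi * x) ` {0<..<1}" if "\<theta> \<in> {0<..<pi}" for \<theta>
      by (rule image_eqI[of _ _ "\<theta> / pi"]) (use that in auto)
    then show ?thesis by auto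
  qed
  show "(Some \<circ> ?g) ` {0<..<1} = Some ` F ` strip_cut u"
  proof -
    have "(Some \<circ> ?g) ` {0<..<1} = (\<lambda>x. Some (F (Complex u x))) ` (\<lambda>x. pi * x) ` {0<..<1}"
      unfolding image_image by (rule image_cong) (use qf(1) in auto)
    then show ?thesis unfolding im strip_cut_eq by (simp add: image_image)
  qed
  show "F ` strip_cut u \<subseteq> F ` strip" by (auto simp: strip_cut_def)
  show "(Some \<circ> ?g) 0 \<in> boundary_inf (F ` strip)"
    using slice_endpoint_not_in_image(1,2)[OF F q, of 0] boundary_infI[OF op] by simp
  show "(Some \<circ> ?g) 1 \<in> boundary_inf (F ` strip)"
    using slice_endpoint_not_in_image(1,2)[OF F q, of pi] boundary_infI[OF op] by simp
qed

lemma closure_of_slice: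
  assumes q: "continuous_on {0..pi} q" "\<And>\<theta>. 0 < \<theta> \<Longrightarrow> \<theta> < pi \<Longrightarrow> q \<theta> = F (Complex u \<theta>)"
  shows "riemann_sphere closure_of (Some ` F ` strip_cut u) \<subseteq> Some ` (insert (q 0) (insert (q pi) (F ` strip_cut u)))"
proof -
  have "q ` {0..pi} \<subseteq> insert (q 0) (insert (q pi) (F ` strip_cut u))"
  proof (rule image_subsetI)
    fix x assume "x \<in> {0..pi}"
    then consider "x = 0" | "x = pi" | "x \<in> {0<..<pi}" by fastforce
    then show "q x \<in> insert (q 0) (insert (q pi) (F ` strip_cut u))"
      by cases (simp_all add: q(2) strip_cut_eq)
  qed
  moreover have "riemann_sphere closure_of (Some ` F ` strip_cut u) \<subseteq> Some ` q ` {0..pi}"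
  proof (rule closure_of_minimal)
    show "Some ` F ` strip_cut u \<subseteq> Some ` q ` {0..pi}"
    proof (intro image_mono image_subsetI)
      fix z assume "z \<in> strip_cut u"
      then obtain \<theta> where "z = Complex u \<theta>" "0 < \<theta>" "\<theta> < pi" by (auto simp: strip_cut_eq)
      then show "F z \<in> q ` {0..pi}" using q(2)[of \<theta>] by (intro image_eqI[of _ _ \<theta>]) auto
    qed
    have "compact (q ` {0..pi})" using q(1) by (intro compact_continuous_image) auto
    then show "closedin riemann_sphere (Some ` q ` {0..pi})" by (simp add: compact_imp_closed)
  qed
  ultimately show ?thesis by blast
qed

text \<open>The real part of the inverse map is continuous on a connected set that avoids the cut, so it cannot pass the value \<open>u\<close>.\<close>
lemma strip_end_component:
  assumes F: "F holomorphic_on strip" "inj_on F strip" and w: "w \<in> strip_end u"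
  shows "connected_component_set (F ` strip - F ` strip_cut u) (F w) = F ` strip_end u"
proof (rule antisym)
  have eq: "F ` strip - F ` strip_cut u = F ` (strip - strip_cut u)"
    using F(2) by (simp add: inj_on_image_set_diff strip_cut_def)
  show "F ` strip_end u \<subseteq> connected_component_set (F ` strip - F ` strip_cut u) (F w)"
  proof (rule connected_component_maximal)
    show "F w \<in> F ` strip_end u" using w by simp
    show "connected (F ` strip_end u)"
      by (intro connected_continuous_image connected_strip_end continuous_on_subset[OF holomorphic_on_imp_continuous_on[OF F(1)]])
         (auto simp: strip_end_def)
    show "F ` strip_end u \<subseteq> F ` strip - F ` strip_cut u"
      unfolding eq by (auto simp: strip_end_def strip_cut_def)
  qed
  show "connected_component_set (F ` strip - F ` strip_cut u) (F w) \<subseteq> F ` strip_end u"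
  proof
    fix y assume "y \<in> connected_component_set (F ` strip - F ` strip_cut u) (F w)"
    then obtain T where T: "connected T" "T \<subseteq> F ` (strip - strip_cut u)" "y \<in> T" "F w \<in> T"
      unfolding eq by (auto simp: connected_component_def)
    obtain g where g: "g holomorphic_on (F ` strip)" "\<And>z. z \<in> strip \<Longrightarrow> g (F z) = z"
      using holomorphic_has_inverse[OF F(1) open_strip F(2)] by metis
    have "connected ((\<lambda>x. Re (g x)) ` T)"
      by (intro connected_continuous_image T(1) continuous_intros continuous_on_subset[OF holomorphic_on_imp_continuous_on[OF g(1)]])
         (use T(2) in auto)
    then have iv: "is_interval ((\<lambda>x. Re (g x)) ` T)" by (simp add: is_interval_connected_1)
    have "u \<notin> (\<lambda>x. Re (g x)) ` T" using T(2) g(2) by (auto simp: strip_cut_def)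
    moreover have "Re (g (F w)) > u" using w g(2) by (auto simp: strip_end_def)
    moreover have "Re (g y) \<in> (\<lambda>x. Re (g x)) ` T" "Re (g (F w)) \<in> (\<lambda>x. Re (g x)) ` T" using T by auto
    ultimately have "Re (g y) > u" using iv unfolding is_interval_1 by (meson linorder_le_less_linear less_imp_le)
    moreover obtain z where "z \<in> strip" "y = F z" using T(2,3) by auto
    ultimately show "y \<in> F ` strip_end u" using g(2) by (auto simp: strip_end_def)
  qed
qed

text \<open>The length-area argument in its final form: for conformal images of the strip the null-chain can be taken to consist of images
of vertical segments, and the domains they cut off are known explicitly.\<close>
lemma null_chain_slices:
  assumes F: "F holomorphic_on strip" "inj_on F strip"
  obtains u where "\<And>n. real n < u n" "strict_mono u"
    "null_chain (F ` strip) (\<lambda>n. F ` strip_cut (u n))"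
    "\<And>n. chain_domain (F ` strip) (\<lambda>n. F ` strip_cut (u n)) n = F ` strip_end (u n)"
proof -
  obtain u q where uq: "\<And>n. real n < u n" "\<And>n. u n < u (Suc n)" "\<And>n::nat. continuous_on {0..pi} (q n)"
    "\<And>n \<theta>. 0 < \<theta> \<Longrightarrow> \<theta> < pi \<Longrightarrow> q n \<theta> = F (Complex (u n) \<theta>)"
    "\<And>n. {q n 0, q n pi} \<inter> {q (Suc n) 0, q (Suc n) pi} = {}"
    "\<And>n s t. 0 < s \<Longrightarrow> s < pi \<Longrightarrow> 0 < t \<Longrightarrow> t < pi \<Longrightarrow> chordal_dist (F (Complex (u n) s)) (F (Complex (u n) t)) \<le> 1 / (real n + 1)"
    using good_slices[OF F] by metis
  have sm: "strict_mono u" using uq(2) by (simp add: strict_mono_Suc_iff)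
  let ?C = "\<lambda>n. F ` strip_cut (u n)" and ?G = "F ` strip"
  have cut_disj: "F ` strip_cut a \<inter> F ` strip_cut b = {}" if "a \<noteq> b" for a b
    using that F(2) by (auto simp: inj_on_def strip_cut_def)
  have sub: "F ` strip_cut a \<subseteq> ?G" for a by (auto simp: strip_cut_def)
  have e: "q n 0 \<notin> ?G" "q n pi \<notin> ?G" for n
    using slice_endpoint_not_in_image(1)[OF F uq(3,4), where e=0] slice_endpoint_not_in_image(1)[OF F uq(3,4), where e=pi] by auto
  have cut_end: "strip_cut b \<subseteq> strip_end a" if "a < b" for a b using that by (auto simp: strip_cut_def strip_end_def)
  have comp: "connected_component_set (?G - ?C n) (F w) = F ` strip_end (u n)" if "w \<in> strip_cut (u (Suc n))" for n w
    using strip_end_component[OF F] cut_end[OF uq(2)] that by blast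
  have ne: "strip_cut a \<noteq> {}" for a unfolding strip_cut_eq using pi_gt_zero by (simp add: not_le)
  have disj_ins: "insert a (insert b A) \<inter> insert c (insert d B) = {}"
    if "{a, b} \<inter> {c, d} = {}" "A \<inter> B = {}" "A \<subseteq> S" "B \<subseteq> S" "a \<notin> S" "b \<notin> S" "c \<notin> S" "d \<notin> S"
    for a b c d :: complex and A B S using that by auto
  have dif: "A \<subseteq> S - B" if "A \<subseteq> S" "A \<inter> B = {}" for A B S :: "complex set"
    using that by auto
  have "null_chain ?G ?C" unfolding null_chain_def
  proof (intro conjI allI impI)
    fix n show "crosscut ?G (?C n)" using crosscut_slice[OF F uq(3,4)] .
    show "riemann_sphere closure_of (Some ` ?C n) \<inter> riemann_sphere closure_of (Some ` ?C (Suc n)) = {}"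
    proof -
      let ?A = "insert (q n 0) (insert (q n pi) (?C n))"
      let ?B = "insert (q (Suc n) 0) (insert (q (Suc n) pi) (?C (Suc n)))"
      have "?C n \<inter> ?C (Suc n) = {}" using cut_disj[of "u n" "u (Suc n)"] uq(2)[of n] by simp
      then have "?A \<inter> ?B = {}"
        using disj_ins[OF uq(5) _ sub sub e(1) e(2) e(1) e(2)] by blast
      then have "Some ` ?A \<inter> Some ` ?B = {}" by (metis image_Int image_empty inj_Some)
      moreover have "riemann_sphere closure_of (Some ` ?C n) \<subseteq> Some ` ?A"
        by (rule closure_of_slice[OF uq(3,4)])
      moreover have "riemann_sphere closure_of (Some ` ?C (Suc n)) \<subseteq> Some ` ?B"
        by (rule closure_of_slice[OF uq(3,4)])
      ultimately show ?thesis by (meson disjoint_iff subsetD)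
    qed
  next
    fix n :: nat assume n: "n \<ge> 1"
    have un: "u 0 < u n" using sm n by (simp add: strict_mono_less)
    show "separates_in ?G (?C n) (?C 0) (?C (Suc n))" unfolding separates_in_def
    proof (intro conjI ballI)
      show "?C 0 \<subseteq> ?G - ?C n" by (rule dif[OF sub cut_disj]) (use un in simp)
      show "?C (Suc n) \<subseteq> ?G - ?C n" by (rule dif[OF sub cut_disj]) (use uq(2)[of n] in simp)
      fix a b assume ab: "a \<in> ?C 0" "b \<in> ?C (Suc n)"
      show "\<not> connected_component (?G - ?C n) a b"
      proof
        assume "connected_component (?G - ?C n) a b"
        then have "a \<in> connected_component_set (?G - ?C n) b" by (simp add: connected_component_sym)
        then have "a \<in> F ` strip_end (u n)" using ab(2) comp by auto
        then obtain z where z: "z \<in> strip_end (u n)" "a = F z" by blast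
        obtain z' where z': "z' \<in> strip_cut (u 0)" "a = F z'" using ab(1) by blast
        have "z = z'" using inj_onD[OF F(2), of z z'] z z' by (simp add: strip_end_def strip_cut_def)
        then show False using un z(1) z'(1) by (simp add: strip_end_def strip_cut_def)
      qed
    qed
  next
    fix \<epsilon> :: real assume "\<epsilon> > 0"
    then obtain N where N: "1 / (real N + 1) < \<epsilon>"
      by (metis nat_approx_posE of_nat_Suc add.commute)
    have "chordal_dist z w < \<epsilon>" if "n \<ge> N" "z \<in> ?C n" "w \<in> ?C n" for n z w
    proof -
      have "chordal_dist z w \<le> 1 / (real n + 1)" using that(2,3) uq(6)[of _ _ n] unfolding strip_cut_eq by auto
      also have "\<dots> \<le> 1 / (real N + 1)" using that(1) by (simp add: frac_le)
      finally show ?thesis using N by simp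
    qed
    then show "\<forall>\<^sub>F n in sequentially. \<forall>z\<in>?C n. \<forall>w\<in>?C n. chordal_dist z w < \<epsilon>"
      unfolding eventually_sequentially by blast
  qed
  moreover have "chain_domain ?G ?C n = F ` strip_end (u n)" for n
  proof -
    have "chain_domain ?G ?C n = (\<Union>w\<in>strip_cut (u (Suc n)). connected_component_set (?G - ?C n) (F w))"
      by (simp add: chain_domain_def)
    also have "\<dots> = (\<Union>w\<in>strip_cut (u (Suc n)). F ` strip_end (u n))"
      by (rule SUP_cong[OF refl comp])
    finally show ?thesis using ne[of "u (Suc n)"] by simp
  qed
  ultimately show ?thesis by (intro that[of u] uq(1) sm)
qed

section \<open>Prime ends and conformal maps\<close>

lemma cofinal_seqs_refl: "cofinal_seqs U U" by (auto simp: cofinal_seqs_def)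
lemma cofinal_seqs_sym: "cofinal_seqs U V \<Longrightarrow> cofinal_seqs V U" by (auto simp: cofinal_seqs_def)
lemma cofinal_seqs_trans: "cofinal_seqs U V \<Longrightarrow> cofinal_seqs V W \<Longrightarrow> cofinal_seqs U W"
  unfolding cofinal_seqs_def by (meson order_trans)
lemma cofinal_seqs_image: "cofinal_seqs U V \<Longrightarrow> cofinal_seqs (\<lambda>n. F ` U n) (\<lambda>n. F ` V n)"
  unfolding cofinal_seqs_def by (meson image_mono)

lemma in_null_chain_class_iff:
  "C' \<in> null_chain_equiv D `` {C} \<longleftrightarrow>
     null_chain D C \<and> null_chain D C' \<and> cofinal_seqs (chain_domain D C) (chain_domain D C')"
  by (auto simp: null_chain_equiv_def)

lemma null_chain_class_in_prime_ends: "null_chain D C \<Longrightarrow> null_chain_equiv D `` {C} \<in> prime_ends D"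
  unfolding prime_ends_def by (rule quotientI) simp

lemma null_chain_class_eq:
  assumes "null_chain D C" "null_chain D C'" "cofinal_seqs (chain_domain D C) (chain_domain D C')"
  shows "null_chain_equiv D `` {C} = null_chain_equiv D `` {C'}"
proof (intro set_eqI)
  fix X
  show "X \<in> null_chain_equiv D `` {C} \<longleftrightarrow> X \<in> null_chain_equiv D `` {C'}"
    unfolding in_null_chain_class_iff
    using assms by (meson cofinal_seqs_sym cofinal_seqs_trans)
qed

text \<open>The induced map of prime ends is a definite description; it is determined once the chains of the source class are
mutually cofinal, because cofinality passes to images and is transitive.\<close>
lemma pe_map_eqI:
  assumes C: "C \<in> P" and C': "null_chain (F ` D) C'"
    and cof: "cofinal_seqs (\<lambda>n. F ` chain_domain D C n) (chain_domain (F ` D) C')"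
    and P: "\<And>X. X \<in> P \<Longrightarrow> cofinal_seqs (chain_domain D C) (chain_domain D X)"
  shows "pe_map F D P = null_chain_equiv (F ` D) `` {C'}"
  unfolding pe_map_def
proof (rule the_equality)
  show "null_chain_equiv (F ` D) `` {C'} \<in> prime_ends (F ` D) \<and>
    (\<exists>C\<in>P. \<exists>C'\<in>null_chain_equiv (F ` D) `` {C'}. cofinal_seqs (\<lambda>n. F ` chain_domain D C n) (chain_domain (F ` D) C'))"
  proof (intro conjI bexI)
    show "null_chain_equiv (F ` D) `` {C'} \<in> prime_ends (F ` D)"
      using null_chain_class_in_prime_ends[OF C'] .
    show "C' \<in> null_chain_equiv (F ` D) `` {C'}"
      unfolding in_null_chain_class_iff using C' by (simp add: cofinal_seqs_refl)
  qed (fact cof C)+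
next
  fix Q assume Q: "Q \<in> prime_ends (F ` D) \<and> (\<exists>C\<in>P. \<exists>C'\<in>Q. cofinal_seqs (\<lambda>n. F ` chain_domain D C n) (chain_domain (F ` D) C'))"
  then obtain X Y where XY: "X \<in> P" "Y \<in> Q" "cofinal_seqs (\<lambda>n. F ` chain_domain D X n) (chain_domain (F ` D) Y)" by auto
  obtain Z where Z: "null_chain (F ` D) Z" "Q = null_chain_equiv (F ` D) `` {Z}"
    using Q unfolding prime_ends_def by (auto elim!: quotientE)
  have Y: "null_chain (F ` D) Y" "cofinal_seqs (chain_domain (F ` D) Z) (chain_domain (F ` D) Y)"
    using XY(2) unfolding Z(2) in_null_chain_class_iff by auto
  have "cofinal_seqs (chain_domain (F ` D) C') (chain_domain (F ` D) Z)"
    using cof cofinal_seqs_image[OF P[OF XY(1)], of F] XY(3) Y(2) by (meson cofinal_seqs_sym cofinal_seqs_trans)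
  then show "Q = null_chain_equiv (F ` D) `` {C'}" unfolding Z(2)
    using null_chain_class_eq[OF C' Z(1)] by simp
qed

lemma connectedin_sphere_Some: "connectedin riemann_sphere (Some ` S) \<longleftrightarrow> connected S"
proof -
  have "homeomorphic_map euclidean (subtopology riemann_sphere (range Some)) (Some :: complex \<Rightarrow> _)"
    using embedding_map_Some[of "euclidean::complex topology"] by (simp add: embedding_map_def)
  from homeomorphic_map_connectedness[OF this, of S] show ?thesis
    by (auto simp: connectedin_subtopology connectedin_iff_connected)
qed

lemma Hausdorff_riemann_sphere: "Hausdorff_space riemann_sphere"
  by (simp add: Hausdorff_space_Alexandroff_compactification locally_compact_space_euclidean)

text \<open>The closed arc is compact in the sphere and its end points lie outside \<open>D\<close>, so removing the open arc from \<open>D\<close> amounts to removing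
a closed set.\<close>
lemma crosscut_properties:
  assumes "crosscut D C" "open D"
  shows "connected C" "C \<noteq> {}" "C \<subseteq> D" "open (D - C)"
proof -
  obtain \<gamma> where g: "continuous_map (top_of_set {0..1::real}) riemann_sphere \<gamma>"
    "\<gamma> ` {0<..<1} = Some ` C" "C \<subseteq> D" "\<gamma> 0 \<in> boundary_inf D" "\<gamma> 1 \<in> boundary_inf D"
    using assms(1) unfolding crosscut_def by blast
  show "C \<subseteq> D" by fact
  have "connectedin (top_of_set {0..1::real}) {0<..<1}"
    by (simp add: connectedin_subtopology connectedin_iff_connected) (auto simp: greaterThanLessThan_subseteq_atLeastAtMost_iff)
  from connectedin_continuous_map_image[OF g(1) this] show "connected C"
    by (simp add: g(2) connectedin_sphere_Some)
  show "C \<noteq> {}" using g(2) by force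
  have "compactin (top_of_set {0..1::real}) {0..1}" by (simp add: compactin_subtopology)
  from image_compactin[OF this g(1)] have "compactin riemann_sphere (\<gamma> ` {0..1})" .
  moreover have "Hausdorff_space riemann_sphere" by (rule Hausdorff_riemann_sphere)
  ultimately have "closedin riemann_sphere (\<gamma> ` {0..1})" by (rule compactin_imp_closedin[rotated])
  then have "closedin euclidean {z. Some z \<in> \<gamma> ` {0..1}}"
    using closedin_continuous_map_preimage[OF continuous_map_Some[of "euclidean::complex topology"]] by fastforce
  then have cl: "closed {z. Some z \<in> \<gamma> ` {0..1}}" by simp
  have bd: "x \<notin> Some ` D" if "x \<in> boundary_inf D" for x
  proof -
    have "openin riemann_sphere (Some ` D)" using assms(2) by simp
    then show ?thesis using that by (simp add: boundary_inf_def frontier_of_def interior_of_openin)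
  qed
  have "\<gamma> ` {0..1} = insert (\<gamma> 0) (insert (\<gamma> 1) (\<gamma> ` {0<..<1}))"
  proof -
    have "{0..1::real} = insert 0 (insert 1 {0<..<1})" by auto
    then show ?thesis by (metis image_insert)
  qed
  then have "D - C = D - {z. Some z \<in> \<gamma> ` {0..1}}"
    using g(2) bd[OF g(4)] bd[OF g(5)] by auto (metis imageI)+
  then show "open (D - C)" using assms(2) cl by auto
qed

text \<open>A component of \<open>D - C\<close> whose closure missed \<open>C\<close> would be open and closed in the connected set \<open>D\<close>.\<close>
lemma connected_component_Un_cut:
  fixes D C :: "complex set"
  assumes D: "open D" "connected D" and C: "connected C" "C \<noteq> {}" "C \<subseteq> D" "open (D - C)"
    and a: "a \<in> D - C"
  shows "connected (connected_component_set (D - C) a \<union> C)"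
proof -
  define W where "W = connected_component_set (D - C) a"
  have W: "connected W" "W \<subseteq> D - C" "a \<in> W" "open W"
    unfolding W_def
    by (rule connected_connected_component connected_component_subset open_connected_component[OF C(4)] | use a in simp)+
  have "closure W \<inter> C \<noteq> {}"
  proof
    assume e: "closure W \<inter> C = {}"
    have "connected (closure W \<inter> D)"
      by (rule connected_intermediate_closure[OF W(1)]) (use W(2) closure_subset in auto)
    moreover have "a \<in> closure W \<inter> D" using W(3) a closure_subset[of W] by blast
    moreover have "closure W \<inter> D \<subseteq> D - C" using e by blast
    ultimately have "closure W \<inter> D \<subseteq> W"
      unfolding W_def by (intro connected_component_maximal)
    then have "W = closure W \<inter> D" using W(2) closure_subset by auto
    then have "closedin (top_of_set D) W" by (metis closed_closure closedin_closed_Int inf_commute)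
    moreover have "openin (top_of_set D) W" using W(2,4) by (auto intro: open_openin_trans D(1))
    ultimately have "W = {} \<or> W = D" using D(2) by (metis connected_clopen)
    then show False using W C(2,3) by auto
  qed
  then obtain c where c: "c \<in> closure W" "c \<in> C" by auto
  have "connected (insert c W)"
    by (rule connected_intermediate_closure[OF W(1)]) (use c closure_subset in auto)
  then have "connected (insert c W \<union> C)" using C(1) c(2) by (intro connected_Un) auto
  moreover have "insert c W \<union> C = W \<union> C" using c by auto
  ultimately show ?thesis by (simp add: W_def)
qed

text \<open>The definition of a null-chain only separates \<open>C n\<close> from \<open>C 0\<close>. Monotonicity of the domains follows since, if \<open>C n\<close>
were on the far side of \<open>C (n + 1)\<close>, then the near side together with \<open>C (n + 1)\<close> would be a connected set that joins \<open>C 0\<close> to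
\<open>C (n + 1)\<close> without meeting \<open>C n\<close>.\<close>
lemma chain_domain_properties:
  assumes D: "open D" "connected D" and C: "null_chain D C"
  shows "w \<in> C (Suc n) \<Longrightarrow> chain_domain D C n = connected_component_set (D - C n) w"
    and "chain_domain D C (Suc n) \<subseteq> chain_domain D C n"
    and "C n \<inter> C (Suc n) = {}"
    and "\<And>n. connected (C n) \<and> C n \<noteq> {} \<and> C n \<subseteq> D \<and> open (D - C n)"
proof -
  have cc: "crosscut D (C n)" for n using C by (auto simp: null_chain_def)
  have Cp: "connected (C n)" "C n \<noteq> {}" "C n \<subseteq> D" "open (D - C n)" for n
    using crosscut_properties[OF cc D(1)] by auto
  show "\<And>n. connected (C n) \<and> C n \<noteq> {} \<and> C n \<subseteq> D \<and> open (D - C n)" using Cp by blast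
  have disj: "C n \<inter> C (Suc n) = {}" for n
  proof -
    have "Some ` C n \<inter> Some ` C (Suc n) = {}"
    proof -
      have "Some ` C k \<subseteq> riemann_sphere closure_of (Some ` C k)" for k by (rule closure_of_subset) auto
      moreover have "riemann_sphere closure_of (Some ` C n) \<inter> riemann_sphere closure_of (Some ` C (Suc n)) = {}"
        using C unfolding null_chain_def by blast
      ultimately show ?thesis by (meson disjoint_iff subsetD)
    qed
    then show ?thesis by (metis (mono_tags) disjoint_iff imageI)
  qed
  then show "C n \<inter> C (Suc n) = {}" .
  have sep: "\<not> connected_component (D - C n) a b" if "n \<ge> 1" "a \<in> C 0" "b \<in> C (Suc n)" for n a b
    using C that unfolding null_chain_def separates_in_def by blast
  have sep0: "C 0 \<subseteq> D - C n" if "n \<ge> 1" for n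
    using C that unfolding null_chain_def separates_in_def by blast
  have one: "chain_domain D C n = connected_component_set (D - C n) w" if w: "w \<in> C (Suc n)" for w n
  proof -
    have "C (Suc n) \<subseteq> connected_component_set (D - C n) w"
      by (rule connected_component_maximal[OF w Cp(1)]) (use Cp(3)[of "Suc n"] disj[of n] in blast)
    then have "connected_component_set (D - C n) v = connected_component_set (D - C n) w" if "v \<in> C (Suc n)" for v
      using that connected_component_eq by blast
    then show ?thesis using w unfolding chain_domain_def by blast
  qed
  then show "w \<in> C (Suc n) \<Longrightarrow> chain_domain D C n = connected_component_set (D - C n) w" .
  obtain b where b: "b \<in> C (Suc (Suc n))" using Cp(2) by blast
  obtain w where w: "w \<in> C (Suc n)" using Cp(2) by blast
  obtain a where a: "a \<in> C 0" using Cp(2) by blast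
  have bD: "b \<in> D - C (Suc n)" using b Cp(3) disj by blast
  let ?U = "connected_component_set (D - C (Suc n)) b"
  \<comment> \<open>\<open>?U\<close> is the domain with index \<open>n + 1\<close>\<close>
  have avoid: "C n \<inter> ?U = {}"
  proof (cases "n = 0")
    case True
    then show ?thesis using sep[of "Suc 0" _ b] b by (auto simp: connected_component_sym_eq)
  next
    case False
    show ?thesis
    proof (rule ccontr)
      assume "C n \<inter> ?U \<noteq> {}"
      then obtain x where x: "x \<in> C n" "x \<in> ?U" by blast
      have "C n \<subseteq> connected_component_set (D - C (Suc n)) x"
        by (rule connected_component_maximal[OF x(1) Cp(1)]) (use Cp(3)[of n] disj[of n] in blast)
      then have CU: "C n \<subseteq> ?U" using x(2) connected_component_eq by blast
      let ?W = "connected_component_set (D - C (Suc n)) a"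
      have aD: "a \<in> D - C (Suc n)" using sep0[of "Suc n"] a by auto
      have "C n \<inter> ?W = {}"
      proof (rule ccontr)
        assume "C n \<inter> ?W \<noteq> {}"
        then obtain y where "y \<in> ?U" "y \<in> ?W" using CU by blast
        then have "connected_component (D - C (Suc n)) a b"
          by (metis connected_component_sym connected_component_trans mem_Collect_eq)
        then show False using sep[of "Suc n" a b] a b by simp
      qed
      then have "?W \<union> C (Suc n) \<subseteq> D - C n"
        using connected_component_subset[of "D - C (Suc n)" a] Cp(3)[of "Suc n"] disj[of n] by blast
      moreover have "connected (?W \<union> C (Suc n))"
        by (rule connected_component_Un_cut[OF D Cp aD])
      moreover have "a \<in> ?W" using aD by simp
      ultimately have "connected_component (D - C n) a w" 
        using w unfolding connected_component_def by blast
      then show False using sep[of n a w] False a w by simp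
    qed
  qed
  have "connected (?U \<union> C (Suc n))" by (rule connected_component_Un_cut[OF D Cp bD])
  moreover have "?U \<union> C (Suc n) \<subseteq> D - C n"
    using avoid connected_component_subset[of "D - C (Suc n)" b] Cp(3)[of "Suc n"] disj[of n] by blast
  ultimately have "?U \<union> C (Suc n) \<subseteq> connected_component_set (D - C n) w"
    using w by (intro connected_component_maximal) auto
  then show "chain_domain D C (Suc n) \<subseteq> chain_domain D C n"
    using one[OF b] one[OF w] by blast
qed

definition disc_nbhd :: "complex \<Rightarrow> nat \<Rightarrow> complex set" where
  "disc_nbhd \<zeta> n = ball 0 1 \<inter> ball \<zeta> (1 / (real n + 1))"

lemma disc_nbhd_subset:
  assumes "r > 0"
  obtains n where "disc_nbhd \<zeta> n \<subseteq> ball 0 1 \<inter> ball \<zeta> r"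
proof -
  obtain n where "1 / (real n + 1) < r" using assms by (metis nat_approx_posE of_nat_Suc add.commute)
  then have "disc_nbhd \<zeta> n \<subseteq> ball 0 1 \<inter> ball \<zeta> r" unfolding disc_nbhd_def
    by (intro Int_mono subset_refl subset_ball) simp
  then show ?thesis by (rule that)
qed

text \<open>Compactness makes the domains shrink to \<open>\<zeta>\<close>. Conversely \<open>\<zeta>\<close> lies in the closure of at most one of two consecutive
crosscuts, since these closures are disjoint; a crosscut at positive distance from \<open>\<zeta>\<close> leaves a convex neighbourhood of \<open>\<zeta>\<close> on
one side.\<close>
lemma chain_domain_disc_cofinal:
  assumes C: "C \<in> disc_prime_end \<zeta>"
  shows "cofinal_seqs (chain_domain (ball 0 1) C) (disc_nbhd \<zeta>)"
proof -
  let ?D = "ball 0 1 :: complex set" and ?U = "chain_domain (ball 0 1) C"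
  have nc: "null_chain ?D C" and imp: "(\<Inter>n. closure (?U n)) = {\<zeta>}"
    using C by (auto simp: disc_prime_end_def)
  note cp = chain_domain_properties[OF open_ball connected_ball nc]
  have dec: "?U n \<subseteq> ?U m" if "m \<le> n" for m n
    using that cp(2) by (rule lift_Suc_antimono_le[rotated])
  have Usub: "?U n \<subseteq> ?D" for n
  proof -
    obtain w where "w \<in> C (Suc n)" using cp(4)[of "Suc n"] by blast
    then show ?thesis using cp(1) connected_component_subset by blast
  qed
  show ?thesis unfolding cofinal_seqs_def
  proof (intro conjI allI)
    fix m
    let ?r = "1 / (real m + 1)"
    define K where "K n = closure (?U n) - ball \<zeta> ?r" for n
    have "\<exists>n. K n = {}"
    proof (rule ccontr)
      assume "\<nexists>n. K n = {}"
      moreover have "compact (K n)" for n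
      proof -
        have "bounded (?U n)" using Usub bounded_subset[OF bounded_ball] by blast
        then show ?thesis unfolding K_def by (intro compact_diff) auto
      qed
      moreover have "K n \<subseteq> K m" if "m \<le> n" for m n
        unfolding K_def using closure_mono[OF dec[OF that]] by blast
      ultimately have "\<Inter>(range K) \<noteq> {}" by (intro compact_nest) auto
      then obtain x where x: "\<And>n. x \<in> K n" by blast
      then have "x \<in> (\<Inter>n. closure (?U n))" by (auto simp: K_def)
      then have "x = \<zeta>" using imp by blast
      then show False using x[of 0] by (simp add: K_def)
    qed
    then obtain n where "K n = {}" by blast
    then have "?U n \<subseteq> disc_nbhd \<zeta> m"
      using Usub[of n] closure_subset[of "?U n"] unfolding K_def disc_nbhd_def by blast
    then show "\<exists>n. ?U n \<subseteq> disc_nbhd \<zeta> m" by blast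
  next
    fix m
    have zcl: "\<zeta> \<in> closure (?U n)" for n using imp by blast
    have "\<exists>k\<ge>m. \<zeta> \<notin> closure (C k)"
    proof -
      have "Some ` closure (C k) \<subseteq> riemann_sphere closure_of (Some ` C k)" for k
        using continuous_map_image_closure_subset[OF continuous_map_Some[of "euclidean::complex topology"], of "C k"] by simp
      moreover have "riemann_sphere closure_of (Some ` C m) \<inter> riemann_sphere closure_of (Some ` C (Suc m)) = {}"
        using nc by (simp add: null_chain_def)
      ultimately have "\<zeta> \<notin> closure (C m) \<or> \<zeta> \<notin> closure (C (Suc m))" by blast
      then show ?thesis using le_SucI by blast
    qed
    then obtain k where k: "k \<ge> m" "\<zeta> \<notin> closure (C k)" by blast
    then obtain r where r: "r > 0" "ball \<zeta> r \<inter> C k = {}"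
      by (metis closure_approachable disjoint_iff dist_commute mem_ball)
    have "ball \<zeta> r \<inter> ?U k \<noteq> {}"
      using zcl[of k] r(1) by (metis closure_approachable disjoint_iff dist_commute mem_ball)
    then obtain x where x: "x \<in> ball \<zeta> r" "x \<in> ?U k" by blast
    obtain w where w: "w \<in> C (Suc k)" using cp(4)[of "Suc k"] by blast
    have "?D \<inter> ball \<zeta> r \<subseteq> connected_component_set (?D - C k) x"
    proof (rule connected_component_maximal)
      show "x \<in> ?D \<inter> ball \<zeta> r" using x Usub by blast
      show "connected (?D \<inter> ball \<zeta> r)" by (intro convex_connected convex_Int convex_ball)
      show "?D \<inter> ball \<zeta> r \<subseteq> ?D - C k" using r(2) by blast
    qed
    also have "\<dots> = ?U k" using x(2) unfolding cp(1)[OF w] by (metis connected_component_eq)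
    also have "\<dots> \<subseteq> ?U m" by (rule dec[OF k(1)])
    finally have "?D \<inter> ball \<zeta> r \<subseteq> ?U m" .
    moreover obtain n where "disc_nbhd \<zeta> n \<subseteq> ?D \<inter> ball \<zeta> r" using disc_nbhd_subset[OF r(1)] .
    ultimately show "\<exists>n. disc_nbhd \<zeta> n \<subseteq> ?U m" by blast
  qed
qed

text \<open>A Cayley transform of the upper half-plane after the exponential map; the right end of the strip goes to \<open>\<zeta>\<close>.\<close>
definition strip_to_disc :: "complex \<Rightarrow> complex \<Rightarrow> complex" where
  "strip_to_disc \<zeta> w = \<zeta> * (exp w - \<i>) / (exp w + \<i>)"

lemma exp_strip: "w \<in> strip \<Longrightarrow> Im (exp w) > 0" 
  by (auto simp: strip_def Im_exp intro!: mult_pos_pos sin_gt_zero)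

lemma cmod_plus_i:
  assumes "0 < Im p"
  shows "cmod (p - \<i>) < cmod (p + \<i>)" "cmod p \<le> cmod (p + \<i>)"
proof -
  have "(cmod (p - \<i>))\<^sup>2 < (cmod (p + \<i>))\<^sup>2" "(cmod p)\<^sup>2 \<le> (cmod (p + \<i>))\<^sup>2"
    unfolding cmod_power2 using assms by (simp_all add: power2_eq_square algebra_simps)
  then show "cmod (p - \<i>) < cmod (p + \<i>)" "cmod p \<le> cmod (p + \<i>)"
    by (auto intro: power_less_imp_less_base power2_le_imp_le)
qed

lemma strip_to_disc:
  assumes z: "cmod \<zeta> = 1"
  shows "strip_to_disc \<zeta> holomorphic_on strip" "inj_on (strip_to_disc \<zeta>) strip" "strip_to_disc \<zeta> ` strip = ball 0 1"
    "w \<in> strip \<Longrightarrow> cmod (strip_to_disc \<zeta> w - \<zeta>) = 2 / cmod (exp w + \<i>)"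
proof -
  have nz: "exp w + \<i> \<noteq> 0" if "w \<in> strip" for w
  proof
    assume "exp w + \<i> = 0"
    then have "Im (exp w + \<i>) = 0" by (simp only: zero_complex.sel)
    then show False using exp_strip[OF that] by (simp del: Im_exp)
  qed
  have z0: "\<zeta> \<noteq> 0" using z by auto
  show "strip_to_disc \<zeta> holomorphic_on strip" unfolding strip_to_disc_def
    using nz by (intro holomorphic_intros) auto
  have expinj: "v = w" if "v \<in> strip" "w \<in> strip" "exp v = exp w" for v w
  proof -
    have "v = Ln (exp v)" "w = Ln (exp w)" using that(1,2) by (auto simp: strip_def)
    then show ?thesis using that(3) by simp
  qed
  show "inj_on (strip_to_disc \<zeta>) strip"
  proof (rule inj_onI)
    fix v w assume vw: "v \<in> strip" "w \<in> strip" "strip_to_disc \<zeta> v = strip_to_disc \<zeta> w"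
    then have "(exp v - \<i>) * (exp w + \<i>) = (exp w - \<i>) * (exp v + \<i>)"
      using nz z0 by (simp add: strip_to_disc_def divide_eq_eq eq_divide_eq)
    then have "2 * \<i> * exp v = 2 * \<i> * exp w" by (simp add: algebra_simps)
    then show "v = w" using expinj vw by simp
  qed
  show "cmod (strip_to_disc \<zeta> w - \<zeta>) = 2 / cmod (exp w + \<i>)" if "w \<in> strip" for w
  proof -
    have "strip_to_disc \<zeta> w - \<zeta> = \<zeta> * (- 2 * \<i>) / (exp w + \<i>)"
      using nz[OF that] by (simp add: strip_to_disc_def field_simps)
    then show ?thesis using z by (simp add: norm_divide norm_mult)
  qed
  show "strip_to_disc \<zeta> ` strip = ball 0 1"
  proof (intro antisym subsetI)
    fix y assume "y \<in> strip_to_disc \<zeta> ` strip"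
    then obtain w where w: "w \<in> strip" "y = strip_to_disc \<zeta> w" by blast
    have "cmod (exp w - \<i>) < cmod (exp w + \<i>)" by (rule cmod_plus_i(1)[OF exp_strip[OF w(1)]])
    then show "y \<in> ball 0 1" using w z nz by (simp add: strip_to_disc_def norm_mult norm_divide)
  next
    fix y :: complex assume "y \<in> ball 0 1"
    then have y: "cmod (y / \<zeta>) < 1" using z by (simp add: norm_divide)
    define e where "e = y / \<zeta>"
    define v where "v = \<i> * (1 + e) / (1 - e)"
    have e1: "cmod e < 1" "1 - e \<noteq> 0" using y by (auto simp: e_def)
    have "v = \<i> * (1 + e) * cnj (1 - e) / of_real ((cmod (1 - e))\<^sup>2)"
      unfolding v_def by (subst complex_div_cnj) simp
    moreover have "Im (\<i> * (1 + e) * cnj (1 - e)) = 1 - (cmod e)\<^sup>2"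
      unfolding cmod_power2 by (simp add: power2_eq_square algebra_simps)
    ultimately have "Im v = (1 - (cmod e)\<^sup>2) / (cmod (1 - e))\<^sup>2"
      by (simp only: Im_divide_of_real)
    moreover have "(cmod e)\<^sup>2 < 1" using e1(1) by (simp add: power_less_one_iff)
    ultimately have v: "Im v > 0" using e1 by simp
    then have v0: "v \<noteq> 0" by auto
    have "Ln v \<in> strip" using v v0 Im_Ln_pos_lt[OF v0] by (auto simp: strip_def)
    moreover have "strip_to_disc \<zeta> (Ln v) = y"
    proof -
      have k: "v * (1 - e) = \<i> * (1 + e)" using e1(2) by (simp add: v_def)
      have "(v - \<i>) * (1 - e) = \<i> * 2 * e" "(v + \<i>) * (1 - e) = \<i> * 2"
        unfolding left_diff_distrib[of v] distrib_right[of v] k by (simp_all add: algebra_simps)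
      then have "e * (v + \<i>) * (1 - e) = (v - \<i>) * (1 - e)" unfolding mult.assoc by simp
      then have "e * (v + \<i>) = v - \<i>" using e1(2) by (simp only: mult_cancel_right) simp
      moreover have "v + \<i> \<noteq> 0"
      proof -
        have "Im (v + \<i>) \<noteq> 0" using v by simp
        then show ?thesis by (metis zero_complex.sel(2))
      qed
      ultimately have "(v - \<i>) / (v + \<i>) = e" by (simp add: divide_eq_eq)
      then have "\<zeta> * ((v - \<i>) / (v + \<i>)) = y" using z0 by (simp add: e_def)
      then show ?thesis using v0 by (simp add: strip_to_disc_def)
    qed
    ultimately show "y \<in> strip_to_disc \<zeta> ` strip" by blast
  qed
qed

text \<open>The distance of the image of \<open>w\<close> from \<open>\<zeta>\<close> is \<open>2 / \<bar>exp w + \<i>\<bar>\<close>, which is comparable to \<open>exp (- Re w)\<close>.\<close>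
lemma strip_end_cofinal:
  assumes z: "cmod \<zeta> = 1" and u: "\<And>n. real n < u n"
  shows "cofinal_seqs (\<lambda>n. strip_to_disc \<zeta> ` strip_end (u n)) (disc_nbhd \<zeta>)"
  unfolding cofinal_seqs_def
proof (intro conjI allI)
  note m = strip_to_disc[OF z]
  fix k
  define c where "c = ln (2 * (real k + 1))"
  obtain n where n: "c < real n" using reals_Archimedean2 by blast
  show "\<exists>n. strip_to_disc \<zeta> ` strip_end (u n) \<subseteq> disc_nbhd \<zeta> k"
  proof (intro exI[of _ n] image_subsetI)
    fix w assume "w \<in> strip_end (u n)"
    then have w: "w \<in> strip" "c < Re w" using n u[of n] by (auto simp: strip_end_def)
    have "exp c < exp (Re w)" using w by simp
    then have "2 * (real k + 1) < cmod (exp w)" by (simp add: c_def)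
    also have "\<dots> \<le> cmod (exp w + \<i>)" by (rule cmod_plus_i(2)[OF exp_strip[OF w(1)]])
    finally have "2 / cmod (exp w + \<i>) < 1 / (real k + 1)" by (simp add: divide_simps mult.commute split: if_splits)
    then have "dist \<zeta> (strip_to_disc \<zeta> w) < 1 / (real k + 1)"
      using m(4)[OF w(1)] by (simp add: dist_norm norm_minus_commute)
    moreover have "strip_to_disc \<zeta> w \<in> ball 0 1" using m(3) w(1) by blast
    ultimately show "strip_to_disc \<zeta> w \<in> disc_nbhd \<zeta> k" by (simp add: disc_nbhd_def)
  qed
next
  note m = strip_to_disc[OF z]
  fix k
  define r where "r = 2 / (exp (u k) + 1)"
  have r: "r > 0" by (simp add: r_def add_pos_pos)
  obtain n where n: "disc_nbhd \<zeta> n \<subseteq> ball 0 1 \<inter> ball \<zeta> r" using disc_nbhd_subset[OF r] .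
  have "ball 0 1 \<inter> ball \<zeta> r \<subseteq> strip_to_disc \<zeta> ` strip_end (u k)"
  proof
    fix y assume y: "y \<in> ball 0 1 \<inter> ball \<zeta> r"
    then obtain w where w: "w \<in> strip" "y = strip_to_disc \<zeta> w" using m(3) by blast
    have "2 / cmod (exp w + \<i>) < r" using y m(4)[OF w(1)] w(2) by (simp add: dist_norm norm_minus_commute)
    then have "2 / cmod (exp w + \<i>) < 2 / (exp (u k) + 1)" by (simp add: r_def)
    moreover have "cmod (exp w + \<i>) > 0"
    proof -
      have "Im (exp w + \<i>) \<noteq> 0" using exp_strip[OF w(1)] by (simp del: Im_exp)
      then show ?thesis by (metis zero_complex.sel(2) zero_less_norm_iff)
    qed
    ultimately have "exp (u k) + 1 < cmod (exp w + \<i>)"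
      by (simp add: divide_less_eq less_divide_eq add_pos_pos split: if_splits)
    also have "\<dots> \<le> exp (Re w) + 1" using norm_triangle_ineq[of "exp w" \<i>] by simp
    finally have "u k < Re w" by simp
    then show "y \<in> strip_to_disc \<zeta> ` strip_end (u k)" using w by (auto simp: strip_end_def)
  qed
  then show "\<exists>n. disc_nbhd \<zeta> n \<subseteq> strip_to_disc \<zeta> ` strip_end (u k)" using n by blast
qed

text \<open>Existence of the image prime end, by transport of the chain of slices from the strip.\<close>
lemma exists_null_chain_at:
  assumes F: "F holomorphic_on ball 0 1" "inj_on F (ball 0 1)" and z: "cmod \<zeta> = 1"
  obtains C where "null_chain (F ` ball 0 1) C"
    "cofinal_seqs (\<lambda>n. F ` disc_nbhd \<zeta> n) (chain_domain (F ` ball 0 1) C)"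
proof -
  note m = strip_to_disc[OF z]
  define H where "H = F \<circ> strip_to_disc \<zeta>"
  have H: "H holomorphic_on strip" "inj_on H strip"
    unfolding H_def using F m by (auto intro!: holomorphic_on_compose comp_inj_on)
  have im: "H ` strip = F ` ball 0 1" unfolding H_def image_comp[symmetric] m(3) ..
  obtain u where u: "\<And>n. real n < u n"
    "null_chain (H ` strip) (\<lambda>n. H ` strip_cut (u n))"
    "\<And>n. chain_domain (H ` strip) (\<lambda>n. H ` strip_cut (u n)) n = H ` strip_end (u n)"
    using null_chain_slices[OF H] by metis
  have "cofinal_seqs (\<lambda>n. F ` strip_to_disc \<zeta> ` strip_end (u n)) (\<lambda>n. F ` disc_nbhd \<zeta> n)"
    by (rule cofinal_seqs_image[OF strip_end_cofinal[OF z u(1)]])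
  moreover have "(\<lambda>n. F ` strip_to_disc \<zeta> ` strip_end (u n)) = chain_domain (H ` strip) (\<lambda>n. H ` strip_cut (u n))"
  proof
    fix n
    have "F ` strip_to_disc \<zeta> ` strip_end (u n) = H ` strip_end (u n)" by (simp only: H_def image_comp)
    then show "F ` strip_to_disc \<zeta> ` strip_end (u n) = chain_domain (H ` strip) (\<lambda>n. H ` strip_cut (u n)) n"
      by (simp only: u(3))
  qed
  ultimately show ?thesis using that[of "\<lambda>n. H ` strip_cut (u n)"] u(2) unfolding im
    by (simp add: cofinal_seqs_sym)
qed

text \<open>Applied to the identity map, the slice construction yields a null-chain of the disc whose impression is \<open>\<zeta>\<close>.\<close>
lemma disc_prime_end_nonempty:
  assumes z: "cmod \<zeta> = 1"
  shows "disc_prime_end \<zeta> \<noteq> {}"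
proof -
  obtain C where C: "null_chain (ball 0 1) C"
    "cofinal_seqs (disc_nbhd \<zeta>) (chain_domain (ball 0 1) C)"
    using exists_null_chain_at[of "\<lambda>x. x", OF _ _ z] by (auto simp: holomorphic_on_ident)
  have "x = \<zeta>" if x: "\<And>n. x \<in> closure (chain_domain (ball 0 1) C n)" for x
  proof (rule ccontr)
    assume "x \<noteq> \<zeta>"
    then obtain m where m: "disc_nbhd \<zeta> m \<subseteq> ball 0 1 \<inter> ball \<zeta> (dist \<zeta> x / 2)" using disc_nbhd_subset[of "dist \<zeta> x / 2"] by auto
    obtain n where "chain_domain (ball 0 1) C n \<subseteq> disc_nbhd \<zeta> m" using C(2) unfolding cofinal_seqs_def by blast
    then have "closure (chain_domain (ball 0 1) C n) \<subseteq> cball \<zeta> (dist \<zeta> x / 2)"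
      using m by (intro closure_minimal) auto
    then have "dist \<zeta> x \<le> dist \<zeta> x / 2" using x[of n] by auto
    then show False using \<open>x \<noteq> \<zeta>\<close> by simp
  qed
  moreover have "\<zeta> \<in> closure (chain_domain (ball 0 1) C n)" for n
  proof -
    obtain m where m: "disc_nbhd \<zeta> m \<subseteq> chain_domain (ball 0 1) C n" using C(2) unfolding cofinal_seqs_def by blast
    have "\<zeta> \<in> closure (ball 0 1)" using z by (simp add: dist_norm)
    then have "\<zeta> \<in> ball \<zeta> (1 / (real m + 1)) \<inter> closure (ball 0 1)" by (simp add: add_nonneg_pos)
    then have "\<zeta> \<in> closure (disc_nbhd \<zeta> m)" unfolding disc_nbhd_def
      using open_Int_closure_subset[OF open_ball, of \<zeta> "1 / (real m + 1)" "ball 0 1"] by (auto simp: Int_commute)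
    then show ?thesis using closure_mono[OF m] by blast
  qed
  ultimately have "(\<Inter>n. closure (chain_domain (ball 0 1) C n)) = {\<zeta>}" by blast
  then show ?thesis using C(1) by (auto simp: disc_prime_end_def)
qed

lemma pe_map_disc_prime_end:
  assumes z: "cmod \<zeta> = 1" and C: "null_chain (F ` ball 0 1) C"
    "cofinal_seqs (\<lambda>n. F ` disc_nbhd \<zeta> n) (chain_domain (F ` ball 0 1) C)"
  shows "pe_map F (ball 0 1) (disc_prime_end \<zeta>) = null_chain_equiv (F ` ball 0 1) `` {C}"
proof -
  obtain B where B: "B \<in> disc_prime_end \<zeta>" using disc_prime_end_nonempty[OF z] by blast
  show ?thesis
  proof (rule pe_map_eqI[OF B C(1)])
    show "cofinal_seqs (\<lambda>n. F ` chain_domain (ball 0 1) B n) (chain_domain (F ` ball 0 1) C)"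
      using cofinal_seqs_image[OF chain_domain_disc_cofinal[OF B], of F] C(2) by (rule cofinal_seqs_trans)
    show "cofinal_seqs (chain_domain (ball 0 1) B) (chain_domain (ball 0 1) X)" if "X \<in> disc_prime_end \<zeta>" for X
      using chain_domain_disc_cofinal[OF B] chain_domain_disc_cofinal[OF that] by (meson cofinal_seqs_sym cofinal_seqs_trans)
  qed
qed

text \<open>Both chains are cofinal with images of the same sequence \<open>N\<close>, so they correspond under \<open>\<phi>\<close>.\<close>
lemma pe_map_null_chain_class:
  assumes C: "null_chain D C" "cofinal_seqs (\<lambda>n. F ` N n) (chain_domain D C)"
    and C': "null_chain (\<phi> ` D) C'" "cofinal_seqs (\<lambda>n. (\<phi> \<circ> F) ` N n) (chain_domain (\<phi> ` D) C')"
  shows "pe_map \<phi> D (null_chain_equiv D `` {C}) = null_chain_equiv (\<phi> ` D) `` {C'}"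
proof (rule pe_map_eqI[of C])
  show "C \<in> null_chain_equiv D `` {C}" unfolding in_null_chain_class_iff using C(1) by (simp add: cofinal_seqs_refl)
  show "cofinal_seqs (\<lambda>n. \<phi> ` chain_domain D C n) (chain_domain (\<phi> ` D) C')"
    using cofinal_seqs_sym[OF cofinal_seqs_image[OF C(2), of \<phi>]] C'(2) unfolding image_comp
    by (rule cofinal_seqs_trans)
  show "cofinal_seqs (chain_domain D C) (chain_domain D X)" if "X \<in> null_chain_equiv D `` {C}" for X
    using that unfolding in_null_chain_class_iff by simp
qed (fact C'(1))

section \<open>The Julia--Wolff theorem\<close>

lemma cmod_one_minus_cnj_mult:
  "(cmod (1 - cnj a * z))\<^sup>2 - (cmod (z - a))\<^sup>2 = (1 - (cmod a)\<^sup>2) * (1 - (cmod z)\<^sup>2)"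
  unfolding cmod_power2 by (simp add: power2_eq_square algebra_simps)

lemma one_minus_cnj_mult_nonzero:
  assumes "cmod a < 1" "cmod z < 1"
  shows "1 - cnj a * z \<noteq> 0"
proof
  assume "1 - cnj a * z = 0"
  then have "cmod (cnj a * z) = 1" by (metis eq_iff_diff_eq_0 norm_one)
  moreover have "cmod (cnj a * z) \<le> cmod a * 1" unfolding norm_mult complex_mod_cnj
    using assms by (intro mult_left_mono) auto
  ultimately show False using assms by simp
qed

text \<open>The Schwarz lemma for the map conjugated by disc automorphisms, multiplied out so that it passes to limits at the boundary.\<close>
lemma Schwarz_Pick:
  assumes v: "v holomorphic_on ball 0 1" "v ` ball 0 1 \<subseteq> ball 0 1" and a: "cmod a < 1" and z: "cmod z < 1"
  shows "(cmod (1 - cnj (v a) * v z))\<^sup>2 * (1 - (cmod a)\<^sup>2) * (1 - (cmod z)\<^sup>2) \<le>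
         (cmod (1 - cnj a * z))\<^sup>2 * (1 - (cmod (v a))\<^sup>2) * (1 - (cmod (v z))\<^sup>2)"
proof -
  have vb: "cmod (v x) < 1" if "cmod x < 1" for x using v(2) that by (auto simp: image_subset_iff)
  define M where "M = (\<lambda>b z. (z - b) / (1 - cnj b * z))"
  have M1: "(cmod (M b z))\<^sup>2 = 1 - (1 - (cmod b)\<^sup>2) * (1 - (cmod z)\<^sup>2) / (cmod (1 - cnj b * z))\<^sup>2"
    if "cmod b < 1" "cmod z < 1" for b z
    using one_minus_cnj_mult_nonzero[OF that] cmod_one_minus_cnj_mult[of b z]
    by (simp add: M_def norm_divide power_divide divide_simps)
  have Mb: "cmod (M b z) < 1" if "cmod b < 1" "cmod z < 1" for b z
  proof -
    have "0 < (1 - (cmod b)\<^sup>2) * (1 - (cmod z)\<^sup>2) / (cmod (1 - cnj b * z))\<^sup>2"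
      using that one_minus_cnj_mult_nonzero[OF that] by (intro divide_pos_pos mult_pos_pos) (auto simp: power_less_one_iff)
    then have "(cmod (M b z))\<^sup>2 < 1\<^sup>2" using M1[OF that] by simp
    then show ?thesis by (rule power_less_imp_less_base) simp
  qed
  have Mh: "M b holomorphic_on ball 0 1" if "cmod b < 1" for b
    unfolding M_def using one_minus_cnj_mult_nonzero[OF that] by (intro holomorphic_intros) auto
  have Minv: "M (- a) (M a z) = z"
  proof -
    have n1: "1 - cnj a * z \<noteq> 0" by (rule one_minus_cnj_mult_nonzero[OF a z])
    have n2: "1 - cnj a * a \<noteq> 0" by (rule one_minus_cnj_mult_nonzero[OF a a])
    have e1: "(M a z + a) * (1 - cnj a * z) = z * (1 - cnj a * a)"
      using n1 by (simp add: M_def distrib_right) (simp add: algebra_simps)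
    have e2: "(1 + cnj a * M a z) * (1 - cnj a * z) = 1 - cnj a * a"
      using n1 by (simp add: M_def distrib_right) (simp add: algebra_simps)
    have "(M a z + a) = z * (1 + cnj a * M a z)"
      using e1 e2 n1 by (metis (no_types, lifting) mult.assoc mult_cancel_right)
    moreover have "1 + cnj a * M a z \<noteq> 0" using e2 n2 by auto
    ultimately show ?thesis by (simp add: M_def)
  qed
  define h where "h = M (v a) \<circ> v \<circ> M (- a)"
  have h: "h holomorphic_on ball 0 1" unfolding h_def
    by (intro holomorphic_on_compose Mh holomorphic_on_subset[OF v(1)] holomorphic_on_subset[OF Mh[OF vb[OF a]]])
       (use a Mb[of "-a"] vb in auto)
  have "cmod (h (M a z)) \<le> cmod (M a z)"
  proof (rule Schwarz_Lemma(1)[OF h])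
    show "h 0 = 0" by (simp add: h_def M_def)
    show "cmod (h x) < 1" if "cmod x < 1" for x
      unfolding h_def o_def by (intro Mb vb a that) (use a that in auto)
    show "cmod (M a z) < 1" by (rule Mb[OF a z])
  qed
  then have "(cmod (M (v a) (v z)))\<^sup>2 \<le> (cmod (M a z))\<^sup>2"
    by (intro power_mono) (auto simp: h_def Minv)
  then have "(1 - (cmod a)\<^sup>2) * (1 - (cmod z)\<^sup>2) / (cmod (1 - cnj a * z))\<^sup>2
      \<le> (1 - (cmod (v a))\<^sup>2) * (1 - (cmod (v z))\<^sup>2) / (cmod (1 - cnj (v a) * v z))\<^sup>2"
    unfolding M1[OF a z] M1[OF vb[OF a] vb[OF z]] by simp
  then show ?thesis
    using one_minus_cnj_mult_nonzero[OF a z] one_minus_cnj_mult_nonzero[OF vb[OF a] vb[OF z]]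
    by (simp add: divide_le_eq le_divide_eq mult_ac)
qed

text \<open>The case \<open>a = 0\<close>: a self-map cannot approach the circle faster than linearly. It is the source of all comparisons between domains.\<close>
lemma Schwarz_Pick_boundary_growth:
  assumes v: "v holomorphic_on ball 0 1" "v ` ball 0 1 \<subseteq> ball 0 1"
  obtains c where "c > 0" "\<And>z. cmod z < 1 \<Longrightarrow> c * (1 - cmod z) \<le> 1 - cmod (v z)"
proof
  have vb: "cmod (v x) < 1" if "cmod x < 1" for x using v(2) that by (auto simp: image_subset_iff)
  let ?c = "(1 - cmod (v 0))\<^sup>2 / 2"
  show "?c > 0" using vb[of 0] by simp
  show "?c * (1 - cmod z) \<le> 1 - cmod (v z)" if z: "cmod z < 1" for z
  proof -
    have "1 - cmod (v 0) \<le> cmod (1 - cnj (v 0) * v z)"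
    proof -
      have "cmod (cnj (v 0) * v z) \<le> cmod (v 0) * 1" unfolding norm_mult complex_mod_cnj
        using vb[OF z] by (intro mult_left_mono) auto
      then show ?thesis using norm_triangle_ineq2[of 1 "cnj (v 0) * v z"] by simp
    qed
    then have "(1 - cmod (v 0))\<^sup>2 \<le> (cmod (1 - cnj (v 0) * v z))\<^sup>2"
      using vb[of 0] by (intro power_mono) auto
    moreover have le1: "(1 - cmod x) \<le> 1 - (cmod x)\<^sup>2" "1 - (cmod x)\<^sup>2 \<le> 2 * (1 - cmod x)" if "cmod x < 1" for x :: complex
      using that power_decreasing[of 1 2 "cmod x"] sum_squares_bound[of 1 "cmod x"] by auto
    ultimately have "(1 - cmod (v 0))\<^sup>2 * (1 - cmod z) \<le> (cmod (1 - cnj (v 0) * v z))\<^sup>2 * (1 - (cmod z)\<^sup>2)"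
      using le1(1)[OF z] z by (intro mult_mono) auto
    also have "\<dots> \<le> (1 - (cmod (v 0))\<^sup>2) * (1 - (cmod (v z))\<^sup>2)"
      using Schwarz_Pick[OF v _ z, of 0] by simp
    also have "\<dots> \<le> 1 * (2 * (1 - cmod (v z)))"
      using le1[OF vb[OF z]] vb[OF z] vb[of 0] by (intro mult_mono) (auto simp: power_le_one)
    finally show ?thesis by simp
  qed
qed

text \<open>Under the Cayley transform \<open>1 - cnj a * z\<close> corresponds to \<open>p + cnj q\<close> and \<open>1 - \<bar>a\<bar>\<^sup>2\<close> to \<open>4 * Re p\<close>, up to factors that cancel.\<close>
lemma half_plane_Schwarz_Pick:
  assumes f: "f holomorphic_on {w. 0 < Re w}" and pos: "\<And>w. 0 < Re w \<Longrightarrow> 0 < Re (f w)"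
    and a: "0 < Re a" and w: "0 < Re w"
  shows "(cmod (f w + cnj (f a)))\<^sup>2 * Re a * Re w \<le> (cmod (w + cnj a))\<^sup>2 * Re (f a) * Re (f w)"
proof -
  define C where "C = (\<lambda>p::complex. (p - 1) / (p + 1))"
  define D where "D = (\<lambda>z::complex. (1 + z) / (1 - z))"
  have nz: "p + 1 \<noteq> 0" if "0 < Re p" for p :: complex
  proof
    assume "p + 1 = 0"
    then have "Re (p + 1) = 0" by (simp only: zero_complex.sel)
    then show False using that by simp
  qed
  have C1: "1 - (cmod (C p))\<^sup>2 = 4 * Re p / (cmod (p + 1))\<^sup>2" if "0 < Re p" for p
  proof -
    have "(cmod (p + 1))\<^sup>2 - (cmod (p - 1))\<^sup>2 = 4 * Re p"
      unfolding cmod_power2 by (simp add: power2_eq_square algebra_simps)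
    then show ?thesis using nz[OF that] by (simp add: C_def norm_divide power_divide divide_simps)
  qed
  have Cb: "cmod (C p) < 1" if "0 < Re p" for p
  proof -
    have "0 < 4 * Re p / (cmod (p + 1))\<^sup>2" using that nz[OF that] by simp
    then have "(cmod (C p))\<^sup>2 < 1\<^sup>2" using C1[OF that] by simp
    then show ?thesis by (rule power_less_imp_less_base) simp
  qed
  have C2: "1 - cnj (C p) * C q = 2 * (q + cnj p) / (cnj (p + 1) * (q + 1))" if "0 < Re p" "0 < Re q" for p q
  proof -
    have n: "cnj p + 1 \<noteq> 0" using nz[of "cnj p"] that by simp
    show ?thesis using n nz[OF that(2)] by (simp add: C_def divide_simps) (simp add: algebra_simps)
  qed
  have DC: "D (C p) = p" if "0 < Re p" for p
  proof -
    have "1 + C p = 2 * p / (p + 1)" "1 - C p = 2 / (p + 1)" using nz[OF that] by (simp_all add: C_def field_simps)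
    then show ?thesis using nz[OF that] by (simp add: D_def)
  qed
  have Dr: "0 < Re (D z)" if "cmod z < 1" for z
  proof -
    have "D z = (1 + z) * cnj (1 - z) / of_real ((cmod (1 - z))\<^sup>2)"
      unfolding D_def by (subst complex_div_cnj) simp
    moreover have "Re ((1 + z) * cnj (1 - z)) = 1 - (cmod z)\<^sup>2"
      unfolding cmod_power2 by (simp add: power2_eq_square algebra_simps)
    ultimately have "Re (D z) = (1 - (cmod z)\<^sup>2) / (cmod (1 - z))\<^sup>2"
      by (simp only: Re_divide_of_real)
    moreover have "1 - z \<noteq> 0" using that by auto
    ultimately show ?thesis using that by (simp add: power_less_one_iff)
  qed
  define v where "v = C \<circ> f \<circ> D"
  have Ch: "C holomorphic_on {w. 0 < Re w}" unfolding C_def using nz by (intro holomorphic_intros) auto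
  have Dh: "D holomorphic_on ball 0 1" unfolding D_def by (intro holomorphic_intros) auto
  have v1: "v holomorphic_on ball 0 1" unfolding v_def
    by (intro holomorphic_on_compose Dh holomorphic_on_subset[OF f] holomorphic_on_subset[OF Ch]) (use Dr pos in auto)
  have v2: "v ` ball 0 1 \<subseteq> ball 0 1" using Cb pos Dr by (auto simp: v_def)
  have vC: "v (C p) = C (f p)" if "0 < Re p" for p using DC[OF that] by (simp add: v_def)
  have key: "(cmod (2 * (f w + cnj (f a)) / (cnj (f a + 1) * (f w + 1))))\<^sup>2 * (4 * Re a / (cmod (a + 1))\<^sup>2) * (4 * Re w / (cmod (w + 1))\<^sup>2)
    \<le> (cmod (2 * (w + cnj a) / (cnj (a + 1) * (w + 1))))\<^sup>2 * (4 * Re (f a) / (cmod (f a + 1))\<^sup>2) * (4 * Re (f w) / (cmod (f w + 1))\<^sup>2)"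
    using Schwarz_Pick[OF v1 v2 Cb[OF a] Cb[OF w]]
    by (simp only: vC[OF a] vC[OF w] C2[OF a w] C2[OF pos[OF a] pos[OF w]] C1[OF a] C1[OF w] C1[OF pos[OF a]] C1[OF pos[OF w]])
  define K where "K = (cmod (a + 1))\<^sup>2 * (cmod (w + 1))\<^sup>2 * (cmod (f a + 1))\<^sup>2 * (cmod (f w + 1))\<^sup>2"
  have K: "K > 0" using nz a w pos[OF a] pos[OF w] by (simp add: K_def)
  have cn: "cmod (cnj (p + 1)) = cmod (p + 1)" for p by (rule complex_mod_cnj)
  have "64 * ((cmod (f w + cnj (f a)))\<^sup>2 * Re a * Re w) / K \<le> 64 * ((cmod (w + cnj a))\<^sup>2 * Re (f a) * Re (f w)) / K"
    using key unfolding norm_divide norm_mult power_divide power_mult_distrib cn K_def by (simp add: mult_ac)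
  then show ?thesis using K by (simp add: divide_le_cancel)
qed

text \<open>The constant is the infimum of \<open>Re (P w) / Re w\<close>. Subtracting \<open>(c - d) * w\<close> leaves a function \<open>Q\<close> with positive real part for
which \<open>Re (Q a) / Re a\<close> is at most \<open>2 * d\<close> at some point \<open>a\<close>; the Schwarz--Pick inequality with base point \<open>a\<close> propagates the
smallness to \<open>Q w / w\<close> in every sector. Working with \<open>c - d\<close> instead of \<open>c\<close> keeps \<open>Q\<close> in the open half-plane.\<close>
lemma half_plane_angular_derivative:
  assumes P: "P holomorphic_on {w. 0 < Re w}" and pos: "\<And>w. 0 < Re w \<Longrightarrow> 0 < Re (P w)"
  obtains c where "\<And>k. (\<And>w. 0 < Re w \<Longrightarrow> k * Re w \<le> Re (P w)) \<Longrightarrow> k \<le> c"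
    "\<And>M \<epsilon>. M > 0 \<Longrightarrow> \<epsilon> > 0 \<Longrightarrow> \<exists>R. \<forall>w. 0 < Re w \<and> cmod w \<le> M * Re w \<and> R \<le> cmod w \<longrightarrow> cmod (P w - of_real c * w) \<le> \<epsilon> * cmod w"
proof -
  define S where "S = (\<lambda>w. Re (P w) / Re w) ` {w. 0 < Re w}"
  define c where "c = Inf S"
  have ne: "S \<noteq> {}" by (auto simp: S_def intro: exI[of _ 1])
  have bdd: "bdd_below S" by (rule bdd_belowI[of _ 0]) (auto simp: S_def less_imp_le pos)
  have cle: "c * Re w \<le> Re (P w)" if "0 < Re w" for w
  proof -
    have "c \<le> Re (P w) / Re w" unfolding c_def by (rule cInf_lower[OF _ bdd]) (use that in \<open>auto simp: S_def\<close>)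
    then show ?thesis using that by (simp add: field_simps)
  qed
  show ?thesis
  proof
    show "k \<le> c" if "\<And>w. 0 < Re w \<Longrightarrow> k * Re w \<le> Re (P w)" for k
      unfolding c_def by (rule cInf_greatest[OF ne]) (use that in \<open>auto simp: S_def field_simps\<close>)
    fix M \<epsilon> :: real assume M: "M > 0" and e: "\<epsilon> > 0"
    define d where "d = \<epsilon> / (32 * M + 2)"
    have d: "d > 0" using M e by (simp add: d_def)
    \<comment> \<open>a point where the infimum is almost attained\<close>
    have "\<exists>s\<in>S. s < c + d" unfolding c_def by (rule cInf_lessD[OF ne]) (use d in simp)
    then obtain a where a: "0 < Re a" "Re (P a) < (c + d) * Re a" by (auto simp: S_def field_simps)
    define Q where "Q = (\<lambda>w. P w - of_real (c - d) * w)"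
    have Qh: "Q holomorphic_on {w. 0 < Re w}" unfolding Q_def by (intro holomorphic_intros P)
    have ReQ: "Re (Q w) = Re (P w) - (c - d) * Re w" for w by (simp add: Q_def)
    have Qp: "0 < Re (Q w)" if "0 < Re w" for w
      using cle[OF that] mult_pos_pos[OF d that] unfolding ReQ by (simp add: algebra_simps)
    have Qa: "Re (Q a) \<le> 2 * d * Re a" using a unfolding ReQ by (simp add: algebra_simps)
    define R where "R = max (cmod a) (2 * cmod (Q a) / d)"
    show "\<exists>R. \<forall>w. 0 < Re w \<and> cmod w \<le> M * Re w \<and> R \<le> cmod w \<longrightarrow> cmod (P w - of_real c * w) \<le> \<epsilon> * cmod w"
    proof (intro exI[of _ R] allI impI, elim conjE)
      fix w assume w: "0 < Re w" "cmod w \<le> M * Re w" "R \<le> cmod w"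
      have aw: "cmod a \<le> cmod w" "2 * cmod (Q a) \<le> d * cmod w"
        using w(3) d by (auto simp: R_def divide_le_eq mult.commute)
      have "cmod (Q w) \<le> (32 * M + 1) * d * cmod w"
      proof (cases "2 * cmod (Q a) \<le> cmod (Q w)")
        case True
        have "cmod (Q w) - cmod (Q a) \<le> cmod (Q w + cnj (Q a))"
          using norm_diff_ineq[of "Q w" "cnj (Q a)"] by simp
        then have h: "cmod (Q w) / 2 \<le> cmod (Q w + cnj (Q a))" using True by simp
        have "cmod (w + cnj a) \<le> 2 * cmod w" using norm_triangle_ineq[of w "cnj a"] aw(1) by simp
        then have w2: "(cmod (w + cnj a))\<^sup>2 \<le> (2 * cmod w)\<^sup>2" by (intro power_mono) auto
        have "(cmod (Q w) / 2)\<^sup>2 * Re a * Re w \<le> (cmod (Q w + cnj (Q a)))\<^sup>2 * Re a * Re w"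
          using h a w by (intro mult_right_mono power_mono) auto
        also have "\<dots> \<le> (cmod (w + cnj a))\<^sup>2 * Re (Q a) * Re (Q w)"
          by (rule half_plane_Schwarz_Pick[OF Qh Qp a(1) w(1)])
        also have "\<dots> \<le> (2 * cmod w)\<^sup>2 * (2 * d * Re a) * cmod (Q w)"
          using w2 Qa Qp[OF a(1)] Qp[OF w(1)] complex_Re_le_cmod[of "Q w"] by (intro mult_mono) auto
        finally have "Re a * ((cmod (Q w))\<^sup>2 * Re w) \<le> Re a * (32 * d * (cmod w)\<^sup>2 * cmod (Q w))"
          by (simp add: power_mult_distrib power_divide field_simps)
        then have "(cmod (Q w))\<^sup>2 * Re w \<le> 32 * d * (cmod w)\<^sup>2 * cmod (Q w)" using a(1) by simp
        moreover have "cmod (Q w) > 0" using Qp[OF w(1)] by auto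
        ultimately have q: "cmod (Q w) * Re w \<le> 32 * d * (cmod w)\<^sup>2" by (simp add: power2_eq_square)
        have "cmod (Q w) * cmod w \<le> cmod (Q w) * (M * Re w)" using w(2) by (intro mult_left_mono) auto
        also have "\<dots> \<le> M * (32 * d * (cmod w)\<^sup>2)" using q M by (simp add: mult.left_commute)
        finally have "cmod (Q w) * cmod w \<le> (32 * M * d * cmod w) * cmod w" by (simp add: power2_eq_square mult_ac)
        then have "cmod (Q w) \<le> 32 * M * d * cmod w" using w(1) by (subst (asm) mult_le_cancel_right) auto
        moreover have "0 \<le> d * cmod w" using d by simp
        ultimately show ?thesis by (simp add: algebra_simps)
      next
        case False
        then have "cmod (Q w) \<le> d * cmod w" using aw(2) by simp
        moreover have "0 \<le> 32 * M * d * cmod w" using d M by simp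
        ultimately show ?thesis by (simp add: algebra_simps)
      qed
      moreover have eq: "P w - of_real c * w = Q w - of_real d * w" by (simp add: Q_def algebra_simps)
      moreover have "cmod (Q w - of_real d * w) \<le> cmod (Q w) + d * cmod w"
        using norm_triangle_ineq4[of "Q w" "of_real d * w"] d by (simp add: norm_mult)
      ultimately have "cmod (P w - of_real c * w) \<le> (32 * M + 2) * d * cmod w"
        unfolding eq by (simp add: algebra_simps)
      also have "(32 * M + 2) * d = \<epsilon>" using M by (simp add: d_def)
      finally show "cmod (P w - of_real c * w) \<le> \<epsilon> * cmod w" .
    qed
  qed
qed

text \<open>The limit of the Schwarz--Pick inequality along the sequence is Julia's inequality, which says that in half-plane coordinates
\<open>Re (P w) \<ge> Re w / (2 * A)\<close>. Hence the angular derivative of \<open>P\<close> at infinity is positive, and its reciprocal is, up to a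
unimodular factor, the angular limit of the difference quotient of \<open>\<psi>\<close>.\<close>
lemma Julia_Wolff:
  assumes psi: "\<psi> holomorphic_on ball 0 1" "\<psi> ` ball 0 1 \<subseteq> ball 0 1"
    and zeta: "cmod \<zeta>0 = 1" "\<And>n. cmod (\<zeta> n) < 1" "\<zeta> \<longlonglongrightarrow> \<zeta>0"
    and A: "\<And>n. 1 - cmod (\<psi> (\<zeta> n)) \<le> A * (1 - cmod (\<zeta> n))"
  obtains z0 l where "cmod z0 = 1" "angular_lim \<psi> \<zeta>0 z0" "angular_lim (\<lambda>z. (\<psi> z - z0) / (z - \<zeta>0)) \<zeta>0 l"
proof -
  have pb: "cmod (\<psi> x) < 1" if "cmod x < 1" for x using psi(2) that by (auto simp: image_subset_iff)
  have A0: "A > 0"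
  proof -
    have "0 < A * (1 - cmod (\<zeta> 0))" using A[of 0] pb[OF zeta(2), of 0] by linarith
    then show ?thesis using zeta(2)[of 0] by (simp add: zero_less_mult_iff)
  qed
  obtain z0 r where r: "strict_mono r" "(\<lambda>n. \<psi> (\<zeta> (r n))) \<longlonglongrightarrow> z0"
  proof -
    have "\<And>n. \<psi> (\<zeta> n) \<in> cball 0 1" using pb[OF zeta(2)] by (simp add: less_imp_le)
    then show ?thesis using compact_cball[of "0::complex" 1, unfolded compact_def, rule_format, of "\<lambda>n. \<psi> (\<zeta> n)"] that
      by (auto simp: o_def)
  qed
  have zr: "(\<lambda>n. \<zeta> (r n)) \<longlonglongrightarrow> \<zeta>0" using LIMSEQ_subseq_LIMSEQ[OF zeta(3) r(1)] by (simp add: o_def)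
  have z0: "cmod z0 = 1"
  proof (rule antisym)
    show "cmod z0 \<le> 1"
      by (rule LIMSEQ_le_const2[OF tendsto_norm[OF r(2)]]) (use pb[OF zeta(2)] less_imp_le in blast)
    have "(\<lambda>n. 1 - cmod (\<psi> (\<zeta> (r n)))) \<longlonglongrightarrow> 1 - cmod z0" by (intro tendsto_intros r(2))
    moreover have "(\<lambda>n. A * (1 - cmod (\<zeta> (r n)))) \<longlonglongrightarrow> A * (1 - cmod \<zeta>0)" by (intro tendsto_intros zr)
    ultimately have "1 - cmod z0 \<le> A * (1 - cmod \<zeta>0)"
      by (rule LIMSEQ_le) (use A in blast)
    then show "1 \<le> cmod z0" using zeta(1) by simp
  qed
  have Julia: "(cmod (z0 - \<psi> z))\<^sup>2 * (1 - (cmod z)\<^sup>2) \<le> 2 * A * (cmod (\<zeta>0 - z))\<^sup>2 * (1 - (cmod (\<psi> z))\<^sup>2)"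
    if z: "cmod z < 1" for z
  proof -
    have le: "(cmod (1 - cnj (\<psi> a) * \<psi> z))\<^sup>2 * (1 - (cmod z)\<^sup>2) \<le> 2 * A * (cmod (1 - cnj a * z))\<^sup>2 * (1 - (cmod (\<psi> z))\<^sup>2)"
      if a: "cmod a < 1" "1 - cmod (\<psi> a) \<le> A * (1 - cmod a)" for a
    proof -
      have p: "0 < 1 - (cmod a)\<^sup>2" using a by (simp add: power_less_one_iff)
      have q: "0 \<le> 1 - (cmod (\<psi> z))\<^sup>2" using pb[OF z] by (simp add: power_le_one)
      have "1 - (cmod (\<psi> a))\<^sup>2 \<le> 2 * (1 - cmod (\<psi> a))" using sum_squares_bound[of 1 "cmod (\<psi> a)"] by simp
      also have "\<dots> \<le> 2 * (A * (1 - cmod a))" using a(2) by simp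
      also have "\<dots> \<le> 2 * (A * (1 - (cmod a)\<^sup>2))" using a(1) A0 power_decreasing[of 1 2 "cmod a"] by simp
      finally have k: "1 - (cmod (\<psi> a))\<^sup>2 \<le> 2 * A * (1 - (cmod a)\<^sup>2)" by simp
      have "(1 - (cmod a)\<^sup>2) * ((cmod (1 - cnj (\<psi> a) * \<psi> z))\<^sup>2 * (1 - (cmod z)\<^sup>2)) \<le>
          (cmod (1 - cnj a * z))\<^sup>2 * (1 - (cmod (\<psi> a))\<^sup>2) * (1 - (cmod (\<psi> z))\<^sup>2)"
        using Schwarz_Pick[OF psi a(1) z] by (simp add: mult_ac)
      also have "\<dots> \<le> (cmod (1 - cnj a * z))\<^sup>2 * (2 * A * (1 - (cmod a)\<^sup>2)) * (1 - (cmod (\<psi> z))\<^sup>2)"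
        using k q by (intro mult_right_mono mult_left_mono) auto
      also have "\<dots> = (1 - (cmod a)\<^sup>2) * (2 * A * (cmod (1 - cnj a * z))\<^sup>2 * (1 - (cmod (\<psi> z))\<^sup>2))" by (simp add: mult_ac)
      finally show ?thesis using p by simp
    qed
    have "(cmod (1 - cnj z0 * \<psi> z))\<^sup>2 * (1 - (cmod z)\<^sup>2) \<le> 2 * A * (cmod (1 - cnj \<zeta>0 * z))\<^sup>2 * (1 - (cmod (\<psi> z))\<^sup>2)"
    proof (rule LIMSEQ_le)
      show "(\<lambda>n. (cmod (1 - cnj (\<psi> (\<zeta> (r n))) * \<psi> z))\<^sup>2 * (1 - (cmod z)\<^sup>2)) \<longlonglongrightarrow> (cmod (1 - cnj z0 * \<psi> z))\<^sup>2 * (1 - (cmod z)\<^sup>2)"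
        by (intro tendsto_intros r(2))
      show "(\<lambda>n. 2 * A * (cmod (1 - cnj (\<zeta> (r n)) * z))\<^sup>2 * (1 - (cmod (\<psi> z))\<^sup>2)) \<longlonglongrightarrow> 2 * A * (cmod (1 - cnj \<zeta>0 * z))\<^sup>2 * (1 - (cmod (\<psi> z))\<^sup>2)"
        by (intro tendsto_intros zr)
    qed (use le[OF zeta(2) A] in blast)
    moreover have "cmod (1 - cnj y * x) = cmod (y - x)" if "cmod y = 1" for x y
    proof -
      have "y * (1 - cnj y * x) = y - x"
        using complex_norm_square[of y] that by (simp add: right_diff_distrib mult.assoc[symmetric])
      then show ?thesis using that by (metis norm_mult mult_1)
    qed
    ultimately show ?thesis using z0 zeta(1) by simp
  qed
  define Z where "Z = (\<lambda>w::complex. \<zeta>0 * ((w - 1) / (w + 1)))"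
  define P where "P = (\<lambda>w. (z0 + \<psi> (Z w)) / (z0 - \<psi> (Z w)))"
  define W where "W = (\<lambda>z. (\<zeta>0 + z) / (\<zeta>0 - z))"
  have nz: "p + 1 \<noteq> 0" if "0 < Re p" for p :: complex
  proof
    assume "p + 1 = 0"
    then have "Re (p + 1) = 0" by (simp only: zero_complex.sel)
    then show False using that by simp
  qed
  have Zb: "cmod (Z w) < 1" if "0 < Re w" for w
  proof -
    have "(cmod (w - 1))\<^sup>2 < (cmod (w + 1))\<^sup>2"
      unfolding cmod_power2 using that by (simp add: power2_eq_square algebra_simps)
    then have "cmod (w - 1) < cmod (w + 1)" by (rule power_less_imp_less_base) simp
    then show ?thesis using zeta(1) nz[OF that] by (simp add: Z_def norm_mult norm_divide)
  qed
  have ReC: "Re ((y + x) / (y - x)) = (1 - (cmod x)\<^sup>2) / (cmod (y - x))\<^sup>2" if "cmod y = 1" for x y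
  proof -
    have "(y + x) / (y - x) = (y + x) * cnj (y - x) / of_real ((cmod (y - x))\<^sup>2)"
      by (subst complex_div_cnj) simp
    moreover have "Re ((y + x) * cnj (y - x)) = (cmod y)\<^sup>2 - (cmod x)\<^sup>2"
      unfolding cmod_power2 by (simp add: power2_eq_square algebra_simps)
    ultimately show ?thesis using that by (simp only: Re_divide_of_real) simp
  qed
  have ne: "y - x \<noteq> 0" if "cmod y = 1" "cmod x < 1" for x y :: complex using that by auto
  have WZ: "W (Z w) = w" if "0 < Re w" for w
  proof -
    have "\<zeta>0 \<noteq> 0" using zeta(1) by auto
    moreover have "\<zeta>0 + Z w = \<zeta>0 * (2 * w / (w + 1))" "\<zeta>0 - Z w = \<zeta>0 * (2 / (w + 1))"
      using nz[OF that] by (simp_all add: Z_def field_simps)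
    ultimately show ?thesis using nz[OF that] by (simp add: W_def)
  qed
  have ZW: "Z (W z) = z" if "cmod z < 1" for z
  proof -
    have "\<zeta>0 \<noteq> 0" "\<zeta>0 - z \<noteq> 0" using zeta(1) that by auto
    moreover have "W z - 1 = 2 * z / (\<zeta>0 - z)" "W z + 1 = 2 * \<zeta>0 / (\<zeta>0 - z)"
      using calculation by (simp_all add: W_def field_simps)
    ultimately show ?thesis by (simp add: Z_def)
  qed
  have ReW: "Re (W z) = (1 - (cmod z)\<^sup>2) / (cmod (\<zeta>0 - z))\<^sup>2" for z unfolding W_def by (rule ReC[OF zeta(1)])
  have ReWp: "0 < Re (W z)" if "cmod z < 1" for z
    unfolding ReW using ne[OF zeta(1) that] that by (simp add: power_less_one_iff)
  have ReP: "Re (P w) = (1 - (cmod (\<psi> (Z w)))\<^sup>2) / (cmod (z0 - \<psi> (Z w)))\<^sup>2" for w unfolding P_def by (rule ReC[OF z0])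
  have Ppos: "0 < Re (P w)" if "0 < Re w" for w
    unfolding ReP using ne[OF z0 pb[OF Zb[OF that]]] pb[OF Zb[OF that]] by (simp add: power_less_one_iff)
  have Zh: "Z holomorphic_on {w. 0 < Re w}" unfolding Z_def using nz by (intro holomorphic_intros) auto
  have "\<psi> \<circ> Z holomorphic_on {w. 0 < Re w}"
    by (rule holomorphic_on_compose[OF Zh holomorphic_on_subset[OF psi(1)]]) (use Zb in auto)
  then have Ph: "P holomorphic_on {w. 0 < Re w}" unfolding P_def o_def
    using ne[OF z0 pb[OF Zb]] by (intro holomorphic_intros) auto
  obtain c where c1: "\<And>k. (\<And>w. 0 < Re w \<Longrightarrow> k * Re w \<le> Re (P w)) \<Longrightarrow> k \<le> c"
    and c2: "\<And>M \<epsilon>. M > 0 \<Longrightarrow> \<epsilon> > 0 \<Longrightarrow> \<exists>R. \<forall>w. 0 < Re w \<and> cmod w \<le> M * Re w \<and> R \<le> cmod w \<longrightarrow> cmod (P w - of_real c * w) \<le> \<epsilon> * cmod w"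
    using half_plane_angular_derivative[OF Ph Ppos] by metis
  have gen2: "1 / (2 * A) * x \<le> y" if "x \<le> 2 * A * y" for x y
    using that A0 by (simp add: divide_le_eq mult_ac)
  have "1 / (2 * A) \<le> c"
  proof (rule c1)
    fix w :: complex assume w: "0 < Re w"
    let ?z = "Z w"
    have z: "cmod ?z < 1" by (rule Zb[OF w])
    have "Re w = (1 - (cmod ?z)\<^sup>2) / (cmod (\<zeta>0 - ?z))\<^sup>2" using ReW[of ?z] WZ[OF w] by simp
    moreover have "(1 - (cmod ?z)\<^sup>2) / (cmod (\<zeta>0 - ?z))\<^sup>2 \<le> 2 * A * ((1 - (cmod (\<psi> ?z))\<^sup>2) / (cmod (z0 - \<psi> ?z))\<^sup>2)"
    proof -
      have gen: "p / x \<le> 2 * A * (q / y)" if "y * p \<le> 2 * A * x * q" "x > 0" "y > 0" for p q x y :: real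
        using that by (simp add: divide_le_eq le_divide_eq mult_ac)
      show ?thesis by (rule gen[OF Julia[OF z]]) (use ne[OF zeta(1) z] ne[OF z0 pb[OF z]] in auto)
    qed
    ultimately show "1 / (2 * A) * Re w \<le> Re (P w)" unfolding ReP
      by (intro gen2) linarith
  qed
  then have c0: "c > 0" using A0 by (smt (verit) divide_pos_pos)
  define l where "l = z0 / (\<zeta>0 * of_real c)"
  have quot: "((\<lambda>z. (\<psi> z - z0) / (z - \<zeta>0)) \<longlongrightarrow> l) (at \<zeta>0 within {z \<in> ball 0 1. cmod (z - \<zeta>0) \<le> M * (1 - cmod z)})"
    if M: "M > 1" for M
  proof -
    let ?F = "at \<zeta>0 within {z \<in> ball 0 1. cmod (z - \<zeta>0) \<le> M * (1 - cmod z)}"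
    have evS: "\<forall>\<^sub>F z in ?F. cmod z < 1 \<and> cmod (z - \<zeta>0) \<le> M * (1 - cmod z)" by (simp add: eventually_at_filter)
    have zl: "((\<lambda>z. z) \<longlongrightarrow> \<zeta>0) ?F" by (rule tendsto_ident_at)
    have zz: "\<zeta>0 \<noteq> 0" using zeta(1) by auto
    have Winv: "((\<lambda>z. 1 / W z) \<longlongrightarrow> 0) ?F"
    proof -
      have "((\<lambda>z. (\<zeta>0 - z) / (\<zeta>0 + z)) \<longlongrightarrow> (\<zeta>0 - \<zeta>0) / (\<zeta>0 + \<zeta>0)) ?F"
        by (intro tendsto_intros zl) (use zz in auto)
      then show ?thesis by (simp add: W_def)
    qed
    have sector: "cmod (W z) \<le> 2 * M * Re (W z)" if z: "cmod z < 1" "cmod (z - \<zeta>0) \<le> M * (1 - cmod z)" for z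
    proof -
      define d where "d = cmod (\<zeta>0 - z)"
      have d: "d > 0" using ne[OF zeta(1) z(1)] by (simp add: d_def)
      have "d \<le> M * (1 - cmod z)" using z(2) by (simp add: d_def norm_minus_commute)
      also have "\<dots> \<le> M * (1 - (cmod z)\<^sup>2)" using z(1) M power_decreasing[of 1 2 "cmod z"] by simp
      finally have "d \<le> M * (1 - (cmod z)\<^sup>2)" .
      then have "2 / d \<le> 2 * M * ((1 - (cmod z)\<^sup>2) / d\<^sup>2)" using d by (simp add: divide_simps power2_eq_square)
      moreover have "cmod (W z) \<le> 2 / d"
        using norm_triangle_ineq[of \<zeta>0 z] z(1) zeta(1) d by (simp add: W_def norm_divide d_def divide_right_mono)
      ultimately show ?thesis unfolding ReW d_def by simp
    qed
    have PW: "((\<lambda>z. P (W z) / W z) \<longlongrightarrow> of_real c) ?F"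
    proof (rule tendstoI)
      fix e :: real assume e: "e > 0"
      obtain R where R: "\<And>w. 0 < Re w \<Longrightarrow> cmod w \<le> 2 * M * Re w \<Longrightarrow> R \<le> cmod w \<Longrightarrow> cmod (P w - of_real c * w) \<le> e / 2 * cmod w"
        using c2[of "2 * M" "e / 2"] M e by auto
      have "\<forall>\<^sub>F z in ?F. dist (1 / W z) 0 < 1 / (\<bar>R\<bar> + 1)" by (rule tendstoD[OF Winv]) simp
      then show "\<forall>\<^sub>F z in ?F. dist (P (W z) / W z) (of_real c) < e"
        using evS
      proof eventually_elim
        case (elim z)
        have Wp: "0 < Re (W z)" using ReWp elim by simp
        then have W0: "W z \<noteq> 0" by auto
        have "1 / cmod (W z) < 1 / (\<bar>R\<bar> + 1)" using elim(1) by (simp add: norm_divide)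
        then have "R \<le> cmod (W z)" using W0 by (simp add: divide_simps split: if_splits)
        then have "cmod (P (W z) - of_real c * W z) \<le> e / 2 * cmod (W z)" using R[OF Wp] sector elim(2) by simp
        moreover have "P (W z) / W z - of_real c = (P (W z) - of_real c * W z) / W z" using W0 by (simp add: field_simps)
        ultimately have "cmod (P (W z) / W z - of_real c) \<le> e / 2" using W0 by (simp add: norm_divide divide_le_eq)
        then show ?case using e by (simp add: dist_norm)
      qed
    qed
    have lim: "((\<lambda>z. (z0 / \<zeta>0) * ((1 + 1 / W z) / (P (W z) / W z + 1 / W z))) \<longlongrightarrow> (z0 / \<zeta>0) * ((1 + 0) / (of_real c + 0))) ?F"
      by (intro tendsto_intros PW Winv) (use c0 in auto)
    have l: "(z0 / \<zeta>0) * ((1 + 0) / (of_real c + 0)) = l" by (simp add: l_def)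
    show ?thesis
    proof (rule Lim_transform_eventually[OF lim[unfolded l]], rule eventually_mono[OF evS])
      fix z assume "cmod z < 1 \<and> cmod (z - \<zeta>0) \<le> M * (1 - cmod z)"
      then have z: "cmod z < 1" by simp
      have Wp: "0 < Re (W z)" by (rule ReWp[OF z])
      then have W0: "W z \<noteq> 0" "W z + 1 \<noteq> 0" using nz by auto
      have P0: "P (W z) + 1 \<noteq> 0" by (rule nz[OF Ppos[OF Wp]])
      have n1: "\<zeta>0 - z \<noteq> 0" "z0 - \<psi> z \<noteq> 0" using ne[OF zeta(1) z] ne[OF z0 pb[OF z]] by auto
      have "W z + 1 = 2 * \<zeta>0 / (\<zeta>0 - z)" using n1 by (simp add: W_def field_simps)
      moreover have "P (W z) + 1 = 2 * z0 / (z0 - \<psi> z)" unfolding P_def ZW[OF z] using n1 by (simp add: field_simps)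
      moreover have "(1 + 1 / W z) / (P (W z) / W z + 1 / W z) = (W z + 1) / (P (W z) + 1)"
        using W0 P0 by (simp add: divide_simps)
      ultimately have "(z0 / \<zeta>0) * ((1 + 1 / W z) / (P (W z) / W z + 1 / W z)) =
          (z0 / \<zeta>0) * ((2 * \<zeta>0 / (\<zeta>0 - z)) / (2 * z0 / (z0 - \<psi> z)))" by (simp only:)
      also have "\<dots> = (z0 - \<psi> z) / (\<zeta>0 - z)"
      proof -
        have "z0 \<noteq> 0" using z0 by auto
        then show ?thesis using zz n1 by simp
      qed
      also have "\<dots> = (\<psi> z - z0) / (z - \<zeta>0)" by (metis minus_diff_eq minus_divide_divide)
      finally show "(z0 / \<zeta>0) * ((1 + 1 / W z) / (P (W z) / W z + 1 / W z)) = (\<psi> z - z0) / (z - \<zeta>0)" .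
    qed
  qed
  have "(\<psi> \<longlongrightarrow> z0) (at \<zeta>0 within {z \<in> ball 0 1. cmod (z - \<zeta>0) \<le> M * (1 - cmod z)})" (is "(_ \<longlongrightarrow> _) ?F") if M: "M > 1" for M
  proof -
    have "((\<lambda>z. z0 + (\<psi> z - z0) / (z - \<zeta>0) * (z - \<zeta>0)) \<longlongrightarrow> z0 + l * (\<zeta>0 - \<zeta>0)) ?F"
      by (intro tendsto_intros quot[OF M] tendsto_ident_at)
    then have "((\<lambda>z. z0 + (\<psi> z - z0) / (z - \<zeta>0) * (z - \<zeta>0)) \<longlongrightarrow> z0) ?F" by simp
    then show ?thesis
      by (rule Lim_transform_eventually) (auto simp: eventually_at_filter)
  qed
  then show ?thesis using that[of z0 l] z0 quot by (simp add: angular_lim_def)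
qed

section \<open>Explicit maps into and around a Dini sector\<close>

text \<open>The sector of opening angle \<open>4 * \<pi> / 3\<close> around the upper half-plane. It keeps away from the poles of the functions
\<open>s / (s + \<i> * t)\<close> on the negative imaginary axis, uniformly in \<open>t\<close>.\<close>
definition slit_sector :: "complex set" where "slit_sector = {s. - Im s < cmod s / 2}"

lemma open_slit_sector: "open slit_sector"
  unfolding slit_sector_def by (intro open_Collect_less continuous_intros) auto

lemma slit_sector_bound:
  assumes s: "s \<in> slit_sector" and t: "0 < t"
  shows "s + \<i> * of_real t \<noteq> 0" "cmod s \<le> 2 * cmod (s + \<i> * of_real t)"
proof -
  have e: "(cmod (s + \<i> * of_real t))\<^sup>2 = (cmod s)\<^sup>2 + 2 * t * Im s + t\<^sup>2"
    unfolding cmod_power2 by (simp add: power2_eq_square algebra_simps)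
  have s0: "cmod s > 0" using s by (auto simp: slit_sector_def)
  have "- Im s * (2 * t) \<le> cmod s / 2 * (2 * t)" using s t by (intro mult_right_mono) (auto simp: slit_sector_def)
  then have "(cmod s)\<^sup>2 - t * cmod s + t\<^sup>2 \<le> (cmod (s + \<i> * of_real t))\<^sup>2" unfolding e by (simp add: mult_ac)
  moreover have "(cmod s / 2)\<^sup>2 \<le> (cmod s)\<^sup>2 - t * cmod s + t\<^sup>2"
  proof -
    have "0 \<le> (cmod s / 2 - t)\<^sup>2 + (cmod s)\<^sup>2 / 2" by simp
    then show ?thesis unfolding power2_eq_square by (simp add: algebra_simps)
  qed
  ultimately have "(cmod s / 2)\<^sup>2 \<le> (cmod (s + \<i> * of_real t))\<^sup>2" by (rule order_trans[rotated])
  then have l: "cmod s / 2 \<le> cmod (s + \<i> * of_real t)" by (rule power2_le_imp_le) simp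
  then show "cmod s \<le> 2 * cmod (s + \<i> * of_real t)" by simp
  show "s + \<i> * of_real t \<noteq> 0" using l s0 by auto
qed

text \<open>The function \<open>\<kappa>\<close> of the introduction, a superposition over dyadic scales. Its term of scale \<open>t\<close> has imaginary part
\<open>m * t * Re s / \<bar>s + \<i> * t\<bar>\<^sup>2\<close>: of the sign of \<open>Re s\<close>, and of order \<open>m\<close> where \<open>\<bar>s\<bar>\<close> is
comparable to \<open>t\<close>. So multiplication by \<open>exp (twist m s)\<close> turns points near the real axis towards the imaginary
axis, by an angle of order \<open>m j\<close> at scale \<open>1 / 2^j\<close>, at bounded cost for the modulus if \<open>m\<close> is summable.\<close>
definition twist :: "(nat \<Rightarrow> real) \<Rightarrow> complex \<Rightarrow> complex" where
  "twist m s = - (\<Sum>j. of_real (m j) * (s / (s + \<i> * of_real (1 / 2 ^ j))))"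

text \<open>The bound \<open>1/8\<close> makes the modulus of \<open>twist m\<close> at most \<open>1/4\<close> on the sector; so the cosine of its imaginary part is above
\<open>1/2\<close>, and the factor \<open>exp (Re (twist m s))\<close> lies between \<open>1/2\<close> and \<open>2\<close>.\<close>
locale twist_weights =
  fixes m :: "nat \<Rightarrow> real"
  assumes m_pos: "\<And>j. 0 < m j" and m_sums: "summable m" "suminf m \<le> 1/8"
begin

lemma term_bound:
  assumes "s \<in> slit_sector"
  shows "norm (of_real (m j) * (s / (s + \<i> * of_real (1 / 2 ^ j)))) \<le> 2 * m j"
proof -
  have b: "s + \<i> * of_real (1 / 2 ^ j) \<noteq> 0" "cmod s \<le> 2 * cmod (s + \<i> * of_real (1 / 2 ^ j))"
    by (rule slit_sector_bound[OF assms]; simp)+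
  then have "cmod s / cmod (s + \<i> * of_real (1 / 2 ^ j)) \<le> 2" by (simp add: divide_le_eq)
  then have "m j * (cmod s / cmod (s + \<i> * of_real (1 / 2 ^ j))) \<le> m j * 2"
    using m_pos[of j] by (intro mult_left_mono) auto
  then show ?thesis using m_pos[of j] by (simp add: norm_mult norm_divide mult.commute)
qed

lemma summable_terms:
  assumes "s \<in> slit_sector"
  shows "summable (\<lambda>j. of_real (m j) * (s / (s + \<i> * of_real (1 / 2 ^ j))))"
  by (rule summable_comparison_test'[OF summable_mult[OF m_sums(1), of 2]]) (use term_bound[OF assms] in simp)

lemma norm_twist:
  assumes "s \<in> slit_sector"
  shows "cmod (twist m s) \<le> 1 / 4"
proof -
  have "norm (\<Sum>j. of_real (m j) * (s / (s + \<i> * of_real (1 / 2 ^ j)))) \<le> (\<Sum>j. 2 * m j)"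
    by (rule norm_suminf_le[OF term_bound[OF assms] summable_mult[OF m_sums(1)]])
  also have "\<dots> \<le> 1 / 4" using m_sums by (simp add: suminf_mult)
  finally show ?thesis by (simp add: twist_def)
qed

lemma holomorphic_twist: "twist m holomorphic_on slit_sector"
proof -
  have "(\<lambda>s. \<Sum>j. of_real (m j) * (s / (s + \<i> * of_real (1 / 2 ^ j)))) holomorphic_on slit_sector"
  proof (rule holomorphic_uniform_sequence[OF open_slit_sector])
    fix n
    show "(\<lambda>s. \<Sum>j<n. of_real (m j) * (s / (s + \<i> * of_real (1 / 2 ^ j)))) holomorphic_on slit_sector"
    proof (intro holomorphic_intros)
      fix s j assume "s \<in> slit_sector"
      then show "s + \<i> * of_real (1 / 2 ^ j) \<noteq> 0" by (rule slit_sector_bound) simp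
    qed
  next
    fix x assume "x \<in> slit_sector"
    then obtain d where d: "d > 0" "cball x d \<subseteq> slit_sector" using open_slit_sector open_contains_cball by blast
    have "uniform_limit (cball x d) (\<lambda>n s. \<Sum>j<n. of_real (m j) * (s / (s + \<i> * of_real (1 / 2 ^ j))))
      (\<lambda>s. \<Sum>j. of_real (m j) * (s / (s + \<i> * of_real (1 / 2 ^ j)))) sequentially"
      by (rule Weierstrass_m_test[OF _ summable_mult[OF m_sums(1), of 2]]) (use d(2) term_bound in blast)
    then show "\<exists>d>0. cball x d \<subseteq> slit_sector \<and> uniform_limit (cball x d) (\<lambda>n s. \<Sum>j<n. of_real (m j) * (s / (s + \<i> * of_real (1 / 2 ^ j))))
      (\<lambda>s. \<Sum>j. of_real (m j) * (s / (s + \<i> * of_real (1 / 2 ^ j)))) sequentially" using d by blast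
  qed
  then show ?thesis unfolding twist_def by (rule holomorphic_on_minus)
qed

text \<open>Every term has the sign of \<open>Re s\<close>, so each one alone bounds the modulus of the sum from below.\<close>
lemma Im_twist:
  assumes s: "s \<in> slit_sector"
  obtains K where "Im (twist m s) = Re s * K" "\<And>j. m j / 2 ^ j / (cmod (s + \<i> * of_real (1 / 2 ^ j)))\<^sup>2 \<le> K" "0 < K"
proof -
  define a where "a j = m j / 2 ^ j / (cmod (s + \<i> * of_real (1 / 2 ^ j)))\<^sup>2" for j
  have nz: "s + \<i> * of_real (1 / 2 ^ j) \<noteq> 0" for j by (rule slit_sector_bound[OF s]) simp
  have Imt: "Im (of_real (m j) * (s / (s + \<i> * of_real (1 / 2 ^ j)))) = - (Re s * a j)" for j
  proof -
    have "s / (s + \<i> * of_real t) = s * cnj (s + \<i> * of_real t) / of_real ((cmod (s + \<i> * of_real t))\<^sup>2)" for t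
      by (subst complex_div_cnj) simp
    moreover have "Im (s * cnj (s + \<i> * of_real t)) = - (t * Re s)" for t by (simp add: algebra_simps)
    ultimately have "Im (s / (s + \<i> * of_real t)) = - (t * Re s) / (cmod (s + \<i> * of_real t))\<^sup>2" for t
      by (simp only: Im_divide_of_real)
    note * = this[of "1 / 2 ^ j"]
    have "Im (of_real x * z) = x * Im z" for x z by simp
    then show ?thesis by (simp only: *) (simp add: a_def)
  qed
  have S: "(\<lambda>j. - (Re s * a j)) sums (- Im (twist m s))"
    using sums_Im[OF summable_sums[OF summable_terms[OF s]]] unfolding Imt by (simp add: twist_def)
  have S': "(\<lambda>j. Re s * a j) sums Im (twist m s)" using sums_minus[OF S] by simp
  have a0: "0 < a j" for j using m_pos[of j] nz[of j] by (simp add: a_def)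
  show ?thesis
  proof (cases "Re s = 0")
    case True
    have i: "Im (twist m s) = 0" using S' True by (simp add: sums_iff)
    have "summable a"
    proof (rule summable_comparison_test'[OF summable_mult[OF m_sums(1), of "4 / (cmod s)\<^sup>2"]])
      fix n :: nat
      have s0: "cmod s > 0" using s by (auto simp: slit_sector_def)
      have "cmod s \<le> 2 * cmod (s + \<i> * of_real (1 / 2 ^ n))" by (rule slit_sector_bound[OF s]) simp
      then have "(cmod s)\<^sup>2 \<le> (2 * cmod (s + \<i> * of_real (1 / 2 ^ n)))\<^sup>2" by (intro power_mono) auto
      then have l: "(cmod s)\<^sup>2 / 4 \<le> (cmod (s + \<i> * of_real (1 / 2 ^ n)))\<^sup>2" by (simp add: power_mult_distrib)
      have "a n \<le> m n / ((cmod s)\<^sup>2 / 4)" unfolding a_def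
        by (rule frac_le) (use m_pos[of n] l s0 in \<open>auto simp: divide_le_eq mult_le_cancel_left1\<close>)
      then show "norm (a n) \<le> 4 / (cmod s)\<^sup>2 * m n" using a0[of n] by (simp add: mult.commute)
    qed
    then have "a j \<le> suminf a" for j using sum_le_suminf[of a "{j}"] a0 by (auto simp: less_imp_le)
    moreover have "0 < suminf a" using \<open>summable a\<close> a0 by (intro suminf_pos)
    ultimately show ?thesis using that[of "suminf a"] True i by (simp add: a_def)
  next
    case False
    have "(\<lambda>j. Re s * a j / Re s) sums (Im (twist m s) / Re s)" by (rule sums_divide[OF S'])
    then have A: "a sums (Im (twist m s) / Re s)" using False by simp
    then have sa: "summable a" "suminf a = Im (twist m s) / Re s" by (auto simp: sums_iff)
    have "a j \<le> suminf a" for j using sum_le_suminf[OF sa(1), of "{j}"] a0 by (auto simp: less_imp_le)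
    moreover have "0 < suminf a" using sa(1) a0 by (intro suminf_pos)
    ultimately show ?thesis using that[of "suminf a"] False sa(2) by (simp add: a_def)
  qed
qed

lemma cos_sin_small:
  fixes t :: real
  assumes "\<bar>t\<bar> \<le> 1 / 4"
  shows "1 / 2 \<le> cos t" "t\<^sup>2 / 2 \<le> t * sin t"
proof -
  have c: "1 / 2 \<le> cos x" if "\<bar>x\<bar> \<le> 1 / 4" for x :: real
  proof -
    have "cos (pi / 3) \<le> cos \<bar>x\<bar>" using that pi_gt3 by (intro cos_monotone_0_pi_le) auto
    then show ?thesis by (simp add: cos_60)
  qed
  show "1 / 2 \<le> cos t" using c assms .
  have pos: "x / 2 \<le> sin x" if "0 \<le> x" "x \<le> 1 / 4" for x :: real
  proof -
    have "sin 0 - 0 / 2 \<le> sin x - x / 2"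
    proof (rule DERIV_nonneg_imp_nondecreasing[OF that(1)])
      fix y assume "0 \<le> y" "y \<le> x"
      then show "\<exists>z. ((\<lambda>a. sin a - a / 2) has_real_derivative z) (at y) \<and> 0 \<le> z"
        using c[of y] that by (intro exI[of _ "cos y - 1 / 2"] conjI) (auto intro!: derivative_eq_intros)
    qed
    then show ?thesis by simp
  qed
  show "t\<^sup>2 / 2 \<le> t * sin t"
  proof (cases "0 \<le> t")
    case True
    then show ?thesis using mult_left_mono[OF pos[of t] True] assms by (simp add: power2_eq_square)
  next
    case False
    then show ?thesis using mult_left_mono[OF pos[of "-t"], of "-t"] assms by (simp add: power2_eq_square)
  qed
qed

text \<open>After division by the positive factor \<open>exp (Re (twist m s))\<close>, the sign of \<open>Im (s * exp (twist m s))\<close> is decided by two terms: the first is the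
height of \<open>s\<close>, the second is never negative and is of order \<open>m j * \<bar>s\<bar>\<close> near the real axis.\<close>
lemma Im_twisted:
  assumes s: "s \<in> slit_sector"
  shows "Im (s * exp (twist m s)) = exp (Re (twist m s)) * (Im s * cos (Im (twist m s)) + Re s * sin (Im (twist m s)))"
    "1 / 2 \<le> cos (Im (twist m s))"
    "0 \<le> Re s * sin (Im (twist m s))"
    "Re s \<noteq> 0 \<Longrightarrow> 0 < Re s * sin (Im (twist m s))"
    "1 / 2 ^ Suc j < cmod s \<Longrightarrow> cmod s \<le> 1 / 2 ^ j \<Longrightarrow> \<bar>Im s\<bar> \<le> cmod s / 2 \<Longrightarrow>
       cmod s * m j / 64 \<le> Re s * sin (Im (twist m s))"
    "1 / 2 \<le> exp (Re (twist m s))" "exp (Re (twist m s)) \<le> 2" "cmod (s * exp (twist m s)) = cmod s * exp (Re (twist m s))"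
proof -
  let ?I = "Im (twist m s)"
  obtain K where K: "?I = Re s * K" "\<And>j. m j / 2 ^ j / (cmod (s + \<i> * of_real (1 / 2 ^ j)))\<^sup>2 \<le> K" "0 < K"
    using Im_twist[OF s] by blast
  have I: "\<bar>?I\<bar> \<le> 1 / 4" using abs_Im_le_cmod[of "twist m s"] norm_twist[OF s] by linarith
  show "Im (s * exp (twist m s)) = exp (Re (twist m s)) * (Im s * cos ?I + Re s * sin ?I)"
    by (simp add: Im_exp Re_exp algebra_simps)
  show "1 / 2 \<le> cos ?I" by (rule cos_sin_small[OF I])
  have low: "(Re s)\<^sup>2 * K / 2 \<le> Re s * sin ?I"
  proof -
    have "?I\<^sup>2 / 2 \<le> ?I * sin ?I" by (rule cos_sin_small[OF I])
    then have "K * ((Re s)\<^sup>2 * K / 2) \<le> K * (Re s * sin ?I)" unfolding K(1) by (simp add: power2_eq_square mult_ac)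
    then show ?thesis using K(3) by simp
  qed
  then show "0 \<le> Re s * sin ?I" using K(3) by (smt (verit) divide_nonneg_pos mult_nonneg_nonneg zero_le_power2)
  show "0 < Re s * sin ?I" if "Re s \<noteq> 0"
  proof -
    have "0 < (Re s)\<^sup>2 * K / 2" using that K(3) by simp
    then show ?thesis using low by linarith
  qed
  show "cmod s * m j / 64 \<le> Re s * sin ?I" if j: "1 / 2 ^ Suc j < cmod s" "cmod s \<le> 1 / 2 ^ j" and y: "\<bar>Im s\<bar> \<le> cmod s / 2"
  proof -
    define t where "t = 1 / (2::real) ^ j"
    have t: "t > 0" "t / 2 < cmod s" "cmod s \<le> t" using j by (auto simp: t_def)
    have "(Im s)\<^sup>2 \<le> (cmod s / 2)\<^sup>2" using y by (metis abs_ge_zero power2_abs power_mono)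
    then have "(Im s)\<^sup>2 \<le> (cmod s)\<^sup>2 / 4" by (simp add: power_divide)
    then have x: "(cmod s)\<^sup>2 / 2 \<le> (Re s)\<^sup>2" using cmod_power2[of s] zero_le_power2[of "Re s"] by linarith
    have "cmod (s + \<i> * of_real t) \<le> 2 * t" using norm_triangle_ineq[of s "\<i> * of_real t"] t by (simp add: norm_mult)
    then have "(cmod (s + \<i> * of_real t))\<^sup>2 \<le> (2 * t)\<^sup>2" by (intro power_mono) auto
    moreover have "s + \<i> * of_real t \<noteq> 0" by (rule slit_sector_bound[OF s t(1)])
    ultimately have "m j * t / (2 * t)\<^sup>2 \<le> m j * t / (cmod (s + \<i> * of_real t))\<^sup>2"
      using m_pos[of j] t by (intro divide_left_mono) auto
    also have "\<dots> \<le> K" using K(2)[of j] by (simp add: t_def)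
    finally have Kl: "m j / (4 * t) \<le> K" using t by (simp add: power2_eq_square)
    have "cmod s * m j / 64 \<le> cmod s * m j * (2 * cmod s / t) / 64"
    proof -
      have "1 \<le> 2 * cmod s / t" using t by simp
      then have "cmod s * m j * 1 \<le> cmod s * m j * (2 * cmod s / t)" using m_pos[of j] by (intro mult_left_mono) auto
      then show ?thesis by (simp add: mult_ac)
    qed
    also have "\<dots> \<le> ((cmod s)\<^sup>2 / 2) * (m j / (4 * t)) / 2"
      using t m_pos[of j] by (simp add: power2_eq_square field_simps)
    also have "\<dots> \<le> (Re s)\<^sup>2 * K / 2"
      using x Kl t m_pos[of j] by (intro divide_right_mono mult_mono) auto
    finally show ?thesis using low by simp
  qed
  have R: "\<bar>Re (twist m s)\<bar> \<le> 1 / 4" using abs_Re_le_cmod[of "twist m s"] norm_twist[OF s] by linarith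
  show "1 / 2 \<le> exp (Re (twist m s))" using exp_ge_add_one_self[of "Re (twist m s)"] R by linarith
  have "1 / 2 \<le> exp (- Re (twist m s))" using exp_ge_add_one_self[of "- Re (twist m s)"] R by linarith
  then show "exp (Re (twist m s)) \<le> 2" by (simp add: exp_minus field_simps)
  show "cmod (s * exp (twist m s)) = cmod s * exp (Re (twist m s))" by (simp add: norm_mult)
qed

end

text \<open>One side of a Dini-smooth curve near \<open>p\<close>, in a coordinate \<open>q\<close> with \<open>z = p + u * q\<close>: above a curve tangent to the real axis whose slope at
scale \<open>1 / 2^j\<close> is \<open>w j\<close>. Summability of \<open>w\<close> is the Dini condition; dyadic scales replace the integral. The
factor \<open>u\<close> absorbs rotation and scaling, so that the unit disc can be used.\<close>
definition contains_dini_sector :: "complex set \<Rightarrow> complex \<Rightarrow> bool" where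
  "contains_dini_sector W p \<longleftrightarrow> (\<exists>u w. u \<noteq> 0 \<and> summable w \<and> (\<forall>j. 0 \<le> w j) \<and>
     (\<forall>j q. 1 / 2 ^ Suc j < cmod q \<and> cmod q \<le> 1 / 2 ^ j \<and> w j * cmod q < Im q \<longrightarrow> p + u * q \<in> W))"

text \<open>Passing to the scales from \<open>k\<close> on makes the tail of \<open>w\<close> and the factor \<open>u\<close> small.\<close>
lemma dini_sector_shrink:
  assumes "contains_dini_sector W p" and "0 < \<delta>" "0 < r"
  obtains u w where "u \<noteq> 0" "cmod u < r" "summable w" "suminf w \<le> \<delta>" "\<And>j::nat. 0 \<le> w j"
    "\<And>j q. 1 / 2 ^ Suc j < cmod q \<Longrightarrow> cmod q \<le> 1 / 2 ^ j \<Longrightarrow> w j * cmod q < Im q \<Longrightarrow> p + u * q \<in> W"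
proof -
  obtain u w where u: "u \<noteq> 0" and w: "summable w" "\<And>j::nat. 0 \<le> w j"
    and W: "\<And>j q. 1 / 2 ^ Suc j < cmod q \<Longrightarrow> cmod q \<le> 1 / 2 ^ j \<Longrightarrow> w j * cmod q < Im q \<Longrightarrow> p + u * q \<in> W"
    using assms(1) unfolding contains_dini_sector_def by blast
  obtain N where N: "\<And>n. n \<ge> N \<Longrightarrow> norm (\<Sum>i. w (i + n)) < \<delta>" using suminf_exist_split[OF assms(2) w(1)] by blast
  obtain M where M: "cmod u / r < 2 ^ M" using real_arch_pow[of 2 "cmod u / r"] by auto
  define k where "k = max N M"
  have "(2::real) ^ M \<le> 2 ^ k" by (simp add: k_def)
  then have "r * 2 ^ M \<le> r * 2 ^ k" using assms(3) by (intro mult_left_mono) auto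
  moreover have "cmod u < r * 2 ^ M" using M assms(3) by (simp add: divide_less_eq mult.commute)
  ultimately have k: "cmod u / 2 ^ k < r" by (simp add: divide_less_eq)
  show ?thesis
  proof (rule that[of "u / 2 ^ k" "\<lambda>j. w (j + k)"])
    show "u / 2 ^ k \<noteq> 0" using u by simp
    show "cmod (u / 2 ^ k) < r" using k by (simp add: norm_divide norm_power)
    show "summable (\<lambda>j. w (j + k))" using w(1) by (subst summable_iff_shift)
    show "(\<Sum>j. w (j + k)) \<le> \<delta>" using N[of k] by (simp add: k_def abs_less_iff)
    show "0 \<le> w (j + k)" for j by (rule w)
    fix j q assume q: "1 / 2 ^ Suc j < cmod q" "cmod q \<le> 1 / 2 ^ j" "w (j + k) * cmod q < Im q"
    have "p + u * (q / 2 ^ k) \<in> W"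
    proof (rule W[of "j + k"])
      have c: "cmod (q / 2 ^ k) = cmod q / 2 ^ k" by (simp add: norm_divide norm_power)
      have "1 / 2 ^ Suc j / 2 ^ k < cmod q / 2 ^ k" using q(1) by (rule divide_strict_right_mono) simp
      then show "1 / 2 ^ Suc (j + k) < cmod (q / 2 ^ k)" unfolding c by (simp add: power_add)
      have "cmod q / 2 ^ k \<le> 1 / 2 ^ j / 2 ^ k" using q(2) by (rule divide_right_mono) simp
      then show "cmod (q / 2 ^ k) \<le> 1 / 2 ^ (j + k)" unfolding c by (simp add: power_add)
      have "q / 2 ^ k = q / of_real (2 ^ k)" by simp
      then have i: "Im (q / 2 ^ k) = Im q / 2 ^ k" by (simp only: Im_divide_of_real)
      have "w (j + k) * cmod q / 2 ^ k < Im q / 2 ^ k" using q(3) by (rule divide_strict_right_mono) simp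
      then show "w (j + k) * cmod (q / 2 ^ k) < Im (q / 2 ^ k)" unfolding c i by simp
    qed
    then show "p + u / 2 ^ k * q \<in> W" by simp
  qed
qed

text \<open>The maps below change the modulus of a point by at most a factor \<open>2\<close>, hence by at most one dyadic scale; the weights
therefore have to dominate \<open>w\<close> at the two neighbouring scales as well. For \<open>j = 0\<close> the term \<open>w (j - 1)\<close> is \<open>w 0\<close>, which does no harm. The
geometric sequence makes the weights strictly positive.\<close>
definition spread :: "real \<Rightarrow> (nat \<Rightarrow> real) \<Rightarrow> nat \<Rightarrow> real" where
  "spread K w j = K * (w (j - 1) + w j + w (j + 1)) + (1 / 64) * (1 / 2) ^ j"

lemma twist_weights_spread:
  assumes w: "summable w" "\<And>j. 0 \<le> w j" "4 * K * suminf w \<le> 1 / 16" and K: "0 < K"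
  shows "twist_weights (spread K w)"
proof
  have s0: "summable (\<lambda>j. w (j + 1))" using w(1) by (subst summable_iff_shift)
  have s1: "summable (\<lambda>j. w (j - 1))"
    by (subst summable_iff_shift[symmetric, of _ 1]) (use w(1) in simp)
  have g: "summable (\<lambda>j. (1 / 64) * (1 / 2 :: real) ^ j)" by (intro summable_mult summable_geometric) simp
  have gs: "(\<Sum>j. (1 / 64) * (1 / 2 :: real) ^ j) = 1 / 32"
  proof -
    have "(\<lambda>j. (1 / 2 :: real) ^ j) sums 2" using geometric_sums[of "1 / 2 :: real"] by simp
    then have "(1 / 64) * 2 = (\<Sum>j. (1 / 64) * (1 / 2 :: real) ^ j)" by (rule sums_unique[OF sums_mult])
    moreover have "(1 / 64) * 2 = (1 / 32 :: real)" by simp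
    ultimately show ?thesis by (rule trans[OF sym])
  qed
  show "0 < spread K w j" for j
    using w(2)[of j] w(2)[of "j - 1"] w(2)[of "j + 1"] K unfolding spread_def by (intro add_nonneg_pos mult_nonneg_nonneg) auto
  have sm: "summable (\<lambda>j. K * (w (j - 1) + w j + w (j + 1)))" by (intro summable_mult summable_add s0 s1 w(1))
  show "summable (spread K w)" unfolding spread_def by (intro summable_add sm g)
  have le: "w n \<le> suminf w" for n using sum_le_suminf[OF w(1), of "{n}"] w(2) by auto
  have e0: "(\<Sum>j. w (j + 1)) \<le> suminf w" using suminf_split_head[OF w(1)] w(2)[of 0] by simp
  have e1: "(\<Sum>j. w (j - 1)) \<le> 2 * suminf w"
    using suminf_split_head[OF s1] le[of 0] by simp
  have "suminf (spread K w) = (\<Sum>j. K * (w (j - 1) + w j + w (j + 1))) + 1 / 32"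
    unfolding spread_def by (simp only: suminf_add[OF sm g, symmetric] gs)
  also have "(\<Sum>j. K * (w (j - 1) + w j + w (j + 1))) = K * (\<Sum>j. w (j - 1) + w j + w (j + 1))"
    by (rule suminf_mult[OF summable_add[OF summable_add[OF s1 w(1)] s0]])
  also have "(\<Sum>j. w (j - 1) + w j + w (j + 1)) = (\<Sum>j. w (j - 1)) + suminf w + (\<Sum>j. w (j + 1))"
    by (simp only: suminf_add[OF summable_add[OF s1 w(1)] s0, symmetric] suminf_add[OF s1 w(1), symmetric])
  also have "K * ((\<Sum>j. w (j - 1)) + suminf w + (\<Sum>j. w (j + 1))) \<le> K * (4 * suminf w)"
    using e0 e1 K by (intro mult_left_mono) linarith+
  finally show "suminf (spread K w) \<le> 1 / 8" using w(3) by simp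
qed

lemma spread_ge:
  assumes "\<And>j. 0 \<le> w j" "0 < K" "i = j \<or> i = Suc j \<or> j = Suc i"
  shows "K * w i < spread K w j"
proof -
  have "w i \<le> w (j - 1) + w j + w (j + 1)"
    using assms(3) assms(1)[of "j - 1"] assms(1)[of j] assms(1)[of "j + 1"] by auto
  then have "K * w i \<le> K * (w (j - 1) + w j + w (j + 1))" using assms(2) by simp
  then show ?thesis unfolding spread_def by (smt (verit) zero_less_power divide_pos_pos mult_pos_pos)
qed

lemma dyadic_index:
  fixes r :: real
  assumes "0 < r" "r \<le> 1"
  obtains j where "1 / 2 ^ Suc j < r" "r \<le> 1 / 2 ^ j"
proof -
  have "\<exists>n. (1 / 2) ^ n < r" by (rule real_arch_pow_inv) (use assms in auto)
  then have ex: "\<exists>n. 1 / 2 ^ n < r" by (simp add: power_one_over)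
  define n where "n = (LEAST n. 1 / 2 ^ n < r)"
  have n: "1 / 2 ^ n < r" unfolding n_def by (rule LeastI_ex[OF ex])
  have "n \<noteq> 0" using n assms by (intro notI) simp
  then obtain j where j: "n = Suc j" using not0_implies_Suc by blast
  have "\<not> 1 / 2 ^ j < r" using not_less_Least[of j "\<lambda>n. 1 / 2 ^ n < r"] j unfolding n_def by simp
  then show ?thesis using that[of j] n j by simp
qed

lemma dyadic_index_near:
  fixes r r' :: real
  assumes "1 / 2 ^ Suc i < r" "r \<le> 1 / 2 ^ i" "1 / 2 ^ Suc j < r'" "r' \<le> 1 / 2 ^ j" "r \<le> 2 * r'" "r' \<le> 2 * r"
  shows "i = j \<or> i = Suc j \<or> j = Suc i"
proof -
  have a: "i \<le> Suc j" if "1 / 2 ^ Suc j < r'" "r \<le> 1 / 2 ^ i" "r' \<le> 2 * r" for i j and r r' :: real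
  proof (rule ccontr)
    assume "\<not> i \<le> Suc j"
    then have "(2::real) ^ Suc (Suc j) \<le> 2 ^ i" by (intro power_increasing) auto
    then have "1 / 2 ^ i \<le> 1 / (2::real) ^ Suc (Suc j)" by (intro divide_left_mono) auto
    then have "2 * r \<le> 1 / 2 ^ Suc j" using that(2) by simp
    then show False using that by linarith
  qed
  show ?thesis using a[OF assms(3,2,6)] a[OF assms(1,4,5)] by auto
qed

text \<open>The map is \<open>q = s * exp (twist m s)\<close> for \<open>s\<close> in a small disc that touches the real axis at \<open>0\<close> from above. Points high above the
axis need no correction; near the axis the twist lifts them above slope \<open>w\<close>.\<close>
lemma inner_dini_map:
  assumes "contains_dini_sector W p" "0 < r"
  obtains g C where "g holomorphic_on ball 0 1" "g ` ball 0 1 \<subseteq> W \<inter> ball p r"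
    "\<And>z. z \<in> ball 0 1 \<Longrightarrow> cmod (g z - p) \<le> C * cmod (1 - z)"
proof -
  obtain u w where u: "u \<noteq> 0" "cmod u < r" and w: "summable w" "suminf w \<le> 1 / 4096" "\<And>j::nat. 0 \<le> w j"
    and W: "\<And>j q. 1 / 2 ^ Suc j < cmod q \<Longrightarrow> cmod q \<le> 1 / 2 ^ j \<Longrightarrow> w j * cmod q < Im q \<Longrightarrow> p + u * q \<in> W"
    using dini_sector_shrink[OF assms(1) _ assms(2), of "1 / 4096"] by auto
  define m where "m = spread 64 w"
  interpret twist_weights m unfolding m_def by (rule twist_weights_spread) (use w in auto)
  have wle: "w n \<le> 1 / 4096" for n using sum_le_suminf[OF w(1), of "{n}"] w(2,3) by fastforce
  \<comment> \<open>this disc has diameter \<open>1/4\<close>, so that \<open>q\<close> stays in the unit disc\<close>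
  define s where "s = (\<lambda>z. \<i> / 8 * (1 - z) :: complex)"
  define q where "q = (\<lambda>z. s z * exp (twist m (s z)))"
  have s: "0 < Im (s z)" "cmod (s z) = cmod (1 - z) / 8" "s z \<in> slit_sector" "s z \<noteq> 0" "cmod (s z) \<le> 1 / 4" if "z \<in> ball 0 1" for z
  proof -
    have "Im (s z) = (1 - Re z) / 8" by (simp add: s_def)
    then show i: "0 < Im (s z)" using that complex_Re_le_cmod[of z] by simp
    show n: "cmod (s z) = cmod (1 - z) / 8" by (simp add: s_def norm_mult)
    have c: "0 \<le> cmod (s z)" by simp
    show "s z \<in> slit_sector" unfolding slit_sector_def mem_Collect_eq using i c by linarith
    show "s z \<noteq> 0" using i by auto
    show "cmod (s z) \<le> 1 / 4" using norm_triangle_ineq4[of 1 z] that unfolding n by simp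
  qed
  have qW: "p + u * q z \<in> W" "cmod (q z) \<le> 2 * cmod (s z)" if z: "z \<in> ball 0 1" for z
  proof -
    let ?s = "s z" and ?e = "exp (Re (twist m (s z)))"
    note S = s[OF z]
    note T = Im_twisted[OF S(3)]
    have cq: "cmod (q z) = cmod ?s * ?e" unfolding q_def by (rule T(8))
    have "cmod ?s * ?e \<le> cmod ?s * 2" by (rule mult_left_mono[OF T(7)]) simp
    then show c2: "cmod (q z) \<le> 2 * cmod ?s" unfolding cq by simp
    have "cmod ?s * (1 / 2) \<le> cmod ?s * ?e" by (rule mult_left_mono[OF T(6)]) simp
    then have c1: "cmod ?s \<le> 2 * cmod (q z)" unfolding cq by simp
    have sp: "0 < cmod ?s" using S(4) by simp
    obtain j where j: "1 / 2 ^ Suc j < cmod ?s" "cmod ?s \<le> 1 / 2 ^ j"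
      by (rule dyadic_index[of "cmod ?s"]) (use sp S(5) in auto)
    obtain i where i: "1 / 2 ^ Suc i < cmod (q z)" "cmod (q z) \<le> 1 / 2 ^ i"
      by (rule dyadic_index[of "cmod (q z)"]) (use sp c1 c2 S(5) in auto)
    have ij: "i = j \<or> i = Suc j \<or> j = Suc i" by (rule dyadic_index_near[OF i j c2 c1])
    have "w i * cmod ?s < Im ?s * cos (Im (twist m ?s)) + Re ?s * sin (Im (twist m ?s))"
    proof (cases "cmod ?s / 2 \<le> Im ?s")
      case True
      have "w i * cmod ?s \<le> 1 / 4096 * cmod ?s" using wle[of i] by (intro mult_right_mono) auto
      also have "\<dots> < cmod ?s / 2 * (1 / 2)" using sp by simp
      also have "\<dots> \<le> Im ?s * cos (Im (twist m ?s))" by (rule mult_mono[OF True T(2)]) (use S(1) in auto)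
      finally show ?thesis using T(3) by linarith
    next
      case False
      have "64 * w i < m j" unfolding m_def by (rule spread_ge[OF w(3) _ ij]) simp
      then have "w i * cmod ?s < m j / 64 * cmod ?s" using sp by (intro mult_strict_right_mono) auto
      also have "\<dots> \<le> Re ?s * sin (Im (twist m ?s))" using T(5)[OF j] False S(1) by (simp add: mult.commute)
      also have "\<dots> \<le> Im ?s * cos (Im (twist m ?s)) + Re ?s * sin (Im (twist m ?s))"
        using T(2) S(1) by (simp add: mult_nonneg_nonneg)
      finally show ?thesis .
    qed
    then have "?e * (w i * cmod ?s) < ?e * (Im ?s * cos (Im (twist m ?s)) + Re ?s * sin (Im (twist m ?s)))"
      by (rule mult_strict_left_mono) simp
    then have "w i * cmod (q z) < Im (q z)" unfolding cq using T(1) by (simp add: q_def mult_ac)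
    then show "p + u * q z \<in> W" by (rule W[OF i])
  qed
  show ?thesis
  proof
    have sh: "s holomorphic_on ball 0 1" unfolding s_def by (intro holomorphic_intros)
    have "twist m \<circ> s holomorphic_on ball 0 1"
      by (rule holomorphic_on_compose[OF sh holomorphic_on_subset[OF holomorphic_twist]]) (use s(3) in blast)
    then show "(\<lambda>z. p + u * q z) holomorphic_on ball 0 1" unfolding q_def o_def by (intro holomorphic_intros sh)
    have n: "cmod (u * q z) \<le> cmod u * cmod (1 - z)" if z: "z \<in> ball 0 1" for z
    proof -
      have "cmod (q z) \<le> cmod (1 - z)" using qW(2)[OF z] s(2)[OF z] norm_ge_zero[of "1 - z"] by linarith
      then show ?thesis unfolding norm_mult by (rule mult_left_mono) simp
    qed
    show "cmod (p + u * q z - p) \<le> cmod u * cmod (1 - z)" if "z \<in> ball 0 1" for z using n[OF that] by simp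
    show "(\<lambda>z. p + u * q z) ` ball 0 1 \<subseteq> W \<inter> ball p r"
    proof (intro image_subsetI IntI)
      fix z :: complex assume z: "z \<in> ball 0 1"
      show "p + u * q z \<in> W" by (rule qW(1)[OF z])
      have "cmod (q z) \<le> 1" using qW(2)[OF z] s(5)[OF z] by linarith
      then have "cmod (u * q z) \<le> cmod u * 1" unfolding norm_mult by (rule mult_left_mono) simp
      then show "p + u * q z \<in> ball p r" using u(2) by (simp add: dist_norm)
    qed
  qed
qed

text \<open>Here the sector of \<open>W\<close> lies below the real axis. The Moebius map \<open>q \<mapsto> q / (1 - \<i> * q)\<close> has derivative \<open>1\<close> at \<open>0\<close>
and sends the complement of the disc \<open>\<bar>q + \<i> / 2\<bar> \<le> 1 / 2\<close> to the upper half-plane. The part of this disc outside the sector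
is a thin set near \<open>0\<close>, where the twist compensates for the negative imaginary part. So \<open>B s = - \<i> * s * exp (twist m s)\<close> has
positive real part on the whole image of the complement of \<open>W\<close> without \<open>p\<close>, not only near \<open>0\<close>, and \<open>(1 - B) / (1 + B)\<close> is the desired map. The
point \<open>\<i>\<close> belongs to \<open>X\<close> because it is the image of infinity.\<close>
lemma outer_dini_map:
  assumes "contains_dini_sector W p"
  obtains u h X where "u \<noteq> 0" "h holomorphic_on X" "\<i> \<in> X"
    "\<And>s. s \<in> X \<Longrightarrow> cmod (h s) < 1" "\<And>s. s \<in> X \<Longrightarrow> 1 - cmod (h s) \<le> 4 * cmod s"
    "\<And>q. q \<noteq> 0 \<Longrightarrow> p + u * q \<notin> W \<Longrightarrow> 1 - \<i> * q \<noteq> 0 \<and> q / (1 - \<i> * q) \<in> X"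
proof -
  obtain u w where u: "u \<noteq> 0" and w: "summable w" "suminf w \<le> 1 / 8192" "\<And>j::nat. 0 \<le> w j"
    and W: "\<And>j q. 1 / 2 ^ Suc j < cmod q \<Longrightarrow> cmod q \<le> 1 / 2 ^ j \<Longrightarrow> w j * cmod q < Im q \<Longrightarrow> p + u * q \<in> W"
    by (rule dini_sector_shrink[OF assms, of "1 / 8192" 1]) auto
  define m where "m = spread 128 w"
  interpret twist_weights m unfolding m_def by (rule twist_weights_spread) (use w in auto)
  have wle: "w n \<le> 1 / 8192" for n using sum_le_suminf[OF w(1), of "{n}"] w(2,3) by fastforce
  define X where "X = {s \<in> slit_sector. 0 < Im (s * exp (twist m s))}"
  define B where "B = (\<lambda>s. - \<i> * (s * exp (twist m s)))"
  define h where "h = (\<lambda>s. (1 - B s) / (1 + B s))"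
  have ReB: "0 < Re (B s)" if "s \<in> X" for s using that by (simp add: B_def X_def)
  have B1: "1 \<le> cmod (1 + B s)" if "s \<in> X" for s using ReB[OF that] complex_Re_le_cmod[of "1 + B s"] by simp
  have B0: "1 + B s \<noteq> 0" if "s \<in> X" for s using B1[OF that] by auto
  have upper: "s \<in> X" if "0 \<le> Im s" "s \<noteq> 0" for s
  proof -
    have "0 < cmod s" using that by simp
    then have ss: "s \<in> slit_sector" unfolding slit_sector_def mem_Collect_eq using that(1) by linarith
    note T = Im_twisted[OF ss]
    have "0 < Im s * cos (Im (twist m s)) + Re s * sin (Im (twist m s))"
    proof (cases "Re s = 0")
      case True
      then have "Im s > 0" using that by (auto simp: complex_eq_iff)
      then show ?thesis using T(2,3) by (intro add_pos_nonneg mult_pos_pos) auto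
    next
      case False
      then show ?thesis using T(2) T(4)[OF False] that(1) by (intro add_nonneg_pos mult_nonneg_nonneg) auto
    qed
    then show ?thesis unfolding X_def using ss T(1) by simp
  qed
  have main: "1 - \<i> * q \<noteq> 0 \<and> q / (1 - \<i> * q) \<in> X" if q: "q \<noteq> 0" "p + u * (- q) \<notin> W" for q
  proof -
    have nW: "- w i * cmod q \<le> Im q" if "1 / 2 ^ Suc i < cmod q" "cmod q \<le> 1 / 2 ^ i" for i
    proof (rule ccontr)
      assume "\<not> ?thesis"
      then have "w i * cmod (- q) < Im (- q)" by simp
      then have "p + u * (- q) \<in> W" using that by (intro W[of i]) auto
      then show False using q(2) by contradiction
    qed
    have nz: "1 - \<i> * q \<noteq> 0"
    proof
      assume "1 - \<i> * q = 0"
      then have "q = - \<i>" by (metis add.inverse_inverse complex_i_mult_minus eq_iff_diff_eq_0 mult.commute mult_minus_right mult.right_neutral)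
      then have "- w 0 \<le> - 1" using nW[of 0] by simp
      then show False using wle[of 0] by simp
    qed
    define s where "s = q / (1 - \<i> * q)"
    have s0: "s \<noteq> 0" using q(1) nz by (simp add: s_def)
    have Ims: "Im s = (Im q + (cmod q)\<^sup>2) / (cmod (1 - \<i> * q))\<^sup>2"
    proof -
      have "s = q * cnj (1 - \<i> * q) / of_real ((cmod (1 - \<i> * q))\<^sup>2)"
        unfolding s_def by (subst complex_div_cnj) simp
      moreover have "Im (q * cnj (1 - \<i> * q)) = Im q + (cmod q)\<^sup>2"
        unfolding cmod_power2 by (simp add: power2_eq_square algebra_simps)
      ultimately show ?thesis by (simp only: Im_divide_of_real)
    qed
    have "s \<in> X"
    proof (cases "0 \<le> Im s")
      case True
      then show ?thesis by (rule upper[OF _ s0])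
    next
      case False
      have "Im q + (cmod q)\<^sup>2 < 0"
      proof (rule ccontr)
        assume "\<not> ?thesis"
        then have "0 \<le> Im s" unfolding Ims by (intro divide_nonneg_nonneg) auto
        then show False using False by simp
      qed
      then have neg: "(cmod q)\<^sup>2 < - Im q" by simp
      have qp: "0 < cmod q" using q(1) by simp
      have "cmod q * cmod q < cmod q * 1"
        using neg abs_Im_le_cmod[of q] by (simp add: power2_eq_square)
      then have "cmod q < 1" using qp by simp
      then obtain i where i: "1 / 2 ^ Suc i < cmod q" "cmod q \<le> 1 / 2 ^ i"
        using dyadic_index[of "cmod q"] qp by auto
      have "cmod q * cmod q < w i * cmod q" using neg nW[OF i] by (simp add: power2_eq_square)
      then have qw: "cmod q < w i" using qp by simp
      then have q4: "cmod q \<le> 1 / 8" using wle[of i] by simp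
      have d1: "1 / 2 \<le> cmod (1 - \<i> * q)" using norm_triangle_ineq2[of 1 "\<i> * q"] q4 by (simp add: norm_mult)
      have d2: "cmod (1 - \<i> * q) \<le> 2" using norm_triangle_ineq4[of 1 "\<i> * q"] q4 by (simp add: norm_mult)
      have ns: "cmod s = cmod q / cmod (1 - \<i> * q)" by (simp add: s_def norm_divide)
      have dp: "0 < cmod (1 - \<i> * q)" using d1 by linarith
      have sq: "cmod s \<le> 2 * cmod q"
      proof -
        have "cmod q * 1 \<le> cmod q * (2 * cmod (1 - \<i> * q))" by (rule mult_left_mono) (use d1 in auto)
        then show ?thesis unfolding ns using dp by (simp add: divide_le_eq mult_ac)
      qed
      have qs: "cmod q \<le> 2 * cmod s"
      proof -
        have "cmod q * cmod (1 - \<i> * q) \<le> cmod q * 2" by (rule mult_left_mono[OF d2]) simp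
        then show ?thesis unfolding ns using dp by (simp add: le_divide_eq mult_ac)
      qed
      have sp: "0 < cmod s" using s0 by simp
      obtain j where j: "1 / 2 ^ Suc j < cmod s" "cmod s \<le> 1 / 2 ^ j"
        by (rule dyadic_index[of "cmod s"]) (use sp sq q4 in auto)
      have ij: "i = j \<or> i = Suc j \<or> j = Suc i" by (rule dyadic_index_near[OF i j qs sq])
      have Ims2: "- (2 * w i * cmod s) \<le> Im s"
      proof -
        have "- w i * cmod q \<le> Im q + (cmod q)\<^sup>2" using nW[OF i] zero_le_power2[of "cmod q"] by linarith
        then have "- w i * cmod q / (cmod (1 - \<i> * q))\<^sup>2 \<le> Im s" unfolding Ims by (rule divide_right_mono) simp
        moreover have "- w i * cmod q / (cmod (1 - \<i> * q))\<^sup>2 = - (w i * cmod s * (1 / cmod (1 - \<i> * q)))"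
          unfolding ns by (simp add: power2_eq_square)
        moreover have "w i * cmod s * (1 / cmod (1 - \<i> * q)) \<le> w i * cmod s * 2"
          using d1 dp w(3)[of i] by (intro mult_left_mono mult_nonneg_nonneg) (auto simp: divide_le_eq)
        ultimately show ?thesis by linarith
      qed
      have wi: "2 * w i * cmod s \<le> 1 / 4 * cmod s" using wle[of i] by (intro mult_right_mono) auto
      have ss: "s \<in> slit_sector" unfolding slit_sector_def mem_Collect_eq using Ims2 wi sp by linarith
      note T = Im_twisted[OF ss]
      have y: "\<bar>Im s\<bar> \<le> cmod s / 2" using Ims2 wi sp False by linarith
      have "128 * w i < m j" unfolding m_def by (rule spread_ge[OF w(3) _ ij]) simp
      then have "2 * w i * cmod s < m j / 64 * cmod s" using sp by (intro mult_strict_right_mono) auto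
      also have "\<dots> \<le> Re s * sin (Im (twist m s))" using T(5)[OF j y] by (simp add: mult.commute)
      finally have r: "2 * w i * cmod s < Re s * sin (Im (twist m s))" .
      have "Im s * 1 \<le> Im s * cos (Im (twist m s))"
        by (rule mult_left_mono_neg) (use False in auto)
      then have "0 < Im s * cos (Im (twist m s)) + Re s * sin (Im (twist m s))" using r Ims2 by linarith
      then show ?thesis unfolding X_def using ss T(1) by simp
    qed
    then show ?thesis using nz by (simp add: s_def)
  qed
  show ?thesis
  proof (rule that[of "- u" h X])
    show "- u \<noteq> 0" using u by simp
    have "twist m holomorphic_on X" by (rule holomorphic_on_subset[OF holomorphic_twist]) (auto simp: X_def)
    then have "B holomorphic_on X" unfolding B_def by (intro holomorphic_intros)
    then show "h holomorphic_on X" unfolding h_def using B0 by (intro holomorphic_intros) auto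
    show "\<i> \<in> X" by (rule upper) auto
    show "cmod (h s) < 1" if "s \<in> X" for s
    proof -
      have "(cmod (1 - B s))\<^sup>2 < (cmod (1 + B s))\<^sup>2"
        unfolding cmod_power2 using ReB[OF that] by (simp add: power2_eq_square algebra_simps)
      then have "cmod (1 - B s) < cmod (1 + B s)" by (rule power_less_imp_less_base) simp
      then show ?thesis using B0[OF that] by (simp add: h_def norm_divide)
    qed
    show "1 - cmod (h s) \<le> 4 * cmod s" if s: "s \<in> X" for s
    proof -
      have ss: "s \<in> slit_sector" using s by (simp add: X_def)
      have "cmod s * exp (Re (twist m s)) \<le> cmod s * 2" by (rule mult_left_mono[OF Im_twisted(7)[OF ss]]) simp
      then have Bs: "cmod (B s) \<le> 2 * cmod s" using Im_twisted(8)[OF ss] by (simp add: B_def norm_mult)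
      have "1 - h s = 2 * B s / (1 + B s)" using B0[OF s] by (simp add: h_def field_simps)
      then have "cmod (1 - h s) = 2 * cmod (B s) / cmod (1 + B s)" by (simp add: norm_divide norm_mult)
      also have "\<dots> \<le> 2 * cmod (B s) / 1" by (rule divide_left_mono[OF B1[OF s]]) (use B1[OF s] in auto)
      finally have "cmod (1 - h s) \<le> 4 * cmod s" using Bs by simp
      then show ?thesis using norm_triangle_ineq2[of 1 "1 - h s"] norm_triangle_ineq2[of 1 "h s"] by simp
    qed
    show "1 - \<i> * q \<noteq> 0 \<and> q / (1 - \<i> * q) \<in> X" if "q \<noteq> 0" "p + - u * q \<notin> W" for q
      using main[of q] that by simp
  qed
qed

section \<open>Dini-smooth curves near one of their points\<close>

lemma modulus_of_continuity_mono: "x \<le> y \<Longrightarrow> modulus_of_continuity g x \<le> modulus_of_continuity g y"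
  unfolding modulus_of_continuity_def by (rule SUP_subset_mono) auto

lemma modulus_of_continuity_ge:
  "\<bar>s - t\<bar> \<le> x \<Longrightarrow> ennreal (cmod (g s - g t)) \<le> modulus_of_continuity g x"
  unfolding modulus_of_continuity_def by (rule SUP_upper2[of "(s, t)"]) auto

text \<open>On \<open>(1 / 2^(j+1), 1 / 2^j]\<close> the integrand is at least \<open>2^j\<close> times the modulus at \<open>1 / 2^(j+1)\<close>, and this interval has length
\<open>1 / 2^(j+1)\<close>.\<close>
lemma dini_continuous_dyadic:
  assumes "dini_continuous g"
  obtains w :: "nat \<Rightarrow> real" where "summable w" "\<And>j. 0 \<le> w j"
    "\<And>j s t. \<bar>s - t\<bar> \<le> 1 / 2 ^ Suc j \<Longrightarrow> cmod (g s - g t) \<le> w j"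
proof -
  define \<mu> where "\<mu> = modulus_of_continuity g"
  define A where "A j = {1 / 2 ^ Suc j <.. 1 / (2::real) ^ j}" for j :: nat
  define c where "c j = \<mu> (1 / 2 ^ Suc j) * ennreal (2 ^ j)" for j
  have "(\<Sum>j. c j * indicator (A j) x) \<le> \<mu> x / ennreal x * indicator {0<..1} x" for x
  proof (cases "0 < x \<and> x \<le> 1")
    case True
    then obtain j where j: "1 / 2 ^ Suc j < x" "x \<le> 1 / 2 ^ j" using dyadic_index by blast
    have "c i * indicator (A i) x = 0" if "i \<noteq> j" for i
    proof -
      have "x \<notin> A i"
      proof
        assume i: "x \<in> A i"
        have l: "False" if "i < j" "1 / 2 ^ Suc i < x" "x \<le> 1 / 2 ^ j" for i j
        proof -
          have "(2::real) ^ Suc i \<le> 2 ^ j" using that(1) by (intro power_increasing) auto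
          then have "1 / 2 ^ j \<le> 1 / (2::real) ^ Suc i" by (intro divide_left_mono) auto
          then show False using that by linarith
        qed
        show False using that l[of i j] l[of j i] i j by (cases i j rule: linorder_cases) (auto simp: A_def)
      qed
      then show ?thesis by simp
    qed
    then have "(\<Sum>i. c i * indicator (A i) x) = (\<Sum>i\<in>{j}. c i * indicator (A i) x)"
      by (intro suminf_finite) auto
    also have "\<dots> = c j" using j by (simp add: A_def)
    also have "\<dots> \<le> \<mu> x * ennreal (inverse x)" unfolding c_def
    proof (rule mult_mono)
      show "\<mu> (1 / 2 ^ Suc j) \<le> \<mu> x" unfolding \<mu>_def using j by (intro modulus_of_continuity_mono) simp
      have "2 ^ j \<le> inverse x" using j True by (simp add: field_simps)
      then show "ennreal (2 ^ j) \<le> ennreal (inverse x)" by (rule ennreal_leI)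
    qed auto
    also have "\<dots> = \<mu> x / ennreal x * indicator {0<..1} x"
      using True by (simp add: divide_ennreal_def inverse_ennreal)
    finally show ?thesis .
  next
    case False
    have "A i \<subseteq> {0<..1}" for i
    proof -
      have "1 / (2::real) ^ i \<le> 1" by simp
      moreover have "0 < 1 / (2::real) ^ Suc i" by simp
      ultimately show ?thesis unfolding A_def by (intro subsetI) (simp only: greaterThanAtMost_iff, linarith)
    qed
    then have "x \<notin> A i" for i using False by (meson greaterThanAtMost_iff subsetD)
    then show ?thesis by simp
  qed
  then have "(\<integral>\<^sup>+x. (\<Sum>j. c j * indicator (A j) x) \<partial>lborel) \<le> (\<integral>\<^sup>+x\<in>{0<..1}. \<mu> x / ennreal x \<partial>lborel)"
    by (intro nn_integral_mono) auto
  also have "\<dots> < \<infinity>" using assms by (simp add: dini_continuous_def \<mu>_def)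
  finally have fin: "(\<integral>\<^sup>+x. (\<Sum>j. c j * indicator (A j) x) \<partial>lborel) < \<infinity>" .
  have "(\<integral>\<^sup>+x. (\<Sum>j. c j * indicator (A j) x) \<partial>lborel) = (\<Sum>j. c j * emeasure lborel (A j))"
    by (subst nn_integral_suminf) (auto simp: A_def nn_integral_cmult_indicator)
  also have "\<dots> = (\<Sum>j. \<mu> (1 / 2 ^ Suc j) * ennreal (1 / 2))"
  proof (rule suminf_cong)
    fix j
    have "1 / 2 ^ j - 1 / 2 ^ Suc j = 1 / (2::real) ^ Suc j" by simp
    moreover have "1 / 2 ^ Suc j \<le> 1 / (2::real) ^ j" by (intro divide_left_mono) auto
    ultimately have "emeasure lborel (A j) = ennreal (1 / 2 ^ Suc j)" unfolding A_def
      by (simp only: emeasure_lborel_Ioc)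
    then have "c j * emeasure lborel (A j) = \<mu> (1 / 2 ^ Suc j) * (ennreal (2 ^ j) * ennreal (1 / 2 ^ Suc j))"
      by (simp add: c_def mult.assoc)
    also have "ennreal (2 ^ j) * ennreal (1 / 2 ^ Suc j) = ennreal (1 / 2)"
      by (subst ennreal_mult'[symmetric]) (auto simp: field_simps)
    finally show "c j * emeasure lborel (A j) = \<mu> (1 / 2 ^ Suc j) * ennreal (1 / 2)" .
  qed
  finally have S: "(\<Sum>j. \<mu> (1 / 2 ^ Suc j) * ennreal (1 / 2)) < \<infinity>" using fin by simp
  define w where "w j = enn2real (\<mu> (1 / 2 ^ Suc j))" for j
  have prodfin: "\<mu> (1 / 2 ^ Suc j) * ennreal (1 / 2) < \<infinity>" for j
  proof -
    have "f j \<le> suminf f" for f :: "nat \<Rightarrow> ennreal"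
      using sum_le_suminf[OF summableI, of "{j}" f] by simp
    from this[of "\<lambda>j. \<mu> (1 / 2 ^ Suc j) * ennreal (1 / 2)"] S show ?thesis by (rule le_less_trans)
  qed
  have muf: "\<mu> (1 / 2 ^ Suc j) < \<infinity>" for j 
  proof -
    have "\<mu> (1 / 2 ^ Suc j) * ennreal (1 / 2) \<noteq> top" using prodfin[of j] by simp
    then have "\<mu> (1 / 2 ^ Suc j) \<noteq> top" by (auto simp: ennreal_top_mult)
    then show ?thesis by (simp add: less_top)
  qed
  have mw: "\<mu> (1 / 2 ^ Suc j) = ennreal (w j)" for j using muf[of j] by (simp add: w_def)
  have w0: "0 \<le> w j" for j by (simp add: w_def)
  have "summable (\<lambda>j. w j * (1 / 2))"
  proof (rule summable_suminf_not_top)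
    show "(\<Sum>j. ennreal (w j * (1 / 2))) \<noteq> top" 
      using S unfolding mw ennreal_mult'[OF w0, symmetric] infinity_ennreal_def less_top .
  qed (simp add: w0)
  from summable_mult2[OF this, of 2] have "summable w" by simp
  moreover have "cmod (g s - g t) \<le> w j" if "\<bar>s - t\<bar> \<le> 1 / 2 ^ Suc j" for j s t
    using modulus_of_continuity_ge[OF that, of g] mw[of j] w0[of j] by (simp add: \<mu>_def)
  ultimately show ?thesis using w0 that by blast
qed

lemma dini_smooth_plane_simple_path:
  assumes "bij_betw h (sphere 0 1) C" "\<And>\<theta>. ((\<lambda>\<theta>. h (cis \<theta>)) has_vector_derivative g \<theta>) (at \<theta>)"
  shows "simple_path (\<lambda>x. h (cis (2 * pi * x)))" "pathfinish (\<lambda>x. h (cis (2 * pi * x))) = pathstart (\<lambda>x. h (cis (2 * pi * x)))"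
    "path_image (\<lambda>x. h (cis (2 * pi * x))) = C"
proof -
  have inj: "inj_on h (sphere 0 1)" and im: "h ` sphere 0 1 = C" using assms(1) by (auto simp: bij_betw_def)
  have cont: "continuous_on UNIV (\<lambda>\<theta>. h (cis \<theta>))"
    using assms(2) by (intro continuous_at_imp_continuous_on ballI has_vector_derivative_continuous)
  have path: "path (\<lambda>x. h (cis (2 * pi * x)))" unfolding path_def
    by (rule continuous_on_compose2[OF cont]) (auto intro!: continuous_intros)
  have ci: "cis (2 * pi * x) = cis (2 * pi * y) \<Longrightarrow> x = y \<or> x = 0 \<and> y = 1 \<or> x = 1 \<and> y = 0"
    if xy: "0 \<le> x" "x \<le> 1" "0 \<le> y" "y \<le> 1" for x y
  proof -
    assume "cis (2 * pi * x) = cis (2 * pi * y)"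
    then have "sin (2 * pi * x) = sin (2 * pi * y) \<and> cos (2 * pi * x) = cos (2 * pi * y)"
      by (simp add: complex_eq_iff)
    then obtain n :: int where "2 * pi * x = 2 * pi * y + 2 * pi * n" unfolding sin_cos_eq_iff by blast
    then have "2 * pi * (x - y - n) = 0" by (simp add: algebra_simps)
    then have n: "x = y + n" by simp
    then have "\<bar>real_of_int n\<bar> \<le> 1" using xy by linarith
    then have "n = 0 \<or> n = 1 \<or> n = -1" by linarith
    then show ?thesis using n xy by auto
  qed
  show "simple_path (\<lambda>x. h (cis (2 * pi * x)))" unfolding simple_path_def loop_free_def
  proof (intro conjI path ballI impI)
    fix x y :: real assume xy: "x \<in> {0..1}" "y \<in> {0..1}" "h (cis (2 * pi * x)) = h (cis (2 * pi * y))"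
    have "cis (2 * pi * x) = cis (2 * pi * y)" by (rule inj_onD[OF inj xy(3)]) auto
    then show "x = y \<or> x = 0 \<and> y = 1 \<or> x = 1 \<and> y = 0" using ci xy by auto
  qed
  show "pathfinish (\<lambda>x. h (cis (2 * pi * x))) = pathstart (\<lambda>x. h (cis (2 * pi * x)))"
    by (simp add: pathfinish_def pathstart_def)
  show "path_image (\<lambda>x. h (cis (2 * pi * x))) = C"
  proof -
    have "(\<lambda>x. cis (2 * pi * x)) ` {0..1} = sphere 0 1"
    proof (intro antisym subsetI)
      fix z :: complex assume "z \<in> sphere 0 1"
      then have z: "z = cis (Arg2pi z)" using Arg2pi_eq[of z] by (simp add: cis_conv_exp)
      show "z \<in> (\<lambda>x. cis (2 * pi * x)) ` {0..1}"
        by (rule image_eqI[of _ _ "Arg2pi z / (2 * pi)"]) (use z Arg2pi_ge_0[of z] Arg2pi_lt_2pi[of z] in auto)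
    qed auto
    then show ?thesis unfolding path_image_def im[symmetric] by (metis image_image)
  qed
qed

text \<open>Used to move from one point of \<open>W\<close> to the sector along connected sets that avoid the curve.\<close>
lemma Jordan_component:
  fixes c :: "real \<Rightarrow> complex"
  assumes W: "W = inside C \<or> W = outside C" and X: "connected X" "X \<inter> C = {}" "X \<inter> W \<noteq> {}"
    and C: "simple_path c" "pathfinish c = pathstart c" "path_image c = C"
  shows "X \<subseteq> W"
proof -
  have J: "open (inside C)" "open (outside C)" "inside C \<inter> outside C = {}" "inside C \<union> outside C = - C"
    using Jordan_inside_outside[OF C(1,2)] unfolding C(3) by auto
  have "X \<subseteq> inside C \<union> outside C" using X(2) J(4) by blast
  moreover have "inside C \<inter> outside C \<inter> X = {}" using J(3) by blast
  ultimately have "inside C \<inter> X = {} \<or> outside C \<inter> X = {}"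
    using connectedD[OF X(1) J(1,2)] by blast
  then show ?thesis using W X(3) \<open>X \<subseteq> inside C \<union> outside C\<close> by blast
qed

text \<open>In a small box the curve is the graph of a function over its tangent. A point of \<open>W\<close> in the box lies on one side of the graph, given by the
sign \<open>\<sigma>\<close>. Vertical segments \<open>V\<close> lead from points on that side to the rectangle \<open>R\<close> far from the graph, without meeting the curve; so the
whole side belongs to \<open>W\<close>. The hypothesis on \<open>Im (H x)\<close> bounds the slope of the graph at each dyadic scale.\<close>
lemma dini_sector_of_graph:
  fixes H :: "real \<Rightarrow> complex"
  assumes a: "a \<noteq> 0" and \<delta>: "0 < \<delta>" and H: "continuous_on {-\<delta>..\<delta>} H"
    and mono: "\<And>x y. -\<delta> \<le> x \<Longrightarrow> x < y \<Longrightarrow> y \<le> \<delta> \<Longrightarrow> Re (H x) < Re (H y)"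
    and Re: "\<And>x. \<bar>x\<bar> \<le> \<delta> \<Longrightarrow> \<bar>Re (H x) - x\<bar> \<le> \<bar>x\<bar> / 4"
    and Im: "\<And>x. \<bar>x\<bar> \<le> \<delta> \<Longrightarrow> \<bar>Im (H x)\<bar> \<le> \<bar>x\<bar> / 4"
    and Im_dini: "\<And>j x. J \<le> j \<Longrightarrow> \<bar>x\<bar> \<le> 1 / 2 ^ Suc j \<Longrightarrow> \<bar>Im (H x)\<bar> \<le> \<bar>x\<bar> * w j"
    and w: "summable w" "\<And>j::nat. 0 \<le> w j"
    and near: "0 < r" "\<And>y. cmod y < r \<Longrightarrow> p + a * y \<in> C \<Longrightarrow> \<exists>x. \<bar>x\<bar> \<le> \<delta> \<and> y = H x"
    and comp: "\<And>X. connected X \<Longrightarrow> X \<inter> C = {} \<Longrightarrow> X \<inter> W \<noteq> {} \<Longrightarrow> X \<subseteq> W"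
    and W: "W \<inter> C = {}" "p \<in> closure W" and onC: "\<And>x. \<bar>x\<bar> \<le> \<delta> \<Longrightarrow> p + a * H x \<in> C"
  shows "contains_dini_sector W p"
proof -
  \<comment> \<open>points of the box have modulus below \<open>2 * \<epsilon>\<close>, hence below \<open>r\<close>, and parameters below \<open>\<delta>\<close>\<close>
  define \<epsilon> where "\<epsilon> = min (\<delta> / 2) (r / 2)"
  have e: "0 < \<epsilon>" "\<epsilon> \<le> \<delta> / 2" "2 * \<epsilon> \<le> r" using \<delta> near(1) by (auto simp: \<epsilon>_def)
  define L where "L y = p + a * y" for y
  have graph: "\<exists>t. \<bar>t\<bar> \<le> \<delta> \<and> Re (H t) = x \<and> \<bar>t\<bar> \<le> 4 / 3 * \<bar>x\<bar>" if x: "\<bar>x\<bar> < \<epsilon>" for x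
  proof -
    have "continuous_on {-\<delta>..\<delta>} (\<lambda>t. Re (H t))" by (intro continuous_intros H)
    moreover have "Re (H (-\<delta>)) \<le> x" "x \<le> Re (H \<delta>)" 
    proof -
      have "\<bar>Re (H \<delta>) - \<delta>\<bar> \<le> \<delta> / 4" "\<bar>Re (H (- \<delta>)) + \<delta>\<bar> \<le> \<delta> / 4" using Re[of \<delta>] Re[of "-\<delta>"] \<delta> by auto
      then show "Re (H (-\<delta>)) \<le> x" "x \<le> Re (H \<delta>)" using x e unfolding abs_le_iff abs_less_iff by linarith+
    qed
    ultimately obtain t where t: "-\<delta> \<le> t" "t \<le> \<delta>" "Re (H t) = x"
      using IVT'[of "\<lambda>t. Re (H t)" "-\<delta>" x \<delta>] \<delta> by auto
    then have "\<bar>x - t\<bar> \<le> \<bar>t\<bar> / 4" using Re[of t] by auto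
    then have "\<bar>t\<bar> \<le> 4 / 3 * \<bar>x\<bar>" by linarith
    then show ?thesis using t by (intro exI[of _ t]) auto
  qed
  have uniq: "Im y = Im (H t)" if y: "\<bar>Re y\<bar> < \<epsilon>" "\<bar>Im y\<bar> < \<epsilon>" "L y \<in> C" and t: "\<bar>t\<bar> \<le> \<delta>" "Re (H t) = Re y" for y t
  proof -
    have "cmod y < r" using cmod_le[of y] y e by linarith
    then obtain x where x: "\<bar>x\<bar> \<le> \<delta>" "y = H x" using near(2) y(3) by (auto simp: L_def)
    have "Re (H t) = Re (H x)" using t(2) x(2) by simp
    moreover have "Re (H t) < Re (H x)" if "t < x" using that x(1) t(1) by (intro mono) linarith+
    moreover have "Re (H x) < Re (H t)" if "x < t" using that x(1) t(1) by (intro mono) linarith+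
    ultimately have "x = t" by (metis less_irrefl linorder_neqE_linordered_idom)
    then show ?thesis using x by simp
  qed
  define V where "V \<sigma> x t = L ` {y. Re y = x \<and> \<sigma> * Im (H t) < \<sigma> * Im y \<and> \<sigma> * Im y < \<epsilon>}" for \<sigma> x t :: real
  define R where "R \<sigma> = L ` {y. \<bar>Re y\<bar> < \<epsilon> \<and> \<epsilon> / 2 < \<sigma> * Im y \<and> \<sigma> * Im y < \<epsilon>}" for \<sigma> :: real
  have Lconn: "connected (L ` S)" if "convex S" for S
    unfolding L_def using that by (intro connected_continuous_image convex_connected continuous_intros)
  have cV: "connected (V \<sigma> x t)" for \<sigma> x t
  proof -
    have "convex {y. Re y = x \<and> \<sigma> * Im (H t) < \<sigma> * Im y \<and> \<sigma> * Im y < \<epsilon>}"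
    proof -
      have "{y. Re y = x \<and> \<sigma> * Im (H t) < \<sigma> * Im y \<and> \<sigma> * Im y < \<epsilon>} =
          {y. 1 \<bullet> y = x} \<inter> {y. (of_real \<sigma> * \<i>) \<bullet> y > \<sigma> * Im (H t)} \<inter> {y. (of_real \<sigma> * \<i>) \<bullet> y < \<epsilon>}"
        by (auto simp: inner_complex_def)
      then show ?thesis by (simp only:) (intro convex_Int convex_hyperplane convex_halfspace_lt convex_halfspace_gt)
    qed
    then show ?thesis unfolding V_def by (rule Lconn)
  qed
  have cR: "connected (R \<sigma>)" for \<sigma>
  proof -
    have "convex {y. \<bar>Re y\<bar> < \<epsilon> \<and> \<epsilon> / 2 < \<sigma> * Im y \<and> \<sigma> * Im y < \<epsilon>}"
    proof -
      have "{y. \<bar>Re y\<bar> < \<epsilon> \<and> \<epsilon> / 2 < \<sigma> * Im y \<and> \<sigma> * Im y < \<epsilon>} =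
          {y. 1 \<bullet> y < \<epsilon>} \<inter> {y. 1 \<bullet> y > - \<epsilon>} \<inter> {y. (of_real \<sigma> * \<i>) \<bullet> y > \<epsilon> / 2} \<inter> {y. (of_real \<sigma> * \<i>) \<bullet> y < \<epsilon>}"
        by (auto simp: inner_complex_def abs_less_iff)
      then show ?thesis by (simp only:) (intro convex_Int convex_halfspace_lt convex_halfspace_gt)
    qed
    then show ?thesis unfolding R_def by (rule Lconn)
  qed
  have small: "\<bar>Im (H t)\<bar> < \<epsilon> / 2" if "\<bar>t\<bar> \<le> \<delta>" "\<bar>Re (H t)\<bar> < \<epsilon>" for t
  proof -
    have "\<bar>Re (H t) - t\<bar> \<le> \<bar>t\<bar> / 4" "\<bar>Im (H t)\<bar> \<le> \<bar>t\<bar> / 4" using Re Im that by auto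
    then show ?thesis using that by linarith
  qed
  have dV: "V \<sigma> x t \<inter> C = {}" if s: "\<sigma> = 1 \<or> \<sigma> = -1" and t: "\<bar>x\<bar> < \<epsilon>" "\<bar>t\<bar> \<le> \<delta>" "Re (H t) = x" for \<sigma> x t
  proof -
    have "L y \<notin> C" if y: "Re y = x" "\<sigma> * Im (H t) < \<sigma> * Im y" "\<sigma> * Im y < \<epsilon>" for y
    proof
      assume "L y \<in> C"
      moreover have "\<bar>Im y\<bar> < \<epsilon>" using s small[OF t(2)] t y by (auto simp: abs_less_iff)
      ultimately have "Im y = Im (H t)" using uniq[of y t] t y by auto
      then show False using y by simp
    qed
    then show ?thesis unfolding V_def by blast
  qed
  have dR: "R \<sigma> \<inter> C = {}" if s: "\<sigma> = 1 \<or> \<sigma> = -1" for \<sigma>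
  proof -
    have "L y \<notin> C" if y: "\<bar>Re y\<bar> < \<epsilon>" "\<epsilon> / 2 < \<sigma> * Im y" "\<sigma> * Im y < \<epsilon>" for y
    proof
      assume "L y \<in> C"
      moreover obtain t where t: "\<bar>t\<bar> \<le> \<delta>" "Re (H t) = Re y" using graph[OF y(1)] by blast
      moreover have "\<bar>Im y\<bar> < \<epsilon>" using s y e by (auto simp: abs_less_iff)
      ultimately have "Im y = Im (H t)" using uniq[of y t] y by auto
      then show False using small[OF t(1)] t y s by auto
    qed
    then show ?thesis unfolding R_def by blast
  qed
  have meet: "V \<sigma> x t \<inter> R \<sigma> \<noteq> {}" if s: "\<sigma> = 1 \<or> \<sigma> = -1" and t: "\<bar>x\<bar> < \<epsilon>" "\<bar>t\<bar> \<le> \<delta>" "Re (H t) = x" for \<sigma> x t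
  proof -
    have "\<sigma> * \<sigma> = 1" using s by auto
    then have "\<sigma> * Im (Complex x (\<sigma> * (3 / 4 * \<epsilon>))) = 3 / 4 * \<epsilon>" by (simp add: mult.assoc[symmetric])
    then obtain y where y: "Re y = x" "\<sigma> * Im y = 3 / 4 * \<epsilon>" by (metis complex.sel(1))
    have "\<sigma> * Im (H t) < \<epsilon> / 2" using s small[OF t(2)] t by auto
    then have "L y \<in> V \<sigma> x t" unfolding V_def by (intro imageI CollectI conjI) (use y e in linarith)+
    moreover have "L y \<in> R \<sigma>" unfolding R_def by (intro imageI CollectI conjI) (use y e t in linarith)+
    ultimately show ?thesis by blast
  qed
  obtain y0 where y0: "L y0 \<in> W" "cmod y0 < \<epsilon>"
  proof -
    have "0 < \<epsilon> * cmod a" using e a by simp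
    then obtain q where q: "q \<in> W" "dist q p < \<epsilon> * cmod a" using W(2) closure_approachable by blast
    show ?thesis
    proof (rule that)
      show "L ((q - p) / a) \<in> W" using q a by (simp add: L_def)
      show "cmod ((q - p) / a) < \<epsilon>" using q a by (simp add: norm_divide dist_norm divide_less_eq)
    qed
  qed
  have y0e: "\<bar>Re y0\<bar> < \<epsilon>" "\<bar>Im y0\<bar> < \<epsilon>" using abs_Re_le_cmod[of y0] abs_Im_le_cmod[of y0] y0(2) by auto
  obtain t0 where t0: "\<bar>t0\<bar> \<le> \<delta>" "Re (H t0) = Re y0" using graph[OF y0e(1)] by blast
  have "Im y0 \<noteq> Im (H t0)"
  proof
    assume "Im y0 = Im (H t0)"
    then have "y0 = H t0" using t0 by (simp add: complex_eq_iff)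
    then show False using onC[OF t0(1)] y0(1) W(1) by (auto simp: L_def)
  qed
  then obtain \<sigma> :: real where s: "\<sigma> = 1 \<or> \<sigma> = -1" "\<sigma> * Im (H t0) < \<sigma> * Im y0"
    by (cases "Im y0 < Im (H t0)") (auto intro: that[of "-1"] that[of 1])
  have "L y0 \<in> V \<sigma> (Re y0) t0" unfolding V_def using s y0e by (intro imageI) auto
  then have "V \<sigma> (Re y0) t0 \<subseteq> W" using y0(1) by (intro comp cV dV s y0e(1) t0) blast
  then have "R \<sigma> \<inter> W \<noteq> {}" using meet[OF s(1) y0e(1) t0] by blast
  then have RW: "R \<sigma> \<subseteq> W" by (intro comp cR dR s)
  have VW: "L y \<in> W" if y: "cmod y < \<epsilon>" and t: "\<bar>t\<bar> \<le> \<delta>" "Re (H t) = Re y" "\<sigma> * Im (H t) < \<sigma> * Im y" for y t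
  proof -
    have ye: "\<bar>Re y\<bar> < \<epsilon>" "\<bar>Im y\<bar> < \<epsilon>" using abs_Re_le_cmod[of y] abs_Im_le_cmod[of y] y by auto
    have "V \<sigma> (Re y) t \<inter> W \<noteq> {}" using meet[OF s(1) ye(1) t(1,2)] RW by blast
    then have "V \<sigma> (Re y) t \<subseteq> W" by (intro comp cV dV s(1) ye(1) t(1,2))
    moreover have "L y \<in> V \<sigma> (Re y) t" unfolding V_def using s(1) ye t(3) by (intro imageI) auto
    ultimately show ?thesis by blast
  qed
  \<comment> \<open>the unit disc of \<open>q\<close> is scaled into the box; two scales are lost since \<open>\<bar>t\<bar> \<le> 2 * \<bar>y\<bar>\<close> and the bound for scale \<open>j\<close> concerns \<open>\<bar>t\<bar> \<le> 1 / 2^(j+1)\<close>\<close>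
  obtain M where "1 / \<epsilon> < 2 ^ M" using real_arch_pow[of 2 "1 / \<epsilon>"] by auto
  then have M: "1 / 2 ^ M < \<epsilon>" using e by (simp add: field_simps)
  define k where "k = J + 2 + M"
  have "1 / (2::real) ^ k \<le> 1 / 2 ^ M" by (intro divide_left_mono power_increasing) (auto simp: k_def)
  then have k: "1 / 2 ^ k < \<epsilon>" using M by linarith
  show ?thesis unfolding contains_dini_sector_def
  proof (intro exI conjI allI impI)
    let ?u = "of_real \<sigma> * a * of_real (1 / 2 ^ k)"
    show "?u \<noteq> 0" using a s(1) by auto
    have "summable (\<lambda>j. w (j + (k - 2)))" using w(1) by (subst summable_iff_shift)
    then show "summable (\<lambda>j. 2 * w (j + (k - 2)))" by (rule summable_mult)
    show "0 \<le> 2 * w (j + (k - 2))" for j using w(2) by simp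
    fix j q assume "1 / 2 ^ Suc j < cmod q \<and> cmod q \<le> 1 / 2 ^ j \<and> 2 * w (j + (k - 2)) * cmod q < Im q"
    then have q: "1 / 2 ^ Suc j < cmod q" "cmod q \<le> 1 / 2 ^ j" "2 * w (j + (k - 2)) * cmod q < Im q" by auto
    define y where "y = of_real (\<sigma> / 2 ^ k) * q"
    have ny: "cmod y = cmod q / 2 ^ k" using s(1) by (auto simp: y_def norm_mult norm_divide norm_power)
    have "1 / (2::real) ^ j \<le> 1" by simp
    then have "cmod q \<le> 1" using q(2) by linarith
    then have "cmod y \<le> 1 / 2 ^ k" unfolding ny by (intro divide_right_mono) auto
    then have ye: "cmod y < \<epsilon>" using k by simp
    then have "\<bar>Re y\<bar> < \<epsilon>" using abs_Re_le_cmod[of y] by simp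
    then obtain t where t: "\<bar>t\<bar> \<le> \<delta>" "Re (H t) = Re y" "\<bar>t\<bar> \<le> 4 / 3 * \<bar>Re y\<bar>" using graph by blast
    have t2: "\<bar>t\<bar> \<le> 2 * cmod y" using t(3) abs_Re_le_cmod[of y] by linarith
    have "2 * cmod y \<le> 1 / 2 ^ Suc (j + (k - 2))"
    proof -
      have "2 * cmod y \<le> 2 * (1 / 2 ^ j / 2 ^ k)" unfolding ny using q(2) by (intro mult_left_mono divide_right_mono) auto
      also have "\<dots> = 1 / 2 ^ Suc (j + (k - 2))"
      proof -
        have "j + k = Suc (Suc (j + (k - 2)))" by (simp add: k_def)
        then have "(2::real) ^ (j + k) = 2 * 2 ^ Suc (j + (k - 2))" by (simp only: power_Suc)
        then show ?thesis by (simp add: power_add[symmetric])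
      qed
      finally show ?thesis .
    qed
    then have "\<bar>Im (H t)\<bar> \<le> \<bar>t\<bar> * w (j + (k - 2))"
      using t2 by (intro Im_dini) (auto simp: k_def)
    also have "\<dots> \<le> 2 * cmod y * w (j + (k - 2))" using t2 w(2) by (intro mult_right_mono)
    also have "\<dots> = 2 * w (j + (k - 2)) * cmod q / 2 ^ k" by (simp add: ny)
    also have "\<dots> < Im q / 2 ^ k" using q(3) by (intro divide_strict_right_mono) auto
    also have "\<dots> = \<sigma> * Im y" using s(1) by (auto simp: y_def)
    finally have "\<sigma> * Im (H t) < \<sigma> * Im y" using s(1) by auto
    then have "L y \<in> W" by (rule VW[OF ye t(1,2)])
    moreover have "L y = p + ?u * q" by (simp add: L_def y_def)
    ultimately show "p + ?u * q \<in> W" by simp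
  qed
qed

text \<open>The parametrization is normalized by \<open>H 0 = 0\<close> and \<open>H' 0 = 1\<close>; integrating the modulus of continuity of \<open>H'\<close> gives
\<open>\<bar>H t - t\<bar> \<le> \<bar>t\<bar> * w j\<close> for \<open>\<bar>t\<bar> \<le> 1 / 2^(j+1)\<close>. Points of the curve close to \<open>p\<close> have small parameters because the
parametrization is injective on a compact circle. Both sides of the curve have \<open>p\<close> in their closure by the Jordan curve theorem.\<close>
lemma dini_curve_sector:
  assumes C: "dini_smooth_plane C" "p \<in> C" and W: "W = inside C \<or> W = outside C"
  shows "contains_dini_sector W p"
proof -
  obtain h g where h: "bij_betw h (sphere 0 1) C" and g: "\<And>\<theta>. ((\<lambda>\<theta>. h (cis \<theta>)) has_vector_derivative g \<theta>) (at \<theta>)"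
    and g0: "\<And>\<theta>. g \<theta> \<noteq> 0" and dc: "dini_continuous g"
    using C(1) unfolding dini_smooth_plane_def by blast
  note c = dini_smooth_plane_simple_path[OF h g]
  have inj: "inj_on h (sphere 0 1)" and im: "h ` sphere 0 1 = C" using h by (auto simp: bij_betw_def)
  have J: "frontier (inside C) = C" "frontier (outside C) = C" "inside C \<union> outside C = - C"
    using Jordan_inside_outside[OF c(1,2)] unfolding c(3) by auto
  have pcl: "p \<in> closure W" using W J(1,2) C(2) by (auto simp: frontier_def)
  have WC: "W \<inter> C = {}" using W J(3) by blast
  obtain w0 where w0: "summable w0" "\<And>j::nat. 0 \<le> w0 j"
    "\<And>j s t. \<bar>s - t\<bar> \<le> 1 / 2 ^ Suc j \<Longrightarrow> cmod (g s - g t) \<le> w0 j"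
    using dini_continuous_dyadic[OF dc] by metis
  obtain z0 where z0: "z0 \<in> sphere 0 1" "h z0 = p" using C(2) im by blast
  define \<theta>0 where "\<theta>0 = Arg2pi z0"
  have cis0: "cis \<theta>0 = z0" using Arg2pi_eq[of z0] z0(1) by (simp add: cis_conv_exp \<theta>0_def)
  define a where "a = g \<theta>0"
  have a0: "a \<noteq> 0" by (simp add: a_def g0)
  define H where "H t = (h (cis (\<theta>0 + t)) - p) / a" for t
  define G where "G t = g (\<theta>0 + t) / a" for t
  have Hder: "(H has_vector_derivative G t) (at t)" for t
  proof -
    have "((\<lambda>t. h (cis (\<theta>0 + t))) has_vector_derivative g (\<theta>0 + t)) (at t)"
    proof -
      have "((+) \<theta>0 has_vector_derivative 1) (at t)" by (auto intro!: derivative_eq_intros)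
      from vector_diff_chain_at[OF this g] show ?thesis by (simp add: o_def)
    qed
    then have "((\<lambda>t. (h (cis (\<theta>0 + t)) - p) * (1 / a)) has_vector_derivative g (\<theta>0 + t) * (1 / a)) (at t)"
      by (intro has_vector_derivative_mult_left) (auto intro!: derivative_eq_intros)
    then show ?thesis unfolding H_def G_def by (simp add: divide_inverse)
  qed
  have H0: "H 0 = 0" using cis0 z0 by (simp add: H_def)
  have Hh: "p + a * H t = h (cis (\<theta>0 + t))" for t using a0 by (simp add: H_def)
  define w where "w j = w0 j / cmod a" for j
  have w: "summable w" "\<And>j. 0 \<le> w j"
    using summable_divide[OF w0(1), of "cmod a"] w0(2) by (simp_all add: w_def[abs_def])
  have G1: "cmod (G t - 1) \<le> w j" if "\<bar>t\<bar> \<le> 1 / 2 ^ Suc j" for t j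
  proof -
    have "G t - 1 = (g (\<theta>0 + t) - g \<theta>0) / a" using a0 by (simp add: G_def a_def diff_divide_distrib)
    moreover have "cmod (g (\<theta>0 + t) - g \<theta>0) \<le> w0 j" using that by (intro w0(3)) simp
    ultimately show ?thesis by (simp add: w_def norm_divide divide_right_mono)
  qed
  have HG: "cmod (H t - of_real t) \<le> \<bar>t\<bar> * w j" if t: "\<bar>t\<bar> \<le> 1 / 2 ^ Suc j" for t j
  proof -
    define S where "S = closed_segment 0 t"
    have "norm ((H t - of_real t) - (H 0 - of_real 0)) \<le> w j * norm (t - 0)"
    proof (rule differentiable_bound[where S = S])
      show "convex S" "t \<in> S" "0 \<in> S" by (auto simp: S_def)
      fix x assume "x \<in> S"
      then have "\<bar>x\<bar> \<le> \<bar>t\<bar>" by (auto simp: S_def closed_segment_eq_real_ivl split: if_splits)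
      then have x: "\<bar>x\<bar> \<le> 1 / 2 ^ Suc j" using t by linarith
      have "((\<lambda>t. H t - of_real t) has_vector_derivative (G x - 1)) (at x)"
        by (intro has_vector_derivative_diff Hder) (auto intro!: derivative_eq_intros)
      then show "((\<lambda>t. H t - of_real t) has_derivative (\<lambda>h. h *\<^sub>R (G x - 1))) (at x within S)"
        unfolding has_vector_derivative_def by (rule has_derivative_at_withinI)
      show "onorm (\<lambda>h. h *\<^sub>R (G x - 1)) \<le> w j"
        by (rule onorm_le) (use G1[OF x] in \<open>simp add: mult.commute mult_left_mono\<close>)
    qed
    then show ?thesis using H0 by (simp add: mult.commute)
  qed
  have "w \<longlonglongrightarrow> 0" by (rule summable_LIMSEQ_zero[OF w(1)])
  then have "\<forall>\<^sub>F j in sequentially. w j < 1 / 4" by (rule order_tendstoD) simp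
  then obtain J where J4: "\<And>j. J \<le> j \<Longrightarrow> w j < 1 / 4" by (auto simp: eventually_sequentially)
  define \<delta> where "\<delta> = 1 / (2::real) ^ Suc J"
  have "(1::real) < 2 ^ Suc J" by (rule power_gt1) simp
  then have d: "0 < \<delta>" "\<delta> < 1" unfolding \<delta>_def by (simp_all only: divide_less_eq_1_pos zero_less_divide_1_iff zero_less_power zero_less_numeral)
  have Hd: "cmod (H x - of_real x) \<le> \<bar>x\<bar> / 4" if "\<bar>x\<bar> \<le> \<delta>" for x
  proof -
    have "\<bar>x\<bar> * w J \<le> \<bar>x\<bar> * (1 / 4)" using J4[of J] by (intro mult_left_mono) auto
    moreover have "cmod (H x - of_real x) \<le> \<bar>x\<bar> * w J" using that unfolding \<delta>_def by (rule HG)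
    ultimately show ?thesis by linarith
  qed
  \<comment> \<open>the part of the curve with parameters away from \<open>\<theta>0\<close>\<close>
  define K where "K = (\<lambda>t. h (cis (\<theta>0 + t))) ` {\<delta>..2 * pi - \<delta>}"
  have chc: "continuous_on S (\<lambda>t. h (cis (\<theta>0 + t)))" for S
  proof -
    have "continuous_on UNIV (\<lambda>\<theta>. h (cis \<theta>))"
      using g by (intro continuous_at_imp_continuous_on ballI has_vector_derivative_continuous)
    then show ?thesis by (rule continuous_on_compose2) (auto intro!: continuous_intros)
  qed
  have "compact K" unfolding K_def by (rule compact_continuous_image[OF chc compact_Icc])
  moreover have "p \<notin> K"
  proof
    assume "p \<in> K"
    then obtain t where t: "\<delta> \<le> t" "t \<le> 2 * pi - \<delta>" "h (cis (\<theta>0 + t)) = h (cis \<theta>0)" using z0 cis0 by (auto simp: K_def)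
    have "cis (\<theta>0 + t) = cis \<theta>0" by (rule inj_onD[OF inj t(3)]) auto
    then have "sin (\<theta>0 + t) = sin \<theta>0 \<and> cos (\<theta>0 + t) = cos \<theta>0" by (simp add: complex_eq_iff)
    then obtain n :: int where n: "\<theta>0 + t = \<theta>0 + 2 * pi * n" unfolding sin_cos_eq_iff by blast
    then have tn: "t = 2 * pi * n" by simp
    have "0 < t" "t < 2 * pi" using t d by auto
    then have "0 < 2 * pi * real_of_int n" "2 * pi * real_of_int n < 2 * pi * 1" unfolding tn by auto
    then have "0 < real_of_int n" "real_of_int n < 1" by (auto simp: zero_less_mult_iff)
    then have "0 < n" "n < 1" by simp_all
    then show False by simp
  qed
  ultimately have "\<exists>r0>0. \<forall>y\<in>K. r0 \<le> dist p y" by (intro separate_point_closed compact_imp_closed)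
  then obtain r0 where r0: "0 < r0" "\<And>y. y \<in> K \<Longrightarrow> r0 \<le> dist p y" by blast
  show ?thesis
  proof (rule dini_sector_of_graph[of a \<delta> H J w "r0 / cmod a" p C W])
    show "continuous_on {- \<delta>..\<delta>} H"
      using Hder by (intro continuous_at_imp_continuous_on ballI has_vector_derivative_continuous)
    show "Re (H x) < Re (H y)" if xy: "- \<delta> \<le> x" "x < y" "y \<le> \<delta>" for x y
    proof (rule DERIV_pos_imp_increasing[OF xy(2)])
      fix t assume t: "x \<le> t" "t \<le> y"
      have "((\<lambda>t. Re (H t)) has_real_derivative Re (G t)) (at t)"
        using bounded_linear.has_vector_derivative[OF bounded_linear_Re Hder[of t]]
        by (simp add: has_real_derivative_iff_has_vector_derivative)
      moreover have "\<bar>t\<bar> \<le> 1 / 2 ^ Suc J" using t xy unfolding \<delta>_def by linarith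
      then have "cmod (G t - 1) < 1 / 4" using G1[of t J] J4[of J] by simp
      then have "0 < Re (G t)" using abs_Re_le_cmod[of "G t - 1"] by simp
      ultimately show "\<exists>z. ((\<lambda>t. Re (H t)) has_real_derivative z) (at t) \<and> 0 < z" by blast
    qed
    show "\<bar>Re (H x) - x\<bar> \<le> \<bar>x\<bar> / 4" if "\<bar>x\<bar> \<le> \<delta>" for x
      using abs_Re_le_cmod[of "H x - of_real x"] Hd[OF that] by simp
    show "\<bar>Im (H x)\<bar> \<le> \<bar>x\<bar> / 4" if "\<bar>x\<bar> \<le> \<delta>" for x
      using abs_Im_le_cmod[of "H x - of_real x"] Hd[OF that] by simp
    show "\<bar>Im (H x)\<bar> \<le> \<bar>x\<bar> * w j" if "\<bar>x\<bar> \<le> 1 / 2 ^ Suc j" for j x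
      using abs_Im_le_cmod[of "H x - of_real x"] HG[OF that] by simp
    show "\<exists>x. \<bar>x\<bar> \<le> \<delta> \<and> y = H x" if y: "cmod y < r0 / cmod a" "p + a * y \<in> C" for y
    proof -
      have "p + a * y \<in> h ` sphere 0 1" unfolding im by (rule y(2))
      then obtain z where z: "z \<in> sphere 0 1" "h z = p + a * y" by (metis imageE)
      define s where "s = Arg2pi (z / z0)"
      have zz: "cmod (z / z0) = 1" using z(1) z0(1) by (simp add: norm_divide)
      then have "cis s = z / z0" using Arg2pi_eq[of "z / z0"] by (simp add: cis_conv_exp s_def)
      moreover have "z0 \<noteq> 0" using z0(1) by auto
      ultimately have cz: "cis (\<theta>0 + s) = z" unfolding cis_mult[symmetric] cis0 by simp
      have s: "0 \<le> s" "s < 2 * pi" using Arg2pi_ge_0 Arg2pi_lt_2pi by (auto simp: s_def)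
      have "dist p (h (cis (\<theta>0 + s))) < r0"
        using y(1) a0 unfolding cz z(2) by (simp add: dist_norm norm_mult less_divide_eq mult.commute)
      then have "h (cis (\<theta>0 + s)) \<notin> K" using r0(2) by force
      then have "\<not> (\<delta> \<le> s \<and> s \<le> 2 * pi - \<delta>)" by (auto simp: K_def)
      then consider "s < \<delta>" | "2 * pi - \<delta> < s" by linarith
      then show ?thesis
      proof cases
        case 1
        have "y = H s" using a0 cz z(2) by (simp add: H_def)
        then show ?thesis using 1 s by (intro exI[of _ s]) auto
      next
        case 2
        have "cis (\<theta>0 + (s - 2 * pi)) = cis (\<theta>0 + s)" unfolding add_diff_eq
          by (intro complex_eqI) (simp_all add: sin_diff cos_diff)
        then have "y = H (s - 2 * pi)" using a0 cz z(2) by (simp add: H_def)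
        then show ?thesis using 2 s by (intro exI[of _ "s - 2 * pi"]) auto
      qed
    qed
    show "X \<subseteq> W" if "connected X" "X \<inter> C = {}" "X \<inter> W \<noteq> {}" for X
      by (rule Jordan_component[OF W that c])
    show "p + a * H x \<in> C" for x unfolding Hh im[symmetric] by auto
  qed (use a0 d w r0 WC pcl in auto)
qed

section \<open>Curves on the sphere in Moebius charts\<close>

text \<open>Comparable to the chordal distance of \<open>z\<close> from \<open>p\<close>, but in the form of the modulus of an affine function of \<open>z\<close>
divided by \<open>1 + \<bar>z\<bar>\<close>, for which the effect of Moebius maps is easy to follow.\<close>
fun sphere_gap :: "complex option \<Rightarrow> complex \<Rightarrow> real" where
  "sphere_gap None z = 1 / (1 + cmod z)"
| "sphere_gap (Some a) z = cmod (z - a) / (1 + cmod z)"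

lemma sphere_gap_nonneg: "0 \<le> sphere_gap p z" 
  by (cases p) (auto intro!: divide_nonneg_nonneg add_nonneg_nonneg)

lemma sphere_gap_pos: "p \<noteq> Some z \<Longrightarrow> 0 < sphere_gap p z"
  by (cases p) (auto intro!: divide_pos_pos add_pos_nonneg)

lemma moebius_sphere_Some:
  assumes "moebius_sphere a b c d (Some z) = Some w"
  shows "c * z + d \<noteq> 0" "a * z + b = w * (c * z + d)"
  using assms by (auto simp: moebius_def split: if_splits)

lemma inj_moebius_sphere:
  assumes D: "a * d - b * c \<noteq> 0"
  shows "inj (moebius_sphere a b c d)"
proof (rule injI)
  fix x y assume e: "moebius_sphere a b c d x = moebius_sphere a b c d y"
  have ff: "z = z'" if "moebius_sphere a b c d (Some z) = moebius_sphere a b c d (Some z')" for z z'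
  proof (cases "c * z + d = 0")
    case True
    then have "c * z' + d = 0" using that by (auto split: if_splits)
    moreover have "c \<noteq> 0" using True D by auto
    ultimately show ?thesis using True by (metis add_right_cancel mult_left_cancel)
  next
    case False
    then have n: "c * z' + d \<noteq> 0" using that by (auto split: if_splits)
    then have "(a * z + b) * (c * z' + d) = (a * z' + b) * (c * z + d)"
      using that False by (simp add: moebius_def frac_eq_eq)
    then have "(a * d - b * c) * (z - z') = 0" by (simp add: algebra_simps)
    then show ?thesis using D by simp
  qed
  have nf: "False" if "moebius_sphere a b c d None = moebius_sphere a b c d (Some z)" for z
  proof (cases "c = 0")
    case True
    then have "d = 0" using that by (auto split: if_splits)
    then show False using True D by simp
  next
    case False
    then have m: "moebius_sphere a b c d (Some z) = Some (a / c)" using that by simp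
    have "c * (a * z + b) = c * (a / c * (c * z + d))" using moebius_sphere_Some(2)[OF m] by simp
    then have "c * b = a * d" using False by (simp add: algebra_simps)
    then show False using D by (simp add: mult.commute)
  qed
  show "x = y" using e ff nf by (cases x; cases y) (metis | simp)+
qed

text \<open>The numerator of \<open>T z - p'\<close> is an affine function of \<open>z\<close> that vanishes exactly at \<open>p\<close>, where infinity counts as the zero of a constant.\<close>
lemma sphere_gap_moebius:
  assumes D: "a * d - b * c \<noteq> 0" and p: "moebius_sphere a b c d p = Some p'"
  obtains l where "0 < l" "\<And>z. cmod (a * z + b - p' * (c * z + d)) = l * (sphere_gap p z * (1 + cmod z))"
proof (cases p)
  case None
  then have c: "c \<noteq> 0" "p' * c = a" using p by (auto split: if_splits)
  have e: "a * z + b - p' * (c * z + d) = b - p' * d" for z using c(2) by (simp add: algebra_simps)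
  have "c * (b - p' * d) = - (a * d - b * c)" using c(2) by (simp add: algebra_simps)
  then have "b - p' * d \<noteq> 0" using D by auto
  moreover have "sphere_gap p z * (1 + cmod z) = 1" for z 
  proof -
    have "1 + cmod z \<noteq> 0" by (metis add_pos_nonneg less_irrefl norm_ge_zero zero_less_one)
    then show ?thesis using None by simp
  qed
  ultimately show ?thesis using that[of "cmod (b - p' * d)"] e by simp
next
  case (Some p0)
  note m = moebius_sphere_Some[OF p[unfolded Some]]
  have e: "a * z + b - p' * (c * z + d) = (a - p' * c) * (z - p0)" for z
    using m(2) by (simp add: algebra_simps)
  have "(a - p' * c) * (c * p0 + d) = a * (c * p0 + d) - c * (p' * (c * p0 + d))" by (simp add: algebra_simps)
  also have "\<dots> = a * d - b * c" unfolding m(2)[symmetric] by (simp add: algebra_simps)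
  finally have "a - p' * c \<noteq> 0" using D by auto
  moreover have "sphere_gap p z * (1 + cmod z) = cmod (z - p0)" for z 
  proof -
    have "1 + cmod z \<noteq> 0" by (metis add_pos_nonneg less_irrefl norm_ge_zero zero_less_one)
    then show ?thesis using Some by simp
  qed
  ultimately show ?thesis using that[of "cmod (a - p' * c)"] e by (simp add: norm_mult)
qed

lemma dini_smooth_jordan_curve_chart:
  assumes "dini_smooth_jordan_curve C" "p \<in> C"
  obtains a b c d C' p' where "a * d - b * c \<noteq> 0" "dini_smooth_plane C'" "p' \<in> C'"
    "moebius_sphere a b c d p = Some p'"
    "\<And>z. Some z \<in> C \<longleftrightarrow> c * z + d \<noteq> 0 \<and> (a * z + b) / (c * z + d) \<in> C'"
proof -
  obtain T C' where T: "moebius_transformation T" "T ` C = Some ` C'" "dini_smooth_plane C'"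
    using assms(1) unfolding dini_smooth_jordan_curve_def by blast
  then obtain a b c d where D: "a * d - b * c \<noteq> 0" "T = moebius_sphere a b c d"
    unfolding moebius_transformation_def by blast
  have "T p \<in> Some ` C'" using assms(2) T(2) by blast
  then obtain p' where p': "p' \<in> C'" "T p = Some p'" by blast
  have inj: "inj T" using inj_moebius_sphere[OF D(1)] D(2) by simp
  have "Some z \<in> C \<longleftrightarrow> c * z + d \<noteq> 0 \<and> (a * z + b) / (c * z + d) \<in> C'" for z
  proof -
    have "Some z \<in> C \<longleftrightarrow> T (Some z) \<in> T ` C" by (simp add: inj inj_image_mem_iff)
    also have "\<dots> \<longleftrightarrow> c * z + d \<noteq> 0 \<and> (a * z + b) / (c * z + d) \<in> C'"
      unfolding T(2) by (auto simp: D(2) moebius_def)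
    finally show ?thesis .
  qed
  then show ?thesis using that D(1) T(3) p' D(2) by blast
qed

lemma plane_curve_sides:
  assumes "dini_smooth_plane C"
  shows "compact C" "open (inside C)" "open (outside C)" "connected (inside C)" "connected (outside C)"
    "inside C \<inter> outside C = {}" "inside C \<union> outside C = - C"
proof -
  obtain h g where h: "bij_betw h (sphere 0 1) C" and g: "\<And>\<theta>. ((\<lambda>\<theta>. h (cis \<theta>)) has_vector_derivative g \<theta>) (at \<theta>)"
    using assms unfolding dini_smooth_plane_def by blast
  note c = dini_smooth_plane_simple_path[OF h g]
  show "compact C" using compact_path_image[OF simple_path_imp_path[OF c(1)]] unfolding c(3) .
  show "open (inside C)" "open (outside C)" "connected (inside C)" "connected (outside C)"
    "inside C \<inter> outside C = {}" "inside C \<union> outside C = - C"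
    using Jordan_inside_outside[OF c(1,2)] unfolding c(3) by auto
qed

lemma connected_delete_affine_zero:
  fixes c d :: complex
  assumes "open S" "connected S" "c \<noteq> 0 \<or> d \<noteq> 0"
  shows "connected {z \<in> S. c * z + d \<noteq> 0}"
proof (cases "c = 0")
  case True
  then have "{z \<in> S. c * z + d \<noteq> 0} = S" using assms(3) by auto
  then show ?thesis using assms(2) by simp
next
  case False
  have "{z \<in> S. c * z + d \<noteq> 0} = S - {- d / c}" using False by (auto simp: field_simps add_eq_0_iff)
  then show ?thesis using connected_open_delete[OF assms(1,2)] by simp
qed

text \<open>In the chart \<open>T\<close> the component \<open>K\<close> contains one side \<open>W\<close> of the plane curve, except for the image of infinity. The inverse chart \<open>m\<close>
carries the map of the Dini sector into \<open>D\<close>. The radius \<open>r\<close> keeps that map away from the exceptional point.\<close>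
lemma inner_sphere_map:
  assumes C: "dini_smooth_jordan_curve C" "p \<in> C"
    and K: "K \<in> connected_components_of (subtopology riemann_sphere (- C))" "K \<subseteq> Some ` D"
  obtains g B where "g holomorphic_on ball 0 1" "g ` ball 0 1 \<subseteq> D"
    "\<And>z. z \<in> ball 0 1 \<Longrightarrow> sphere_gap p (g z) \<le> B * cmod (1 - z)"
proof -
  obtain a b c d C' p' where Det: "a * d - b * c \<noteq> 0" and C': "dini_smooth_plane C'" "p' \<in> C'"
    and p': "moebius_sphere a b c d p = Some p'"
    and Ciff: "\<And>z. Some z \<in> C \<longleftrightarrow> c * z + d \<noteq> 0 \<and> (a * z + b) / (c * z + d) \<in> C'"
    using dini_smooth_jordan_curve_chart[OF C] by metis
  note side = plane_curve_sides[OF C'(1)]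
  have comp: "Some ` S \<subseteq> K" if S: "connected S" "\<And>z. z \<in> S \<Longrightarrow> Some z \<notin> C" "z \<in> S" "Some z \<in> K" for S z
  proof (rule connected_components_of_maximal[OF K(1)])
    show "connectedin (subtopology riemann_sphere (- C)) (Some ` S)"
      using S(1,2) by (auto simp: connectedin_subtopology connectedin_sphere_Some)
    show "\<not> disjnt K (Some ` S)" using S(3,4) by (auto simp: disjnt_iff)
  qed
  have KC: "K \<inter> C = {}" using connected_components_of_subset[OF K(1)] by auto
  have "K \<noteq> {}" using nonempty_connected_components_of[OF K(1)] .
  then obtain z0 where z0: "Some z0 \<in> K" using K(2) by blast
  \<comment> \<open>a component is open, so it also contains a point that is not sent to infinity\<close>
  obtain z1 where z1: "Some z1 \<in> K" "c * z1 + d \<noteq> 0"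
  proof (cases "c * z0 + d = 0")
    case False
    then show ?thesis using that z0 by blast
  next
    case True
    have c0: "c \<noteq> 0" using True Det by auto
    have n0: "a * z0 + b \<noteq> 0"
    proof
      assume "a * z0 + b = 0"
      then have "(a * z0 + b) * c - (c * z0 + d) * a = 0" using True by simp
      then show False using Det by (simp add: algebra_simps)
    qed
    obtain R where R: "\<And>y. y \<in> C' \<Longrightarrow> cmod y \<le> R" using compact_imp_bounded[OF side(1)] by (auto simp: bounded_iff)
    have "open {z. R * cmod (c * z + d) < cmod (a * z + b)}" by (intro open_Collect_less continuous_intros)
    moreover have "z0 \<in> {z. R * cmod (c * z + d) < cmod (a * z + b)}" using True n0 by simp
    ultimately obtain r where r: "0 < r" "ball z0 r \<subseteq> {z. R * cmod (c * z + d) < cmod (a * z + b)}"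
      using open_contains_ball by blast
    have "Some z \<notin> C" if "z \<in> ball z0 r" for z
    proof
      assume "Some z \<in> C"
      then have "c * z + d \<noteq> 0" "cmod ((a * z + b) / (c * z + d)) \<le> R" using Ciff R by auto
      then have "cmod (a * z + b) \<le> R * cmod (c * z + d)" by (simp add: norm_divide divide_le_eq)
      then show False using that r(2) by auto
    qed
    then have "Some ` ball z0 r \<subseteq> K" using r(1) by (intro comp[of _ z0] z0 connected_ball) auto
    moreover have "z0 + of_real (r / 2) \<in> ball z0 r" using r(1) by (simp add: dist_norm)
    moreover have "c * (z0 + of_real (r / 2)) + d = c * of_real (r / 2)"
    proof -
      have "c * (z0 + x) + d = (c * z0 + d) + c * x" for x by (simp add: algebra_simps)
      then show ?thesis using True by simp
    qed
    ultimately show ?thesis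
    proof (intro that[of "z0 + of_real (r / 2)"])
      assume "Some ` ball z0 r \<subseteq> K" "z0 + of_real (r / 2) \<in> ball z0 r"
      then show "Some (z0 + of_real (r / 2)) \<in> K" by blast
      assume "c * (z0 + of_real (r / 2)) + d = c * of_real (r / 2)"
      then show "c * (z0 + of_real (r / 2)) + d \<noteq> 0" using c0 r(1) by (simp only:) simp
    qed
  qed
  define w1 where "w1 = (a * z1 + b) / (c * z1 + d)"
  have "w1 \<notin> C'" using Ciff[of z1] z1 KC by (auto simp: w1_def)
  then obtain W where W: "W = inside C' \<or> W = outside C'" "w1 \<in> W" using side(7) by blast
  have Wo: "open W" "connected W" using W(1) side(2-5) by auto
  have WC: "W \<inter> C' = {}" using W(1) side(7) by blast
  define m where "m w = (d * w - b) / (a - c * w)" for w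
  define W' where "W' = {w \<in> W. - c * w + a \<noteq> 0}"
  have m1: "c * m w + d \<noteq> 0" "(a * m w + b) / (c * m w + d) = w" if "- c * w + a \<noteq> 0" for w
  proof -
    have n: "a - c * w \<noteq> 0" using that by simp
    have 1: "(c * m w + d) * (a - c * w) = a * d - b * c" 
      using n by (simp add: m_def distrib_right) (simp add: algebra_simps)
    have 2: "(a * m w + b) * (a - c * w) = w * (a * d - b * c)" 
      using n by (simp add: m_def distrib_right) (simp add: algebra_simps)
    show nz: "c * m w + d \<noteq> 0" using 1 Det by auto
    have "(a * m w + b) * (a - c * w) = w * (c * m w + d) * (a - c * w)" using 1 2 by (simp add: mult.assoc)
    then have "a * m w + b = w * (c * m w + d)" using n by simp
    then show "(a * m w + b) / (c * m w + d) = w" using nz by simp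
  qed
  have w1W: "w1 \<in> W'" "m w1 = z1"
  proof -
    have wz: "w1 * (c * z1 + d) = a * z1 + b" using z1(2) by (simp add: w1_def)
    have e1: "(a - c * w1) * (c * z1 + d) = a * d - b * c" "(d * w1 - b) * (c * z1 + d) = z1 * (a * d - b * c)"
      using wz by algebra+
    then have n: "a - c * w1 \<noteq> 0" using Det by auto
    then show "w1 \<in> W'" using W(2) by (simp add: W'_def)
    have "(d * w1 - b) * (c * z1 + d) = z1 * (a - c * w1) * (c * z1 + d)" using e1 by (simp add: mult.assoc)
    then have "d * w1 - b = z1 * (a - c * w1)" using z1(2) by simp
    then show "m w1 = z1" using n by (simp add: m_def)
  qed
  have "connected W'" unfolding W'_def by (rule connected_delete_affine_zero[OF Wo]) (use Det in auto)
  moreover have "continuous_on W' m" unfolding m_def W'_def by (intro continuous_intros) auto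
  ultimately have "connected (m ` W')" by (intro connected_continuous_image)
  then have "Some ` m ` W' \<subseteq> K"
  proof (rule comp)
    show "z1 \<in> m ` W'" using w1W by blast
    show "Some z1 \<in> K" by fact
    show "Some z \<notin> C" if zm: "z \<in> m ` W'" for z
    proof -
      obtain w where w: "w \<in> W'" "z = m w" using zm by blast
      have "w \<notin> C'" using w(1) WC by (auto simp: W'_def)
      then show ?thesis using m1[of w] w unfolding Ciff by (simp add: W'_def)
    qed
  qed
  then have mD: "m ` W' \<subseteq> D" using K(2) by blast
  have sec: "contains_dini_sector W p'" by (rule dini_curve_sector[OF C' W(1)])
  define r where "r = (if c \<noteq> 0 \<and> a / c \<noteq> p' then dist p' (a / c) else 1)"
  have r: "0 < r" by (auto simp: r_def)
  obtain g0 B where g0: "g0 holomorphic_on ball 0 1" "g0 ` ball 0 1 \<subseteq> W \<inter> ball p' r"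
    "\<And>z. z \<in> ball 0 1 \<Longrightarrow> cmod (g0 z - p') \<le> B * cmod (1 - z)"
    using inner_dini_map[OF sec r] by metis
  have gW: "g0 z \<in> W'" if zb: "z \<in> ball 0 1" for z
  proof -
    have "g0 z \<in> W \<inter> ball p' r" using g0(2) zb by blast
    then have gz: "g0 z \<in> W" "dist p' (g0 z) < r" by auto
    have "- c * g0 z + a \<noteq> 0"
    proof
      assume z: "- c * g0 z + a = 0"
      then have c0: "c \<noteq> 0" using Det by auto
      then have e: "g0 z = a / c" using z by (simp add: field_simps)
      show False
      proof (cases "a / c = p'")
        case True
        then show ?thesis using gz(1) WC C'(2) e by auto
      next
        case False
        then show ?thesis using gz(2) c0 e by (simp add: r_def)
      qed
    qed
    then show ?thesis using gz(1) by (simp add: W'_def)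
  qed
  obtain l where l: "0 < l" "\<And>z. cmod (a * z + b - p' * (c * z + d)) = l * (sphere_gap p z * (1 + cmod z))"
    using sphere_gap_moebius[OF Det p'] by metis
  define B' where "B' = (cmod c + cmod d) / l * B"
  show ?thesis
  proof (rule that[of "m \<circ> g0" B'])
    have "m holomorphic_on W'" unfolding m_def W'_def by (intro holomorphic_intros) auto
    then have "m holomorphic_on g0 ` ball 0 1" by (rule holomorphic_on_subset) (use gW in blast)
    then show "m \<circ> g0 holomorphic_on ball 0 1" by (rule holomorphic_on_compose[OF g0(1)])
    have "g0 ` ball 0 1 \<subseteq> W'" using gW by blast
    then show "(m \<circ> g0) ` ball 0 1 \<subseteq> D" unfolding image_comp[symmetric] using mD by (meson image_mono order_trans)
    fix z :: complex assume z: "z \<in> ball 0 1"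
    let ?x = "m (g0 z)"
    have nz: "- c * g0 z + a \<noteq> 0" using gW[OF z] by (simp add: W'_def)
    have "a * ?x + b = g0 z * (c * ?x + d)" using m1[OF nz] by (simp add: divide_eq_eq)
    then have "a * ?x + b - p' * (c * ?x + d) = (g0 z - p') * (c * ?x + d)" by (simp add: algebra_simps)
    then have "l * (sphere_gap p ?x * (1 + cmod ?x)) = cmod (g0 z - p') * cmod (c * ?x + d)"
      using l(2)[of ?x] by (simp add: norm_mult)
    also have "\<dots> \<le> (B * cmod (1 - z)) * ((cmod c + cmod d) * (1 + cmod ?x))"
    proof (rule mult_mono[OF g0(3)[OF z]])
      have "cmod (c * ?x + d) \<le> cmod c * cmod ?x + cmod d" by (metis norm_mult norm_triangle_ineq)
      also have "\<dots> \<le> (cmod c + cmod d) * (1 + cmod ?x)" by (simp add: algebra_simps)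
      finally show "cmod (c * ?x + d) \<le> (cmod c + cmod d) * (1 + cmod ?x)" .
      show "0 \<le> B * cmod (1 - z)" using g0(3)[OF z] norm_ge_zero order_trans by blast
    qed simp
    finally have "(l * sphere_gap p ?x) * (1 + cmod ?x) \<le> (B * cmod (1 - z) * (cmod c + cmod d)) * (1 + cmod ?x)"
      by (simp only: mult.assoc)
    moreover have "0 < 1 + cmod ?x" by (simp add: add_pos_nonneg)
    ultimately have "l * sphere_gap p ?x \<le> B * cmod (1 - z) * (cmod c + cmod d)" by (simp only: mult_le_cancel_right_pos)
    then show "sphere_gap p ((m \<circ> g0) z) \<le> B' * cmod (1 - z)"
      using l(1) by (simp add: B'_def field_simps)
  qed
qed

text \<open>In the chart \<open>T\<close> the domain lies on one side of the plane curve, so the other side \<open>W\<close> is disjoint from it. The composition \<open>M = N / E\<close> of \<open>T\<close> with the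
Moebius map of the outer construction has no pole in \<open>D\<close>, also where \<open>T\<close> has one. Since \<open>N\<close> and \<open>E\<close> are linearly independent affine
functions, \<open>1 + \<bar>z\<bar>\<close> is bounded by \<open>\<bar>N\<bar> + \<bar>E\<bar>\<close>: either \<open>E\<close> is large and \<open>\<bar>M z\<bar>\<close> is of order \<open>sphere_gap p z\<close>, or \<open>N\<close>
is large and \<open>sphere_gap p z\<close> is bounded below.\<close>
lemma outer_sphere_map:
  assumes C: "dini_smooth_jordan_curve C" "p \<in> C" and D: "open D" "connected D" "Some ` D \<inter> C = {}"
  obtains G B where "G holomorphic_on D" "G ` D \<subseteq> ball 0 1" "0 < B"
    "\<And>z. z \<in> D \<Longrightarrow> 1 - cmod (G z) \<le> B * sphere_gap p z"
proof -
  obtain a b c d C' p' where Det: "a * d - b * c \<noteq> 0" and C': "dini_smooth_plane C'" "p' \<in> C'"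
    and p': "moebius_sphere a b c d p = Some p'"
    and Ciff: "\<And>z. Some z \<in> C \<longleftrightarrow> c * z + d \<noteq> 0 \<and> (a * z + b) / (c * z + d) \<in> C'"
    using dini_smooth_jordan_curve_chart[OF C] by metis
  note side = plane_curve_sides[OF C'(1)]
  define V where "V = {z \<in> D. c * z + d \<noteq> 0}"
  define Q where "Q = (\<lambda>z. (a * z + b) / (c * z + d)) ` V"
  have "connected V" unfolding V_def by (rule connected_delete_affine_zero[OF D(1,2)]) (use Det in auto)
  then have Qc: "connected Q" unfolding Q_def by (intro connected_continuous_image continuous_intros) (auto simp: V_def)
  have QC: "Q \<inter> C' = {}" using D(3) Ciff unfolding Q_def V_def by blast
  have "inside C' \<inter> Q = {} \<or> outside C' \<inter> Q = {}"
    by (rule connectedD[OF Qc side(2,3)]) (use QC side(6,7) in blast)+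
  then obtain W where W: "W = inside C' \<or> W = outside C'" "W \<inter> Q = {}" by blast
  have sec: "contains_dini_sector W p'" by (rule dini_curve_sector[OF C' W(1)])
  obtain u h X where u: "u \<noteq> 0" and h: "h holomorphic_on X" "\<i> \<in> X"
    "\<And>s. s \<in> X \<Longrightarrow> cmod (h s) < 1" "\<And>s. s \<in> X \<Longrightarrow> 1 - cmod (h s) \<le> 4 * cmod s"
    "\<And>q. q \<noteq> 0 \<Longrightarrow> p' + u * q \<notin> W \<Longrightarrow> 1 - \<i> * q \<noteq> 0 \<and> q / (1 - \<i> * q) \<in> X"
    using outer_dini_map[OF sec] by metis
  obtain l where l: "0 < l" "\<And>z. cmod (a * z + b - p' * (c * z + d)) = l * (sphere_gap p z * (1 + cmod z))"
    using sphere_gap_moebius[OF Det p'] by metis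
  define N where "N z = a * z + b - p' * (c * z + d)" for z
  define E where "E z = u * (c * z + d) - \<i> * N z" for z
  define M where "M z = N z / E z" for z
  have N0: "N z \<noteq> 0" if "z \<in> D" for z
  proof -
    have "p \<noteq> Some z" using that D(3) C(2) by blast
    then have "0 < sphere_gap p z" by (rule sphere_gap_pos)
    then have "0 < l * (sphere_gap p z * (1 + cmod z))" using l(1) by (intro mult_pos_pos add_pos_nonneg) auto
    then have "0 < cmod (N z)" using l(2)[of z] by (simp add: N_def)
    then show ?thesis by simp
  qed
  have EM: "E z \<noteq> 0 \<and> M z \<in> X" if z: "z \<in> D" for z
  proof (cases "c * z + d = 0")
    case True
    then have "E z = - \<i> * N z" by (simp add: E_def)
    moreover from this have "M z = \<i>" using N0[OF z] by (simp add: M_def field_simps)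
    ultimately show ?thesis using N0[OF z] h(2) by simp
  next
    case False
    define q where "q = N z / (u * (c * z + d))"
    have q0: "q \<noteq> 0" using N0[OF z] u False by (simp add: q_def)
    have "u * q = N z / (c * z + d)" using u by (simp add: q_def)
    then have "p' + u * q = (a * z + b) / (c * z + d)" using False by (simp add: N_def diff_divide_distrib)
    also have "\<dots> \<notin> W" using W(2) False z by (auto simp: Q_def V_def)
    finally have k: "1 - \<i> * q \<noteq> 0" "q / (1 - \<i> * q) \<in> X" using h(5)[OF q0] by auto
    have uq: "u * (c * z + d) * q = N z" using u False by (simp add: q_def)
    have Ez: "E z = u * (c * z + d) * (1 - \<i> * q)" unfolding E_def uq[symmetric] by (simp add: algebra_simps)
    have "M z = q / (1 - \<i> * q)" unfolding M_def Ez uq[symmetric] using u False by simp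
    then show ?thesis using k u False Ez by simp
  qed
  define \<Delta> where "\<Delta> = cmod (a * d - b * c)"
  have D0: "0 < \<Delta>" using Det by (simp add: \<Delta>_def)
  define k1 where "k1 = cmod d + cmod c"
  define k2 where "k2 = cmod (d * p' - b) + cmod (a - c * p')"
  define k where "k = (k1 + k2 / cmod u + 1) / \<Delta>"
  have kp: "0 < k" unfolding k_def k1_def k2_def using D0 by (intro divide_pos_pos add_nonneg_pos add_nonneg_nonneg) auto
  have lower: "1 + cmod z \<le> k * (cmod (N z) + cmod (E z))" for z
  proof -
    have 1: "(a * d - b * c) * z = d * N z + (d * p' - b) * (c * z + d)" by (simp add: N_def algebra_simps)
    have 2: "a * d - b * c = (a - c * p') * (c * z + d) - c * N z" by (simp add: N_def algebra_simps)
    have "cmod ((a * d - b * c) * z) \<le> cmod d * cmod (N z) + cmod (d * p' - b) * cmod (c * z + d)"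
      unfolding 1 by (metis norm_mult norm_triangle_ineq)
    then have "\<Delta> * cmod z \<le> cmod d * cmod (N z) + cmod (d * p' - b) * cmod (c * z + d)" by (simp add: \<Delta>_def norm_mult)
    moreover have "\<Delta> \<le> cmod (a - c * p') * cmod (c * z + d) + cmod c * cmod (N z)"
      unfolding \<Delta>_def by (subst 2) (metis norm_mult norm_triangle_ineq4)
    ultimately have "\<Delta> * (1 + cmod z) \<le> k1 * cmod (N z) + k2 * cmod (c * z + d)"
      by (simp add: k1_def k2_def algebra_simps)
    also have "k2 * cmod (c * z + d) \<le> k2 * ((cmod (E z) + cmod (N z)) / cmod u)"
    proof (rule mult_left_mono)
      have "u * (c * z + d) = E z + \<i> * N z" by (simp add: E_def)
      then have "cmod u * cmod (c * z + d) \<le> cmod (E z) + cmod (N z)"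
        using norm_triangle_ineq[of "E z" "\<i> * N z"] by (metis norm_mult norm_ii mult_1)
      then show "cmod (c * z + d) \<le> (cmod (E z) + cmod (N z)) / cmod u" using u by (simp add: le_divide_eq mult.commute)
      show "0 \<le> k2" by (simp add: k2_def)
    qed
    also have "k1 * cmod (N z) + k2 * ((cmod (E z) + cmod (N z)) / cmod u) \<le> (k1 + k2 / cmod u + 1) * (cmod (N z) + cmod (E z))"
      using u by (simp add: algebra_simps add_divide_distrib k1_def)
    finally show ?thesis using D0 by (simp add: k_def field_simps)
  qed
  define B where "B = 8 * k * l + 2 * k * l"
  show ?thesis
  proof (rule that[of "\<lambda>z. h (M z)" B])
    have "M holomorphic_on D" unfolding M_def E_def N_def
      by (intro holomorphic_intros) (use EM in \<open>auto simp: E_def N_def\<close>)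
    then have "h \<circ> M holomorphic_on D"
      by (rule holomorphic_on_compose[OF _ holomorphic_on_subset[OF h(1)]]) (use EM in auto)
    then show "(\<lambda>z. h (M z)) holomorphic_on D" by (simp add: o_def)
    show "(\<lambda>z. h (M z)) ` D \<subseteq> ball 0 1" using h(3) EM by auto
    show "0 < B" using kp l(1) by (simp add: B_def)
    fix z assume z: "z \<in> D"
    have Nl: "cmod (N z) = l * (sphere_gap p z * (1 + cmod z))" using l(2)[of z] by (simp add: N_def)
    have z1: "0 < 1 + cmod z" by (simp add: add_pos_nonneg)
    have s0: "0 \<le> sphere_gap p z" by (rule sphere_gap_nonneg)
    show "1 - cmod (h (M z)) \<le> B * sphere_gap p z"
    proof (cases "1 + cmod z \<le> 2 * k * cmod (E z)")
      case True
      have Ep: "0 < cmod (E z)" using EM[OF z] by simp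
      have "cmod (M z) = l * sphere_gap p z * (1 + cmod z) / cmod (E z)" by (simp add: M_def norm_divide Nl)
      also have "\<dots> \<le> l * sphere_gap p z * (2 * k * cmod (E z)) / cmod (E z)"
        using True l(1) s0 by (intro divide_right_mono mult_left_mono) auto
      also have "\<dots> = 2 * k * l * sphere_gap p z" using Ep by simp
      finally have "4 * cmod (M z) \<le> 8 * k * l * sphere_gap p z" by simp
      also have "\<dots> \<le> B * sphere_gap p z" unfolding B_def using s0 kp l(1) by (intro mult_right_mono) auto
      finally show ?thesis using h(4) EM[OF z] by (meson order_trans)
    next
      case False
      then have "1 + cmod z \<le> 2 * k * cmod (N z)" using lower[of z] by (simp add: algebra_simps)
      then have "1 * (1 + cmod z) \<le> (2 * k * l * sphere_gap p z) * (1 + cmod z)" unfolding Nl by (simp add: mult.assoc)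
      then have "1 \<le> 2 * k * l * sphere_gap p z" using z1 by (simp only: mult_le_cancel_right_pos)
      also have "\<dots> \<le> B * sphere_gap p z" unfolding B_def using s0 kp l(1) by (intro mult_right_mono) auto
      finally show ?thesis using norm_ge_zero[of "h (M z)"] by linarith
    qed
  qed
qed

section \<open>Chordal admissibility\<close>

lemma riemann_map:
  assumes D: "simply_connected_domain D" "D \<noteq> UNIV"
  obtains f g where "f holomorphic_on D" "g holomorphic_on ball 0 1"
    "\<And>z. z \<in> D \<Longrightarrow> f z \<in> ball 0 1 \<and> g (f z) = z" "\<And>z. z \<in> ball 0 1 \<Longrightarrow> g z \<in> D \<and> f (g z) = z"
  using D Riemann_mapping_theorem[of D] unfolding simply_connected_domain_def by blast

text \<open>The order of the choices matters: first the inner map \<open>g\<close> and the preimages of the points \<open>g (r n)\<close> in the disc, whose limit \<open>\<zeta>0\<close>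
determines the prime end; then, for each \<open>t\<close>, the outer map and the Riemann map. The domain \<open>\<Omega> 0\<close> itself is treated like the others.\<close>
theorem theorem6p1:
  fixes \<Omega> :: "real \<Rightarrow> complex set" and p :: "complex option"
  assumes "L_admissible \<Omega>"
    and "p \<in> boundary_inf (\<Omega> 0)"
    and "\<exists>C. dini_smooth_jordan_curve C \<and> p \<in> C \<and>
           (\<exists>K \<in> connected_components_of (subtopology riemann_sphere (- C)). K \<subseteq> Some ` \<Omega> 0)"
    and "\<forall>t>0. \<exists>C. dini_smooth_jordan_curve C \<and> p \<in> C \<and> Some ` \<Omega> t \<inter> C = {}"
  shows "chordally_admissible \<Omega>"
proof -
  have scd: "simply_connected_domain (\<Omega> t)" "\<Omega> t \<noteq> UNIV" "\<Omega> 0 \<subseteq> \<Omega> t" if "0 \<le> t" for t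
    using assms(1) that unfolding L_admissible_def L_admissible_of_order_def by blast+
  obtain g B where g: "g holomorphic_on ball 0 1" "g ` ball 0 1 \<subseteq> \<Omega> 0"
    "\<And>z. z \<in> ball 0 1 \<Longrightarrow> sphere_gap p (g z) \<le> B * cmod (1 - z)"
    using assms(3) inner_sphere_map by metis
  have outer: "\<exists>G B. G holomorphic_on \<Omega> t \<and> G ` \<Omega> t \<subseteq> ball 0 1 \<and> 0 < B \<and> (\<forall>z\<in>\<Omega> t. 1 - cmod (G z) \<le> B * sphere_gap p z)"
    if t: "0 \<le> t" for t
  proof -
    \<comment> \<open>a curve outside \<open>\<Omega> 1\<close> is also outside \<open>\<Omega> 0\<close>\<close>
    define s where "s = (if t = 0 then 1 else t)"
    have s: "0 < s" "t \<le> s" using t by (auto simp: s_def)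
    obtain C where C: "dini_smooth_jordan_curve C" "p \<in> C" "Some ` \<Omega> s \<inter> C = {}" using assms(4) s by blast
    have "open (\<Omega> s)" "connected (\<Omega> s)" using scd(1)[of s] s by (auto simp: simply_connected_domain_def)
    then obtain G B where G: "G holomorphic_on \<Omega> s" "G ` \<Omega> s \<subseteq> ball 0 1" "0 < B"
      "\<And>z. z \<in> \<Omega> s \<Longrightarrow> 1 - cmod (G z) \<le> B * sphere_gap p z"
      using outer_sphere_map[OF C(1,2) _ _ C(3)] by metis
    have "\<Omega> t \<subseteq> \<Omega> s" using scd(3)[of s] s t by (auto simp: s_def split: if_splits)
    then show ?thesis using G holomorphic_on_subset[OF G(1)] by (intro exI[of _ G] exI[of _ B]) auto
  qed
  have growth: "\<exists>A>0. \<forall>r. 0 \<le> r \<longrightarrow> r < 1 \<longrightarrow> 1 - cmod (\<phi> (g (of_real r))) \<le> A * (1 - r)"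
    if t: "0 \<le> t" and \<phi>: "\<phi> holomorphic_on \<Omega> t" "\<phi>' holomorphic_on ball 0 1"
      "\<And>z. z \<in> \<Omega> t \<Longrightarrow> \<phi> z \<in> ball 0 1 \<and> \<phi>' (\<phi> z) = z" "\<And>z. z \<in> ball 0 1 \<Longrightarrow> \<phi>' z \<in> \<Omega> t \<and> \<phi> (\<phi>' z) = z" for t \<phi> \<phi>'
  proof -
    obtain G Bt where G: "G holomorphic_on \<Omega> t" "G ` \<Omega> t \<subseteq> ball 0 1" "0 < Bt" "\<And>z. z \<in> \<Omega> t \<Longrightarrow> 1 - cmod (G z) \<le> Bt * sphere_gap p z"
      using outer[OF t] by blast
    have sub: "\<phi>' ` ball 0 1 \<subseteq> \<Omega> t" using \<phi>(4) by blast
    have v: "G \<circ> \<phi>' holomorphic_on ball 0 1" "(G \<circ> \<phi>') ` ball 0 1 \<subseteq> ball 0 1"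
    proof -
      show "G \<circ> \<phi>' holomorphic_on ball 0 1"
        by (rule holomorphic_on_compose[OF \<phi>(2) holomorphic_on_subset[OF G(1) sub]])
      show "(G \<circ> \<phi>') ` ball 0 1 \<subseteq> ball 0 1"
        unfolding image_comp[symmetric] using G(2) sub by (meson image_mono order_trans)
    qed
    obtain k where k: "0 < k" "\<And>z. cmod z < 1 \<Longrightarrow> k * (1 - cmod z) \<le> 1 - cmod ((G \<circ> \<phi>') z)"
      using Schwarz_Pick_boundary_growth[OF v] by metis
    have "1 - cmod (\<phi> (g (of_real r))) \<le> (Bt * \<bar>B\<bar> / k + 1) * (1 - r)" if r: "0 \<le> r" "r < 1" for r
    proof -
      have rb: "of_real r \<in> ball (0::complex) 1" using r by simp
      define z where "z = g (of_real r)"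
      have "z \<in> \<Omega> 0" unfolding z_def using g(2) rb by blast
      then have z: "z \<in> \<Omega> t" using scd(3)[OF t] by blast
      have "k * (1 - cmod (\<phi> z)) \<le> 1 - cmod (G z)" using k(2)[of "\<phi> z"] \<phi>(3)[OF z] by simp
      also have "\<dots> \<le> Bt * sphere_gap p z" by (rule G(4)[OF z])
      also have "\<dots> \<le> Bt * (\<bar>B\<bar> * (1 - r))"
      proof (rule mult_left_mono)
        have "cmod (1 - of_real r) = 1 - r" using r by (metis abs_of_nonneg diff_ge_0_iff_ge less_imp_le norm_of_real of_real_1 of_real_diff)
        then have "sphere_gap p z \<le> B * (1 - r)" using g(3)[OF rb] by (simp add: z_def)
        also have "\<dots> \<le> \<bar>B\<bar> * (1 - r)" using r by (intro mult_right_mono) auto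
        finally show "sphere_gap p z \<le> \<bar>B\<bar> * (1 - r)" .
      qed (use G(3) in simp)
      finally have "1 - cmod (\<phi> z) \<le> Bt * \<bar>B\<bar> / k * (1 - r)" using k(1) by (simp add: field_simps)
      also have "\<dots> \<le> (Bt * \<bar>B\<bar> / k + 1) * (1 - r)" using r by (intro mult_right_mono) auto
      finally show ?thesis by (simp add: z_def)
    qed
    moreover have "0 < Bt * \<bar>B\<bar> / k + 1" using G(3) k(1) by (intro add_nonneg_pos divide_nonneg_pos mult_nonneg_nonneg) auto
    ultimately show ?thesis by blast
  qed
  obtain f' f where f: "f' holomorphic_on \<Omega> 0" "f holomorphic_on ball 0 1"
    "\<And>z. z \<in> \<Omega> 0 \<Longrightarrow> f' z \<in> ball 0 1 \<and> f (f' z) = z" "\<And>z. z \<in> ball 0 1 \<Longrightarrow> f z \<in> \<Omega> 0 \<and> f' (f z) = z"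
    by (rule riemann_map[OF scd(1,2)[OF order_refl]]) (rule that)
  \<comment> \<open>the points \<open>g (r n)\<close> do not depend on \<open>t\<close>, so neither does the limit \<open>\<zeta>0\<close> of their preimages\<close>
  define r where "r n = 1 - 1 / (real n + 2)" for n :: nat
  have r: "0 \<le> r n" "r n < 1" for n by (auto simp: r_def divide_simps)
  have rl: "(\<lambda>n. 1 - r n) \<longlonglongrightarrow> 0" unfolding r_def by real_asymp
  define \<zeta> where "\<zeta> n = f' (g (of_real (r n)))" for n
  have gz: "g (of_real (r n)) \<in> \<Omega> 0" for n using g(2) r[of n] by (auto simp: image_subset_iff)
  have zb: "cmod (\<zeta> n) < 1" for n using f(3)[OF gz[of n]] by (simp add: \<zeta>_def)
  have fz: "f (\<zeta> n) = g (of_real (r n))" for n using f(3)[OF gz[of n]] by (simp add: \<zeta>_def)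
  obtain A0 where A0: "\<And>n. 1 - cmod (\<zeta> n) \<le> A0 * (1 - r n)"
    using growth[OF order_refl f] r unfolding \<zeta>_def by blast
  obtain c1 where c1: "0 < c1" "\<And>n. c1 * (1 - r n) \<le> 1 - cmod (\<zeta> n)"
  proof -
    have v: "f' \<circ> g holomorphic_on ball 0 1" "(f' \<circ> g) ` ball 0 1 \<subseteq> ball 0 1"
    proof -
      show "f' \<circ> g holomorphic_on ball 0 1"
        by (rule holomorphic_on_compose[OF g(1) holomorphic_on_subset[OF f(1) g(2)]])
      have "f' ` \<Omega> 0 \<subseteq> ball 0 1" using f(3) by blast
      then show "(f' \<circ> g) ` ball 0 1 \<subseteq> ball 0 1"
        unfolding image_comp[symmetric] using g(2) by (meson image_mono order_trans)
    qed
    obtain k where k: "0 < k" "\<And>z. cmod z < 1 \<Longrightarrow> k * (1 - cmod z) \<le> 1 - cmod ((f' \<circ> g) z)"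
      using Schwarz_Pick_boundary_growth[OF v] by metis
    have "k * (1 - r n) \<le> 1 - cmod (\<zeta> n)" for n using k(2)[of "of_real (r n)"] r[of n] by (simp add: \<zeta>_def)
    then show ?thesis using that k(1) by blast
  qed
  obtain \<zeta>0 \<sigma> where \<sigma>: "strict_mono \<sigma>" "(\<lambda>n. \<zeta> (\<sigma> n)) \<longlonglongrightarrow> \<zeta>0"
  proof -
    have "\<And>n. \<zeta> n \<in> cball 0 1" using zb by (simp add: less_imp_le)
    then show ?thesis using compact_cball[of "0::complex" 1, unfolded compact_def, rule_format, of \<zeta>] that
      by (auto simp: o_def)
  qed
  have z0: "cmod \<zeta>0 = 1"
  proof (rule antisym)
    show "cmod \<zeta>0 \<le> 1" by (rule LIMSEQ_le_const2[OF tendsto_norm[OF \<sigma>(2)]]) (use zb less_imp_le in blast)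
    have "(\<lambda>n. 1 - cmod (\<zeta> (\<sigma> n))) \<longlonglongrightarrow> 1 - cmod \<zeta>0" by (intro tendsto_intros \<sigma>(2))
    moreover have "(\<lambda>n. A0 * (1 - r (\<sigma> n))) \<longlonglongrightarrow> A0 * 0"
      using LIMSEQ_subseq_LIMSEQ[OF rl \<sigma>(1)] by (intro tendsto_intros) (simp add: o_def)
    ultimately have "1 - cmod \<zeta>0 \<le> A0 * 0" by (rule LIMSEQ_le) (use A0 in blast)
    then show "1 \<le> cmod \<zeta>0" by simp
  qed
  have finj: "inj_on f (ball 0 1)" using f(4) by (metis inj_on_inverseI)
  have fim: "f ` ball 0 1 = \<Omega> 0"
  proof
    show "f ` ball 0 1 \<subseteq> \<Omega> 0" using f(4) by blast
    show "\<Omega> 0 \<subseteq> f ` ball 0 1" using f(3) by (metis imageI subsetI)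
  qed
  obtain C0 where C0: "null_chain (\<Omega> 0) C0" "cofinal_seqs (\<lambda>n. f ` disc_nbhd \<zeta>0 n) (chain_domain (\<Omega> 0) C0)"
    using exists_null_chain_at[OF f(2) finj z0] unfolding fim by metis
  let ?P = "null_chain_equiv (\<Omega> 0) `` {C0}"
  have "conformally_embedded (\<Omega> 0) (\<Omega> t) ?P" if t: "0 \<le> t" for t
  proof -
    obtain \<phi> \<phi>' where \<phi>: "\<phi> holomorphic_on \<Omega> t" "\<phi>' holomorphic_on ball 0 1"
      "\<And>z. z \<in> \<Omega> t \<Longrightarrow> \<phi> z \<in> ball 0 1 \<and> \<phi>' (\<phi> z) = z" "\<And>z. z \<in> ball 0 1 \<Longrightarrow> \<phi>' z \<in> \<Omega> t \<and> \<phi> (\<phi>' z) = z"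
      by (rule riemann_map[OF scd(1,2)[OF t]]) (rule that)
    have "inj_on \<phi> (\<Omega> t)" using \<phi>(3) by (metis inj_on_inverseI)
    moreover have "\<phi> ` \<Omega> t = ball 0 1"
    proof
      show "\<phi> ` \<Omega> t \<subseteq> ball 0 1" using \<phi>(3) by blast
      show "ball 0 1 \<subseteq> \<phi> ` \<Omega> t" using \<phi>(4) by (metis imageI subsetI)
    qed
    ultimately have conf: "conformal_onto \<phi> (\<Omega> t) (ball 0 1)" and inj: "inj_on \<phi> (\<Omega> 0)"
      using \<phi>(1) inj_on_subset[OF _ scd(3)[OF t]] by (auto simp: conformal_onto_def bij_betw_def)
    define \<psi> where "\<psi> = \<phi> \<circ> f"
    have psi: "\<psi> holomorphic_on ball 0 1" "inj_on \<psi> (ball 0 1)" "\<psi> ` ball 0 1 = \<phi> ` \<Omega> 0" "\<psi> ` ball 0 1 \<subseteq> ball 0 1"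
    proof -
      show "\<psi> holomorphic_on ball 0 1" unfolding \<psi>_def
        by (rule holomorphic_on_compose[OF f(2) holomorphic_on_subset[OF \<phi>(1)]]) (use fim scd(3)[OF t] in blast)
      show "inj_on \<psi> (ball 0 1)" unfolding \<psi>_def using finj inj fim by (intro comp_inj_on) auto
      show im: "\<psi> ` ball 0 1 = \<phi> ` \<Omega> 0" unfolding \<psi>_def image_comp[symmetric] fim ..
      show "\<psi> ` ball 0 1 \<subseteq> ball 0 1" unfolding im using \<phi>(3) scd(3)[OF t] by blast
    qed
    obtain At where At: "0 < At" "\<And>n. 1 - cmod (\<phi> (g (of_real (r n)))) \<le> At * (1 - r n)"
      using growth[OF t \<phi>] r by blast
    have est: "1 - cmod (\<psi> (\<zeta> (\<sigma> n))) \<le> At / c1 * (1 - cmod (\<zeta> (\<sigma> n)))" for n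
    proof -
      have "1 - cmod (\<psi> (\<zeta> (\<sigma> n))) \<le> At * (1 - r (\<sigma> n))" using At(2) by (simp add: \<psi>_def fz)
      also have "1 - r (\<sigma> n) \<le> (1 - cmod (\<zeta> (\<sigma> n))) / c1" using c1 by (simp add: le_divide_eq mult.commute)
      finally show ?thesis using At(1) by (simp add: mult_left_mono)
    qed
    obtain z1 l where z1: "cmod z1 = 1" "angular_lim \<psi> \<zeta>0 z1" "angular_lim (\<lambda>z. (\<psi> z - z1) / (z - \<zeta>0)) \<zeta>0 l"
      by (rule Julia_Wolff[OF psi(1,4) z0 zb \<sigma>(2) est])
    obtain C' where C': "null_chain (\<phi> ` \<Omega> 0) C'" "cofinal_seqs (\<lambda>n. \<psi> ` disc_nbhd \<zeta>0 n) (chain_domain (\<phi> ` \<Omega> 0) C')"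
      using exists_null_chain_at[OF psi(1,2) z0] unfolding psi(3) by metis
    have pe1: "pe_map \<phi> (\<Omega> 0) ?P = null_chain_equiv (\<phi> ` \<Omega> 0) `` {C'}"
      by (rule pe_map_null_chain_class[OF C0 C'(1)]) (use C'(2) in \<open>simp add: \<psi>_def\<close>)
    have pe2: "pe_map \<psi> (ball 0 1) (disc_prime_end \<zeta>0) = null_chain_equiv (\<phi> ` \<Omega> 0) `` {C'}"
      using pe_map_disc_prime_end[OF z0, of \<psi> C'] C' unfolding psi(3) by blast
    have "conformally_embedded_in_disc (\<phi> ` \<Omega> 0) (pe_map \<phi> (\<Omega> 0) ?P)"
      unfolding conformally_embedded_in_disc_def pe1
    proof (intro conjI exI)
      show "null_chain_equiv (\<phi> ` \<Omega> 0) `` {C'} \<in> prime_ends (\<phi> ` \<Omega> 0)" by (rule null_chain_class_in_prime_ends[OF C'(1)])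
      show "conformal_onto \<psi> (ball 0 1) (\<phi> ` \<Omega> 0)" using psi by (simp add: conformal_onto_def bij_betw_def)
      show "\<zeta>0 \<in> sphere 0 1" "z1 \<in> sphere 0 1" using z0 z1(1) by auto
    qed (fact pe2 z1)+
    then show ?thesis unfolding conformally_embedded_def using conf by blast
  qed
  moreover have "?P \<in> prime_ends (\<Omega> 0)" by (rule null_chain_class_in_prime_ends[OF C0(1)])
  ultimately show ?thesis unfolding chordally_admissible_def using assms(1) by blast
qed

end
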